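(* Let $n$ be a positive integer and let $W\subseteq R_{(1,n)}$ be a basepoint free subspace of dimension three. Then $\mathbb P(W)\cap\Sigma_{1,n}$ is a smooth conic if and only if $I_W$ has the bigraded Betti numbers given by a minimal bigraded free resolution of the form $$0\leftarrow I_W\leftarrow R(-1,-n)^3\leftarrow\begin{array}{c}R(-1,-3n)\\ \oplus\\ R(-2,-2n)^3\\ \oplus\\ R(-3,-n)\end{array}\leftarrow\begin{array}{c}R(-2,-3n)^2\\ \oplus\\ R(-3,-2n)^2\end{array}\leftarrow R(-3,-3n)\leftarrow0 .$$
   Context: $\mathbb K$ is a field, and $R=\mathbb K[s,t;u,v]$ is $\mathbb Z^2$-graded with $\deg s=\deg t=(1,0)$, $\deg u=\deg v=(0,1)$. For $W=\operatorname{Span}\{f_0,f_1,f_2\}$, $I_W=\langle f_0,f_1,f_2\rangle$; $W$ is basepoint free if $\sqrt{I_W}=\langle s,t\rangle\cap\langle u,v\rangle$. $\Sigma_{1,n}\subset\mathbb P(R_{(1,n)})=\mathbb P^{2n+1}$ is the Segre variety of factorizable polynomials, i.e. the image of $\mathbb P(R_{(1,0)})\times\mathbb P(R_{(0,n)})=\mathbb P^1\times\mathbb P^n$ under multiplication $(l,g)\mapsto lg$. The bigraded Betti numbers of $I_W$ record how many copies of each $R(-\mathbf a)$, $\mathbf a\in\mathbb Z^2$, appear in each step of the minimal bigraded free resolution. *)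

theory Defs
  imports
    "HOL-Library.Poly_Mapping"
    "HOL-Library.Multiset"
    "HOL-Library.Product_Plus"
    "HOL-Algebra.Algebraic_Closure_Type"
    "Jordan_Normal_Form.Matrix_Kernel"
begin

section \<open>The bigraded ring $R = K[s,t;u,v]$\<close>

datatype bivar = VS | VT | VU | VV

text \<open>The order on the variables only serves to make \<open>R\<close> an instance of class \<open>idom\<close>.\<close>

fun bivar_index :: "bivar \<Rightarrow> nat" where
  "bivar_index VS = 0" | "bivar_index VT = 1" | "bivar_index VU = 2" | "bivar_index VV = 3"

instantiation bivar :: linorder
begin

definition less_eq_bivar :: "bivar \<Rightarrow> bivar \<Rightarrow> bool" where
  "less_eq_bivar x y \<longleftrightarrow> bivar_index x \<le> bivar_index y"

definition less_bivar :: "bivar \<Rightarrow> bivar \<Rightarrow> bool" where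
  "less_bivar x y \<longleftrightarrow> bivar_index x < bivar_index y"

instance
proof
  fix x y :: bivar
  assume "x \<le> y" "y \<le> x"
  then show "x = y"
    by (cases x; cases y) (auto simp: less_eq_bivar_def)
qed (auto simp: less_eq_bivar_def less_bivar_def)

end

type_synonym 'k bipoly = "(bivar \<Rightarrow>\<^sub>0 nat) \<Rightarrow>\<^sub>0 'k"

definition var :: "bivar \<Rightarrow> 'k::field bipoly" where
  "var x = Poly_Mapping.single (Poly_Mapping.single x 1) 1"

definition const :: "'k::field \<Rightarrow> 'k bipoly" where
  "const c = Poly_Mapping.single 0 c"

definition bideg :: "(bivar \<Rightarrow>\<^sub>0 nat) \<Rightarrow> int \<times> int" where
  "bideg m = (int (Poly_Mapping.lookup m VS + Poly_Mapping.lookup m VT),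
     int (Poly_Mapping.lookup m VU + Poly_Mapping.lookup m VV))"

text \<open>The graded piece $R_{\mathbf a}$, which is zero unless both components of \<open>a\<close> are
  non-negative.\<close>

definition homog :: "int \<times> int \<Rightarrow> 'k::field bipoly set" where
  "homog a = {p. \<forall>m \<in> Poly_Mapping.keys p. bideg m = a}"

definition scale :: "'k::field \<Rightarrow> 'k bipoly \<Rightarrow> 'k bipoly" where
  "scale c p = const c * p"

lemma vector_space_scale: "Vector_Spaces.vector_space (scale :: 'k::field \<Rightarrow> 'k bipoly \<Rightarrow> 'k bipoly)"
  by unfold_locales
    (simp_all add: scale_def const_def algebra_simps single_add mult_single
      flip: mult.assoc single_one)

definition lin_span :: "'k::field bipoly set \<Rightarrow> 'k bipoly set" where
  "lin_span = Modules.module.span scale"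

definition lin_dim :: "'k::field bipoly set \<Rightarrow> nat" where
  "lin_dim = Vector_Spaces.vector_space.dim scale"


section \<open>Ideals and basepoint freeness\<close>

lemma module_times: "Modules.module ((*) :: 'a::comm_ring_1 \<Rightarrow> 'a \<Rightarrow> 'a)"
  by unfold_locales (simp_all add: algebra_simps)

definition ideal_gen :: "'a::comm_ring_1 set \<Rightarrow> 'a set" where
  "ideal_gen = Modules.module.span (*)"

definition radical :: "'a::comm_ring_1 set \<Rightarrow> 'a set" where
  "radical I = {p. \<exists>k::nat. p ^ k \<in> I}"

definition basepoint_free :: "'k::field bipoly set \<Rightarrow> bool" where
  "basepoint_free W \<longleftrightarrow>
     radical (ideal_gen W) = ideal_gen {var VS, var VT} \<inter> ideal_gen {var VU, var VV}"


section \<open>The intersection of $P(W)$ with the Segre variety\<close>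

text \<open>
  Projective varieties are represented by the nonzero vectors of their affine cones, and by their
  points over the algebraic closure: over an arbitrary field \<open>K\<close> (finite, say, or the reals) the
  \<open>K\<close>-rational points do not determine \<open>P(W) \<inter> \<Sigma>\<close>.
\<close>

definition segre :: "nat \<Rightarrow> 'k::field bipoly set" where
  "segre n = {l * g | l g. l \<in> homog (1, 0) \<and> g \<in> homog (0, int n)} - {0}"

definition base_change :: "'k::field bipoly \<Rightarrow> 'k alg_closure bipoly" where
  "base_change p = Poly_Mapping.map to_ac p"

text \<open>$P(W) \cap \Sigma_{1,n}$ in the homogeneous coordinates on $P(W)$ given by the basis \<open>fs\<close>
  of \<open>W\<close>. As \<open>0\<close> is not in \<open>segre n\<close>, neither is the zero vector in this set.\<close>

definition segre_section :: "nat \<Rightarrow> 'k::field bipoly list \<Rightarrow> 'k alg_closure vec set" where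
  "segre_section n fs =
     {x \<in> carrier_vec (length fs).
        (\<Sum>i<length fs. scale (x $ i) (base_change (fs ! i))) \<in> segre n}"

text \<open>
  A matrix \<open>A\<close>, not necessarily symmetric, represents the quadratic form $x^T A x$; in this way
  every ternary quadratic form arises in every characteristic. Its gradient is $(A + A^T) x$, so
  the last clause is the Jacobian criterion. It forces the form to be nonzero, since
  the zero form has all points of the plane as singular zeros.
\<close>

definition smooth_conic :: "'k::field alg_closure vec set \<Rightarrow> bool" where
  "smooth_conic C \<longleftrightarrow>
     (\<exists>A \<in> carrier_mat 3 3. let B = map_mat (to_ac :: 'k \<Rightarrow> 'k alg_closure) A in
        C = {x \<in> carrier_vec 3. x \<noteq> 0\<^sub>v 3 \<and> x \<bullet> (B *\<^sub>v x) = 0} \<and>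
        (\<forall>x \<in> C. (B + transpose_mat B) *\<^sub>v x \<noteq> 0\<^sub>v 3))"


section \<open>Minimal bigraded free resolutions\<close>

text \<open>
  A list \<open>[a\<^sub>1, \<dots>, a\<^sub>r]\<close> of bidegrees stands for the free module
  $R(-a_1) \oplus \dots \oplus R(-a_r)$. A degree-preserving homomorphism
  $\bigoplus_k R(-b_k) \to \bigoplus_j R(-a_j)$ is a matrix whose \<open>(j,k)\<close> entry lies in
  $R_{b_k - a_j}$.
\<close>

definition graded_map :: "(int \<times> int) list \<Rightarrow> (int \<times> int) list \<Rightarrow> 'k::field bipoly mat \<Rightarrow> bool" where
  "graded_map b a M \<longleftrightarrow>
     M \<in> carrier_mat (length a) (length b) \<and>
     (\<forall>j<length a. \<forall>k<length b. M $$ (j, k) \<in> homog (b ! k - a ! j))"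

text \<open>
  A resolution $0 \leftarrow I \leftarrow F_0 \leftarrow F_1 \leftarrow \dots$ of the ideal \<open>I\<close>,
  where $F_i$ has the list of bidegrees \<open>a i\<close>. The augmentation $F_0 \to I \subseteq R$ is the
  row matrix \<open>d 0\<close>, and \<open>d (Suc i)\<close> is the map $F_{i+1} \to F_i$.
\<close>

definition bigraded_free_resolution ::
  "'k::field bipoly set \<Rightarrow> (nat \<Rightarrow> (int \<times> int) list) \<Rightarrow> (nat \<Rightarrow> 'k bipoly mat) \<Rightarrow> bool" where
  "bigraded_free_resolution I a d \<longleftrightarrow>
     graded_map (a 0) [(0, 0)] (d 0) \<and>
     (\<forall>i. graded_map (a (Suc i)) (a i) (d (Suc i))) \<and>
     (\<lambda>x. (d 0 *\<^sub>v x) $ 0) ` carrier_vec (length (a 0)) = I \<and>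
     (\<forall>i. mat_kernel (d i) = (\<lambda>x. d (Suc i) *\<^sub>v x) ` carrier_vec (length (a (Suc i))))"

text \<open>Minimality: the image of each $F_{i+1} \to F_i$ lies in $\langle s,t,u,v\rangle F_i$.\<close>

definition minimal_bigraded_free_resolution ::
  "'k::field bipoly set \<Rightarrow> (nat \<Rightarrow> (int \<times> int) list) \<Rightarrow> (nat \<Rightarrow> 'k bipoly mat) \<Rightarrow> bool" where
  "minimal_bigraded_free_resolution I a d \<longleftrightarrow>
     bigraded_free_resolution I a d \<and>
     (\<forall>i. elements_mat (d (Suc i)) \<subseteq> ideal_gen {var VS, var VT, var VU, var VV})"

text \<open>\<open>F ! i\<close> is the multiset of all $\mathbf a$ such that $R(-\mathbf a)$ is a summand of the \<open>i\<close>-th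
  module of a minimal resolution; the modules beyond the end of the list \<open>F\<close> are zero.\<close>

definition has_bigraded_betti :: "'k::field bipoly set \<Rightarrow> (int \<times> int) multiset list \<Rightarrow> bool" where
  "has_bigraded_betti I F \<longleftrightarrow>
     (\<exists>a d. minimal_bigraded_free_resolution I a d \<and>
        (\<forall>i. mset (a i) = (if i < length F then F ! i else {#})))"

end

theory Submission
  imports Defs
begin

text \<open>
  Both sides of the equivalence say that \<open>W\<close> has a basis \<open>s g\<^sub>0, t g\<^sub>0 + s g\<^sub>1, t g\<^sub>1\<close>, where \<open>g\<^sub>0, g\<^sub>1\<close>
  are linearly independent forms of degree \<open>n\<close> in \<open>u, v\<close>.

  Such a basis gives a smooth conic, because the element with coordinates \<open>y\<close> is
  \<open>s (y\<^sub>0 g\<^sub>0 + y\<^sub>1 g\<^sub>1) + t (y\<^sub>1 g\<^sub>0 + y\<^sub>2 g\<^sub>1)\<close>. It factors if and only if the two forms in \<open>u, v\<close> are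
  proportional, that is, \<open>y\<^sub>0 y\<^sub>2 = y\<^sub>1\<^sup>2\<close> (\<open>smooth_conic_if_bilinear_form\<close>). It also gives
  the resolution. Basepoint freeness makes \<open>g\<^sub>0, g\<^sub>1\<close> a regular sequence, and \<open>I\<^sub>W\<close> comes from the ideal
  \<open>(s x, t x + s y, t y)\<close> by substituting \<open>g\<^sub>0, g\<^sub>1\<close> for \<open>x, y\<close>. The resolution of that ideal is
  explicit and symmetric in the pairs \<open>(s, t)\<close> and \<open>(x, y)\<close>, and its exactness uses nothing about
  \<open>x, y\<close> except regularity (\<open>betti_of_bilinear\<close>).

  Conversely, the basis can be read off from first syzygies. A syzygy of bidegree \<open>(2, 0)\<close> on a
  basis of \<open>W\<close> is the same as a relation \<open>s\<^sup>2 F\<^sub>0 + s t F\<^sub>1 + t\<^sup>2 F\<^sub>2 = 0\<close> with \<open>F\<^sub>i \<in> W\<close>. It forces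
  \<open>F\<^sub>0 = t g\<^sub>1\<close>, \<open>F\<^sub>2 = s g\<^sub>0\<close> and \<open>F\<^sub>1 = - (t g\<^sub>0 + s g\<^sub>1)\<close>. If \<open>g\<^sub>0, g\<^sub>1\<close> were dependent, then \<open>W\<close> would
  contain \<open>s g\<close> and \<open>t g\<close> for some \<open>g \<noteq> 0\<close>, which is a syzygy of bidegree \<open>(1, 0)\<close>. So one syzygy of
  bidegree \<open>(2, 0)\<close> and the absence of syzygies of bidegree \<open>(1, 0)\<close> suffice (\<open>bilinear_form\<close>).

  The Betti numbers supply both conditions: \<open>(3, n)\<close> occurs among the degrees of first syzygies, and
  none of these degrees is at most \<open>(2, n)\<close> in both components (\<open>smooth_conic_if_betti\<close>). A smooth conic supplies them
  as follows. A syzygy of bidegree \<open>(1, 0)\<close> would put the line spanned by \<open>s g, t g\<close> on the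
  conic (\<open>no_linear_syzygy\<close>). For the other condition, choose over the algebraic closure two
  points \<open>P, R\<close> of the conic, not joined by a tangent, and the pole \<open>S\<close> of the line through them.
  In these coordinates the conic is \<open>a b + \<kappa> c\<^sup>2 = 0\<close>. The minors that detect factorizable
  elements of \<open>W\<close> are quadratic forms that vanish on the conic, hence multiples of this equation. It
  follows that \<open>P = l g\<close>, \<open>R = k h\<close>, and that \<open>S\<close> is a combination of \<open>k g\<close> and \<open>l h\<close>; multiplying by
  \<open>l k\<close> expresses \<open>l k S\<close> by \<open>k\<^sup>2 P\<close> and \<open>l\<^sup>2 R\<close>, which is a syzygy of bidegree \<open>(2, 0)\<close>
  (\<open>quadratic_syzygy_of_conic_frame\<close>). A \<open>K\<close>-linear functional on the closure, applied to all
  coefficients, carries it to a syzygy over \<open>K\<close> (\<open>descend_quadratic_syzygy\<close>).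
\<close>

section \<open>Coefficients, bidegrees, and division by a variable\<close>

abbreviation coef :: "'k::field bipoly \<Rightarrow> (bivar \<Rightarrow>\<^sub>0 nat) \<Rightarrow> 'k" where
  "coef p m \<equiv> Poly_Mapping.lookup p m"

abbreviation expo :: "(bivar \<Rightarrow>\<^sub>0 nat) \<Rightarrow> bivar \<Rightarrow> nat" where
  "expo m x \<equiv> Poly_Mapping.lookup m x"

abbreviation mvar :: "bivar \<Rightarrow> (bivar \<Rightarrow>\<^sub>0 nat)" where
  "mvar x \<equiv> Poly_Mapping.single x 1"

lemma coef_single_mult:
  "coef (Poly_Mapping.single a c * p) (a + m) = c * coef p m"
proof -
  have "coef (Poly_Mapping.single a c * p) (a + m) =
     (\<Sum>l. Poly_Mapping.lookup (Poly_Mapping.single a c) l * (\<Sum>q. coef p q when a + m = l + q))"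
    by (simp add: lookup_mult)
  also have "\<dots> = (\<Sum>l. (c * (\<Sum>q. coef p q when a + m = l + q)) when l = a)"
    by (intro arg_cong[of _ _ Sum_any] ext) (auto simp: lookup_single when_def)
  also have "\<dots> = c * (\<Sum>q. coef p q when q = m)"
    by simp
  finally show ?thesis by simp
qed

lemma coef_scale [simp]: "coef (scale c p) m = c * coef p m"
  using coef_single_mult[of 0 c p m] by (simp add: scale_def const_def)

lemma coef_var_mult: "coef (var x * p) (mvar x + m) = coef p m"
  by (simp add: var_def coef_single_mult)

lemma coef_var_mult_0:
  assumes "expo m x = 0"
  shows "coef (var x * p) m = 0"
proof (rule ccontr)
  assume "coef (var x * p) m \<noteq> 0"
  then have "m \<in> Poly_Mapping.keys (var x * p)"
    by (simp add: in_keys_iff)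
  then obtain b where "m = mvar x + b"
    using keys_mult[of "var x" p] by (auto simp: var_def)
  with assms show False
    by (simp add: lookup_add)
qed

lemma mon_split:
  assumes "expo m x \<noteq> 0"
  obtains m' where "m = mvar x + m'"
proof
  show "m = mvar x + (m - mvar x)"
  proof (rule poly_mapping_eqI)
    fix y
    show "expo m y = expo (mvar x + (m - mvar x)) y"
      using assms by (auto simp: lookup_add lookup_minus lookup_single when_def)
  qed
qed

lemma homogI: "(\<And>m. coef p m \<noteq> 0 \<Longrightarrow> bideg m = a) \<Longrightarrow> p \<in> homog a"
  by (auto simp: homog_def in_keys_iff)

lemma homogD: "p \<in> homog a \<Longrightarrow> coef p m \<noteq> 0 \<Longrightarrow> bideg m = a"
  by (auto simp: homog_def in_keys_iff)

lemma homog_0 [simp]: "0 \<in> homog a"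
  by (simp add: homog_def)

lemma homog_add: "p \<in> homog a \<Longrightarrow> q \<in> homog a \<Longrightarrow> p + q \<in> homog a"
  using keys_add[of p q] by (auto simp: homog_def)

lemma homog_uminus [simp]: "- p \<in> homog a \<longleftrightarrow> p \<in> homog a"
  by (simp add: homog_def in_keys_iff)

lemma homog_diff: "p \<in> homog a \<Longrightarrow> q \<in> homog a \<Longrightarrow> p - q \<in> homog a"
  using homog_add[of p a "- q"] by simp

lemma homog_scale: "p \<in> homog a \<Longrightarrow> scale c p \<in> homog a"
  by (auto intro!: homogI dest: homogD)

lemma bideg_add: "bideg (m + m') = bideg m + bideg m'"
  by (simp add: bideg_def lookup_add)

lemma coef_mult_nonzero:
  assumes "coef (p * q) m \<noteq> 0"
  obtains a b where "m = a + b" "coef p a \<noteq> 0" "coef q b \<noteq> 0"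
  using assms keys_mult[of p q] unfolding in_keys_iff[symmetric] by blast

lemma homog_mult:
  assumes "p \<in> homog a" "q \<in> homog b" "c = a + b"
  shows "p * q \<in> homog c"
proof (rule homogI)
  fix m assume "coef (p * q) m \<noteq> 0"
  then obtain m1 m2 where "m = m1 + m2" "coef p m1 \<noteq> 0" "coef q m2 \<noteq> 0"
    by (rule coef_mult_nonzero)
  with assms show "bideg m = c"
    by (simp add: bideg_add homogD)
qed

fun vdeg :: "bivar \<Rightarrow> int \<times> int" where
  "vdeg VS = (1, 0)" | "vdeg VT = (1, 0)" | "vdeg VU = (0, 1)" | "vdeg VV = (0, 1)"

lemma bideg_mvar: "bideg (mvar x) = vdeg x"
  by (cases x) (simp_all add: bideg_def lookup_single)

lemma var_homog: "var x \<in> homog (vdeg x)"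
  by (cases x) (simp_all add: homog_def var_def bideg_mvar flip: One_nat_def)

definition free :: "bivar \<Rightarrow> 'k::field bipoly \<Rightarrow> bool" where
  "free x p \<longleftrightarrow> (\<forall>m. coef p m \<noteq> 0 \<longrightarrow> expo m x = 0)"

lemma free_0 [simp]: "free x 0"
  by (simp add: free_def)

lemma free_uminus [simp]: "free x (- p) \<longleftrightarrow> free x p"
  by (simp add: free_def)

lemma free_add: "free x p \<Longrightarrow> free x q \<Longrightarrow> free x (p + q)"
  unfolding free_def lookup_add by (metis add_cancel_right_left)

lemma free_diff: "free x p \<Longrightarrow> free x q \<Longrightarrow> free x (p - q)"
  using free_add[of x p "- q"] by simp

lemma free_mult:
  assumes "free x p" "free x q"
  shows "free x (p * q)"
  unfolding free_def
proof (intro allI impI)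
  fix m assume "coef (p * q) m \<noteq> 0"
  then obtain a b where "m = a + b" "coef p a \<noteq> 0" "coef q b \<noteq> 0"
    by (rule coef_mult_nonzero)
  with assms show "expo m x = 0"
    by (simp add: free_def lookup_add)
qed

lemma free_var: "x \<noteq> y \<Longrightarrow> free x (var y)"
  by (auto simp: free_def var_def lookup_single when_def split: if_splits)

lemma free_homog:
  assumes "p \<in> homog (0, b)"
  shows "free VS p" "free VT p"
  using assms by (auto simp: free_def bideg_def dest!: homogD)

text \<open>
  Quotient and remainder collect the terms divisible and not divisible by the variable, so they
  inherit the bidegree of \<open>p\<close> and every variable missing from \<open>p\<close> is missing from them. All
  divisibility arguments below reduce to this lemma and the uniqueness in \<open>free_unique\<close>.
\<close>

lemma var_division:
  fixes p :: "'k::field bipoly"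
  obtains q r where "p = var x * q + r" "free x r"
    "\<And>a. p \<in> homog a \<Longrightarrow> q \<in> homog (a - vdeg x) \<and> r \<in> homog a"
    "\<And>y. free y p \<Longrightarrow> free y q \<and> free y r"
proof -
  \<comment> \<open>Precomposing the coefficient function with multiplication by the variable divides by it.\<close>
  define q where "q = Poly_Mapping.map_key ((+) (mvar x)) p"
  define r where "r = p - var x * q"
  have inj: "inj ((+) (mvar x))"
    by (rule injI) simp
  have coef_q: "coef q m = coef p (mvar x + m)" for m
    using inj by (simp add: q_def map_key.rep_eq)
  have coef_r: "coef r m = (if expo m x = 0 then coef p m else 0)" for m
  proof (cases "expo m x = 0")
    case True
    then show ?thesis
      by (simp add: r_def lookup_minus coef_var_mult_0)
  next
    case False
    then obtain m' where "m = mvar x + m'"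
      by (rule mon_split)
    with False show ?thesis
      by (simp add: r_def lookup_minus coef_var_mult coef_q del: One_nat_def)
  qed
  show thesis
  proof
    show "p = var x * q + r"
      by (simp add: r_def)
    show "free x r"
      by (auto simp: free_def coef_r split: if_splits)
    fix a assume "p \<in> homog a"
    note p = homogD[OF this]
    show "q \<in> homog (a - vdeg x) \<and> r \<in> homog a"
    proof
      show "q \<in> homog (a - vdeg x)"
      proof (rule homogI)
        fix m assume "coef q m \<noteq> 0"
        then have "bideg (mvar x + m) = a"
          by (intro p) (simp add: coef_q del: One_nat_def)
        then show "bideg m = a - vdeg x"
          by (auto simp: bideg_add bideg_mvar simp del: One_nat_def)
      qed
      show "r \<in> homog a"
        by (rule homogI) (auto simp: coef_r intro: p split: if_splits)
    qed
  next
    fix y assume "free y p"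
    then show "free y q \<and> free y r"
      unfolding free_def coef_q coef_r
      by (metis add_is_0 lookup_add)
  qed
qed

lemma free_var_mult_iff: "free x (var x * p) \<longleftrightarrow> p = 0"
proof
  assume *: "free x (var x * p)"
  show "p = 0"
  proof (rule poly_mapping_eqI)
    fix m
    have "expo (mvar x + m) x \<noteq> 0"
      by (simp add: lookup_add)
    moreover have "coef (var x * p) (mvar x + m) \<noteq> 0 \<longrightarrow> expo (mvar x + m) x = 0"
      using * unfolding free_def by (rule spec)
    ultimately have "coef (var x * p) (mvar x + m) = 0"
      by argo
    then show "coef p m = coef 0 m"
      by (simp add: coef_var_mult del: One_nat_def)
  qed
qed simp

lemma var_nonzero [simp]: "(var x :: 'k::field bipoly) \<noteq> 0"
  using keys_single[of "mvar x" "1 :: 'k"] unfolding var_def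
  by (metis insert_not_empty keys_zero zero_neq_one)

lemma free_unique:
  assumes "var x * q + r = 0" "free x r"
  shows "q = 0" "r = 0"
proof -
  have "var x * q = - r"
    using assms(1) by (simp add: eq_neg_iff_add_eq_0)
  with assms(2) have "free x (var x * q)" by simp
  then show "q = 0" by (simp add: free_var_mult_iff)
  with assms(1) show "r = 0" by simp
qed

lemma bideg_nonneg: "fst (bideg m) \<ge> 0" "snd (bideg m) \<ge> 0"
  by (simp_all add: bideg_def)

lemma homog_st_split:
  assumes "p \<in> homog (i, j)" "i > 0"
  obtains a b where "p = var VS * a + var VT * b" "a \<in> homog (i - 1, j)" "b \<in> homog (i - 1, j)"
proof -
  obtain a r where a: "p = var VS * a + r" "free VS r" "a \<in> homog (i - 1, j)" "r \<in> homog (i, j)"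
    using var_division[of p VS] assms(1) by (metis diff_Pair diff_zero vdeg.simps(1))
  obtain b r' where b: "r = var VT * b + r'" "free VT r'" "b \<in> homog (i - 1, j)" "r' \<in> homog (i, j)"
      "free VS r'"
    using var_division[of r VT] a(2,4) by (metis diff_Pair diff_zero vdeg.simps(2))
  have "r' = 0"
  proof (rule poly_mapping_eqI, rule ccontr)
    fix m assume "coef r' m \<noteq> coef 0 m"
    then have "expo m VS = 0" "expo m VT = 0" "bideg m = (i, j)"
      using b by (auto simp: free_def dest: homogD)
    with assms(2) show False by (simp add: bideg_def)
  qed
  with a b show thesis by (intro that[of a b]) simp_all
qed

lemma st_independent:
  assumes "var VS * a + var VT * b = 0" "a \<in> homog (0, j)" "b \<in> homog (0, j)"
  shows "a = 0" "b = 0"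
proof -
  have f: "free VS (var VT * b)"
    using assms(3) by (intro free_mult free_var free_homog) simp_all
  show "a = 0" using free_unique[OF assms(1) f] by simp
  show "b = 0" using free_unique[OF assms(1) f] by simp
qed
lemma bideg_eq_0: assumes "bideg m = (0, 0)" shows "m = 0"
proof (rule poly_mapping_eqI)
  fix x
  have "int (expo m VS + expo m VT) = 0" "int (expo m VU + expo m VV) = 0" using assms unfolding bideg_def by blast+
  then have "expo m VS = 0" "expo m VT = 0" "expo m VU = 0" "expo m VV = 0" by linarith+
  then show "expo m x = expo 0 x" by (cases x) simp_all
qed

lemma homog_00_const:
  assumes "p \<in> homog (0, 0)"
  obtains c where "p = const c"
proof
  show "p = const (coef p 0)"
  proof (rule poly_mapping_eqI)
    fix m
    show "coef p m = coef (const (coef p 0)) m"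
    proof (cases "m = 0")
      case False
      then have "coef p m = 0"
        using homogD[OF assms] bideg_eq_0 by blast
      with False show ?thesis
        by (simp add: const_def lookup_single)
    qed (simp add: const_def)
  qed
qed

section \<open>Syzygies of the ideal \<open>(sx, tx + sy, ty)\<close>\<close>

text \<open>
  The parts of the statement ``\<open>s, t, x, y\<close> is a regular sequence in every order'' that make the
  complex below exact. Its matrices only involve \<open>s, t, x, y\<close>, so these may be arbitrary
  ring elements.
\<close>

locale bilinear_regular =
  fixes s t x y :: "'a::idom"
  assumes koszul_st: "\<And>a b. s * a + t * b = 0 \<Longrightarrow> \<exists>h. a = t * h \<and> b = - s * h"
    and koszul_xy: "\<And>a b. x * a + y * b = 0 \<Longrightarrow> \<exists>h. a = y * h \<and> b = - x * h"
    and s_mod_xy: "\<And>h a b. s * h = x * a + y * b \<Longrightarrow> \<exists>c d. h = x * c + y * d"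
    and t_mod_xy: "\<And>h a b. t * h = x * a + y * b \<Longrightarrow> \<exists>c d. h = x * c + y * d"
    and t_mod_sxy: "\<And>h a b c. t * h = x * a + y * b + s * c \<Longrightarrow> \<exists>a b c. h = x * a + y * b + s * c"
    and x_mod_st: "\<And>h a b. x * h = s * a + t * b \<Longrightarrow> \<exists>c d. h = s * c + t * d"
    and x_mod_s: "\<And>h a. x * h = s * a \<Longrightarrow> \<exists>c. h = s * c"
    and x_mod_t: "\<And>h a. x * h = t * a \<Longrightarrow> \<exists>c. h = t * c"
    and y_mod_s: "\<And>h a. y * h = s * a \<Longrightarrow> \<exists>c. h = s * c"
    and nonzero: "s \<noteq> 0" "t \<noteq> 0" "x \<noteq> 0" "y \<noteq> 0"
begin

text \<open>
  A relation between the three generators is \<open>s A + t B = 0\<close> with \<open>A = a x + b y\<close> and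
  \<open>B = b x + c y\<close>, so \<open>A = t h\<close> and \<open>B = - s h\<close>. Here \<open>h\<close> lies in \<open>(x, y)\<close>, since \<open>t\<close> is not a zero
  divisor modulo \<open>(x, y)\<close>. Solving for \<open>a, b, c\<close> by the Koszul relation of \<open>x, y\<close> leaves one
  compatibility condition, an element of \<open>(s, t) \<inter> (x, y)\<close>; this intersection is the product of the
  two ideals.
\<close>

lemma syzygies_0:
  assumes "a * (s * x) + b * (t * x + s * y) + c * (t * y) = 0"
  shows "\<exists>c1 c2 k01 k02 k12.
    a = t\<^sup>2 * c1 + y\<^sup>2 * c2 + (t * x + s * y) * k01 + t * y * k02 \<and>
    b = - s * t * c1 - x * y * c2 - s * x * k01 + t * y * k12 \<and>
    c = s\<^sup>2 * c1 + x\<^sup>2 * c2 - s * x * k02 - (t * x + s * y) * k12"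
proof -
  have "s * (a * x + b * y) + t * (b * x + c * y) = 0"
    using assms by (simp add: algebra_simps)
  from koszul_st[OF this] obtain h where h: "a * x + b * y = t * h" "b * x + c * y = - s * h"
    by blast
  obtain h1 h2 where h12: "h = x * h1 + y * h2"
    using t_mod_xy[of h a b] h(1) by (auto simp: algebra_simps)
  have "x * (a - t * h1) + y * (b - t * h2) = 0"
    using h(1) by (simp add: h12 algebra_simps)
  from koszul_xy[OF this] obtain m where m: "a - t * h1 = y * m" "b - t * h2 = - x * m"
    by blast
  have "x * (b + s * h1) + y * (c + s * h2) = 0"
  proof -
    have "x * (b + s * h1) + y * (c + s * h2) = (b * x + c * y) + s * (x * h1 + y * h2)"
      by (simp add: algebra_simps)
    then show ?thesis
      using h(2) by (simp add: h12[symmetric])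
  qed
  from koszul_xy[OF this] obtain m' where m': "b + s * h1 = y * m'" "c + s * h2 = - x * m'"
    by blast
  have eq: "t * h2 = x * m + y * m' + s * (- h1)"
  proof -
    have "t * h2 = (b + s * h1) - (b - t * h2) - s * h1"
      by simp
    then show ?thesis
      unfolding m m' by simp
  qed
  from t_mod_sxy[OF this] obtain \<beta> \<delta> e where h2: "h2 = x * \<beta> + y * \<delta> + s * e"
    by blast
  have "s * (h1 + t * e) = x * (m - t * \<beta>) + y * (m' - t * \<delta>)"
    using eq by (simp add: h2 algebra_simps)
  then obtain \<alpha> \<gamma> where ag: "h1 + t * e = x * \<alpha> + y * \<gamma>"
    using s_mod_xy by blast
  have h1: "h1 = x * \<alpha> + y * \<gamma> - t * e"
    using ag by (simp add: algebra_simps)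
  have "x * (m - t * \<beta> - s * \<alpha>) + y * (m' - t * \<delta> - s * \<gamma>) = 0"
    using eq by (simp add: h2 h1 algebra_simps)
  from koszul_xy[OF this] obtain \<eta>
    where \<eta>: "m - t * \<beta> - s * \<alpha> = y * \<eta>" "m' - t * \<delta> - s * \<gamma> = - x * \<eta>"
    by blast
  have mm: "m = t * \<beta> + s * \<alpha> + y * \<eta>" "m' = t * \<delta> + s * \<gamma> - x * \<eta>"
    using \<eta> by (simp_all add: algebra_simps)
  have abc: "a = t * h1 + y * m" "b = y * m' - s * h1" "c = - x * m' - s * h2"
    using m m' by (simp_all add: algebra_simps)
  show ?thesis
    by (rule exI[of _ "- e"], rule exI[of _ \<eta>], rule exI[of _ \<alpha>], rule exI[of _ "\<beta> + \<gamma>"],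
        rule exI[of _ \<delta>]) (simp add: abc h1 h2 mm algebra_simps power2_eq_square)
qed

text \<open>
  The third equation modulo \<open>s\<close> and modulo \<open>x\<close> shows \<open>c1 \<in> (x, y)\<close> and \<open>c2 \<in> (s, t)\<close>. Subtracting a
  combination of the columns of the next matrix removes \<open>c1\<close> and \<open>c2\<close>, and the remainder
  is a relation between the Koszul syzygies of the generators, in fact a multiple of
  \<open>(t y, - (t x + s y), s x)\<close>.
\<close>

lemma syzygies_1:
  assumes "t\<^sup>2 * c1 + y\<^sup>2 * c2 + (t * x + s * y) * k01 + t * y * k02 = 0"
    and "- s * t * c1 - x * y * c2 - s * x * k01 + t * y * k12 = 0"
    and "s\<^sup>2 * c1 + x\<^sup>2 * c2 - s * x * k02 - (t * x + s * y) * k12 = 0"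
  shows "\<exists>p1 p2 p3 p4.
    c1 = x * p1 + y * p2 \<and> c2 = s * p3 + t * p4 \<and> k01 = - t * p1 - y * p3 \<and>
    k02 = s * p1 - t * p2 + x * p3 - y * p4 \<and> k12 = s * p2 + x * p4"
proof -
  have eq: "x * (t * k12 - x * c2) = s * (s * c1 - x * k02 - y * k12)"
    using assms(3) by (simp add: algebra_simps power2_eq_square)
  then obtain \<alpha> where \<alpha>: "t * k12 - x * c2 = s * \<alpha>"
    using x_mod_s by blast
  have "s * (x * \<alpha>) = s * (s * c1 - x * k02 - y * k12)"
    using eq unfolding \<alpha> by (simp add: algebra_simps)
  then have \<alpha>': "x * \<alpha> = s * c1 - x * k02 - y * k12"
    using nonzero by simp
  have "s * c1 = x * (k02 + \<alpha>) + y * k12"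
    using \<alpha>' by (simp add: algebra_simps)
  then obtain p1 p2 where c1: "c1 = x * p1 + y * p2"
    using s_mod_xy by blast
  have "x * c2 = s * (- \<alpha>) + t * k12"
    using \<alpha> by (simp add: algebra_simps)
  then obtain p3 p4 where c2: "c2 = s * p3 + t * p4"
    using x_mod_st by blast
  \<comment> \<open>What is left of the Koszul coefficients after c1 and c2 have been removed.\<close>
  define l01 where "l01 = k01 + t * p1 + y * p3"
  define l02 where "l02 = k02 - (s * p1 - t * p2 + x * p3 - y * p4)"
  define l12 where "l12 = k12 - (s * p2 + x * p4)"
  have k: "k01 = l01 - t * p1 - y * p3" "k02 = l02 + s * p1 - t * p2 + x * p3 - y * p4"
      "k12 = l12 + s * p2 + x * p4"
    by (simp_all add: l01_def l02_def l12_def)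
  have l2: "s * x * l01 = t * y * l12"
    using assms(2) unfolding c1 c2 k by (simp add: algebra_simps power2_eq_square)
  have l3: "s * x * l02 = - (t * x + s * y) * l12"
  proof -
    have "s\<^sup>2 * c1 + x\<^sup>2 * c2 - s * x * k02 - (t * x + s * y) * k12 =
        - (s * x * l02) - (t * x + s * y) * l12"
      unfolding c1 c2 k by (simp add: algebra_simps power2_eq_square)
    with assms(3) show ?thesis
      by (simp add: algebra_simps eq_neg_iff_add_eq_0 neg_eq_iff_add_eq_0)
  qed
  have "s * (x * l01) + t * (- y * l12) = 0"
    using l2 by (simp add: algebra_simps)
  from koszul_st[OF this] obtain h where h: "x * l01 = t * h" "y * l12 = s * h"
    by auto
  obtain h1 where h1: "l01 = t * h1"
    using x_mod_t[OF h(1)] by blast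
  obtain h2 where h2: "l12 = s * h2"
    using y_mod_s[OF h(2)] by blast
  have "x * h1 = h"
    using h(1) nonzero by (simp add: h1 algebra_simps)
  moreover have "y * h2 = h"
    using h(2) nonzero by (simp add: h2 algebra_simps)
  ultimately have "x * h1 + y * (- h2) = 0"
    by simp
  from koszul_xy[OF this] obtain m where m: "h1 = y * m" "h2 = x * m"
    by auto
  have "s * x * l02 = s * x * (- (t * x + s * y) * m)"
    unfolding l3 by (simp add: h2 m algebra_simps)
  then have l02: "l02 = - (t * x + s * y) * m"
    using nonzero by simp
  show ?thesis
    by (rule exI[of _ "p1 - y * m"], rule exI[of _ "p2 + x * m"], rule exI[of _ p3],
        rule exI[of _ p4]) (simp add: c1 c2 k h1 h2 m l02 algebra_simps)
qed

lemma syzygies_2: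
  assumes "x * p1 + y * p2 = 0" "s * p3 + t * p4 = 0" "- t * p1 - y * p3 = 0"
    and "s * p2 + x * p4 = 0"
  shows "\<exists>h. p1 = y * h \<and> p2 = - x * h \<and> p3 = - t * h \<and> p4 = s * h"
proof -
  obtain h where h: "p1 = y * h" "p2 = - x * h"
    using koszul_xy[OF assms(1)] by blast
  have "y * p3 = y * (- t * h)"
    using assms(3) by (simp add: h algebra_simps)
  then have "p3 = - t * h"
    using nonzero by (metis mult_left_cancel)
  moreover have "x * p4 = x * (s * h)"
    using assms(4) by (simp add: h algebra_simps)
  then have "p4 = s * h"
    using nonzero by (metis mult_left_cancel)
  ultimately show ?thesis
    using h by blast
qed

end

text \<open>
  Division by the variable \<open>z\<close> splits an equation into its parts with and without \<open>z\<close>, and an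
  element without \<open>z\<close> multiplies both parts separately. This lemma and the next four apply it to
  regularity modulo various ideals.
\<close>

lemma var_mod:
  fixes x :: "'k::field bipoly"
  assumes "free z x" "x \<noteq> 0" "x * h = var z * a"
  shows "\<exists>c. h = var z * c"
proof -
  obtain q r where h: "h = var z * q + r" "free z r"
    using var_division[of h z] by metis
  have "var z * (x * q - a) + x * r = 0"
    using assms(3) by (simp add: h algebra_simps)
  then have "x * r = 0"
    using free_unique(2) free_mult[OF assms(1) h(2)] by blast
  with h assms(2) show ?thesis by auto
qed

lemma var_mod_pair:
  fixes x y :: "'k::field bipoly"
  assumes "free z x" "free z y" "var z * h = x * a + y * b"
  shows "\<exists>c d. h = x * c + y * d"
proof -
  obtain a' ra where a: "a = var z * a' + ra" "free z ra"
    using var_division[of a z] by metis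
  obtain b' rb where b: "b = var z * b' + rb" "free z rb"
    using var_division[of b z] by metis
  have "var z * (x * a' + y * b' - h) + (x * ra + y * rb) = 0"
    using assms(3) by (simp add: a b algebra_simps)
  then have "x * a' + y * b' - h = 0"
    using free_unique(1) free_add[OF free_mult free_mult] assms(1,2) a(2) b(2) by blast
  then show ?thesis by (metis eq_iff_diff_eq_0)
qed

lemma var_mod_triple:
  fixes x y w :: "'k::field bipoly"
  assumes "free z x" "free z y" "free z w" "var z * h = x * a + y * b + w * c"
  shows "\<exists>a b c. h = x * a + y * b + w * c"
proof -
  obtain a' ra where a: "a = var z * a' + ra" "free z ra"
    using var_division[of a z] by metis
  obtain b' rb where b: "b = var z * b' + rb" "free z rb"
    using var_division[of b z] by metis
  obtain c' rc where c: "c = var z * c' + rc" "free z rc"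
    using var_division[of c z] by metis
  have "var z * (x * a' + y * b' + w * c' - h) + (x * ra + y * rb + w * rc) = 0"
    using assms(4) by (simp add: a b c algebra_simps)
  then have "x * a' + y * b' + w * c' - h = 0"
    using free_unique(1) free_add[OF free_add[OF free_mult free_mult] free_mult] assms(1-3)
      a(2) b(2) c(2) by blast
  then show ?thesis by (metis eq_iff_diff_eq_0)
qed

lemma mod_two_vars:
  fixes x :: "'k::field bipoly"
  assumes "free z x" "free w x" "z \<noteq> w" "x \<noteq> 0" "x * h = var z * a + var w * b"
  shows "\<exists>c d. h = var z * c + var w * d"
proof -
  obtain h1 r where h: "h = var z * h1 + r" "free z r"
    using var_division[of h z] by metis
  obtain h2 r2 where r: "r = var w * h2 + r2" "free w r2" "free z r2"
    using var_division[of r w] h(2) by metis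
  obtain b1 b2 where b: "b - x * h2 = var z * b1 + b2" "free z b2"
    using var_division[of "b - x * h2" z] by metis
  have b': "b = x * h2 + var z * b1 + b2"
    using b(1) by (simp add: algebra_simps)
  have "var z * (a - x * h1 + var w * b1) + (var w * b2 - x * r2) = 0"
    using assms(5) by (simp add: h r b' algebra_simps)
  moreover have "free z (var w * b2 - x * r2)"
    using assms b r by (intro free_diff free_mult free_var) auto
  ultimately have "var w * b2 + (- (x * r2)) = 0"
    using free_unique(2) by fastforce
  moreover have "free w (- (x * r2))"
    using assms r by (simp add: free_mult)
  ultimately have "x * r2 = 0"
    using free_unique(2) by fastforce
  with assms(4) h r show ?thesis by auto
qed

lemma koszul_vars:
  assumes "z \<noteq> w" "var z * a + var w * b = (0 :: 'k::field bipoly)"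
  shows "\<exists>h. a = var w * h \<and> b = - var z * h"
proof -
  obtain b' r where b: "b = var z * b' + r" "free z r"
    using var_division[of b z] by metis
  have eq: "var z * (a + var w * b') + var w * r = 0"
    using assms(2) by (simp add: b algebra_simps)
  have f: "free z (var w * r)"
    using assms(1) b(2) by (intro free_mult free_var) auto
  have "a + var w * b' = 0" "var w * r = 0"
    using free_unique[OF eq f] by auto
  then have "a = var w * (- b')" "b = - var z * (- b')"
    using b by (simp_all add: eq_neg_iff_add_eq_0)
  then show ?thesis by blast
qed

lemma free_power: "free x p \<Longrightarrow> free x (p ^ m)"
  by (induction m) (auto intro: free_mult simp: free_def[of _ 1] lookup_one when_def)

lemma power_var_mod:
  fixes H1 H2 :: "'k::field bipoly"
  assumes "z \<noteq> w" "var z ^ N * H2 = var w ^ M * H1"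
  shows "\<exists>h. H1 = var z ^ N * h"
  using assms(2)
proof (induction N arbitrary: H1 H2)
  case (Suc N)
  have pw: "free z (var w ^ M :: 'k bipoly)"
    using assms(1) by (intro free_power free_var) simp
  have "var w ^ M * H1 = var z * (var z ^ N * H2)"
    using Suc.prems by (simp add: algebra_simps)
  then obtain c where c: "H1 = var z * c"
    using var_mod[OF pw] by fastforce
  have "var z * (var z ^ N * H2) = var z * (var w ^ M * c)"
    using Suc.prems by (simp add: c algebra_simps)
  then have "var z ^ N * H2 = var w ^ M * c"
    by simp
  from Suc.IH[OF this] show ?case
    by (auto simp: c algebra_simps)
qed simp

text \<open>
  This replaces coprimality of \<open>g0, g1\<close>. If powers of two different variables lie in \<open>(g0, g1)\<close>,
  then \<open>a\<close> times each of these powers is divisible by \<open>g1\<close>, and since the two powers have no common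
  factor, \<open>a\<close> itself is.
\<close>

lemma koszul_of_powers:
  fixes g0 g1 :: "'k::field bipoly"
  assumes "z \<noteq> w" "g1 \<noteq> 0"
    and "var z ^ N = g0 * p + g1 * q" "var w ^ M = g0 * p' + g1 * q'"
    and "g0 * a + g1 * b = 0"
  shows "\<exists>h. a = g1 * h \<and> b = - g0 * h"
proof -
  have g0a: "g0 * a = - (g1 * b)"
    using assms(5) by (simp add: eq_neg_iff_add_eq_0)
  define H H' where "H = q * a - p * b" and "H' = q' * a - p' * b"
  have "var z ^ N * a = p * (g0 * a) + g1 * q * a"
    unfolding assms(3) by (simp add: algebra_simps)
  then have e1: "var z ^ N * a = g1 * H"
    unfolding g0a by (simp add: H_def algebra_simps)
  have "var w ^ M * a = p' * (g0 * a) + g1 * q' * a"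
    unfolding assms(4) by (simp add: algebra_simps)
  then have e2: "var w ^ M * a = g1 * H'"
    unfolding g0a by (simp add: H'_def algebra_simps)
  have "g1 * (var z ^ N * H') = var z ^ N * (g1 * H')"
    by (rule mult.left_commute)
  also have "\<dots> = var w ^ M * (var z ^ N * a)"
    unfolding e2[symmetric] by (rule mult.left_commute)
  also have "\<dots> = g1 * (var w ^ M * H)"
    unfolding e1 by (rule mult.left_commute)
  finally have "var z ^ N * H' = var w ^ M * H"
    using assms(2) by simp
  from power_var_mod[OF assms(1) this] obtain h where h: "H = var z ^ N * h"
    by blast
  have "var z ^ N * a = var z ^ N * (g1 * h)"
    unfolding e1 h by (rule mult.left_commute)
  then have a: "a = g1 * h"
    by simp
  have "g1 * b = g1 * (- g0 * h)"
    using g0a by (simp add: a algebra_simps)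
  with assms(2) have "b = - g0 * h"
    by (metis mult_left_cancel)
  with a show ?thesis by blast
qed

lemma bilinear_regular_bipoly:
  fixes g0 g1 :: "'k::field bipoly"
  assumes "g0 \<in> homog (0, j)" "g1 \<in> homog (0, j)" "g0 \<noteq> 0" "g1 \<noteq> 0"
    and "var VU ^ N = g0 * p + g1 * q" "var VV ^ M = g0 * p' + g1 * q'"
  shows "bilinear_regular (var VS) (var VT) g0 g1"
proof -
  note f = free_homog[OF assms(1)] free_homog[OF assms(2)]
  show ?thesis
  proof
    fix a b assume "g0 * a + g1 * b = 0"
    then show "\<exists>h. a = g1 * h \<and> b = - g0 * h"
      using koszul_of_powers[of VU VV, OF _ assms(4,5,6)] by simp
  next
    fix h a b c assume "var VT * h = g0 * a + g1 * b + var VS * c"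
    then show "\<exists>a b c. h = g0 * a + g1 * b + var VS * c"
      by (rule var_mod_triple[rotated 3]) (use f free_var in auto)
  next
    fix h a b assume "g0 * h = var VS * a + var VT * b"
    then show "\<exists>c d. h = var VS * c + var VT * d"
      by (rule mod_two_vars[rotated 4]) (use f assms in auto)
  next
    fix a b :: "'k bipoly" assume "var VS * a + var VT * b = 0"
    then show "\<exists>h. a = var VT * h \<and> b = - var VS * h"
      by (rule koszul_vars[rotated]) simp
  qed (use assms f var_mod var_mod_pair var_nonzero in \<open>blast+\<close>)
qed

section \<open>Ideals with few generators, and minimality\<close>

lemma ideal_gen_insert:
  fixes a :: "'a::comm_ring_1"
  shows "ideal_gen (insert a S) = {k * a + p | k p. p \<in> ideal_gen S}"
proof -
  interpret R: Modules.module "(*) :: 'a \<Rightarrow> 'a \<Rightarrow> 'a::comm_ring_1" by (rule module_times)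
  show ?thesis
    unfolding ideal_gen_def R.span_insert
  proof (intro equalityI subsetI)
    fix z assume "z \<in> {z. \<exists>k. z - k * a \<in> R.span S}"
    then obtain k where "z - k * a \<in> R.span S" by blast
    moreover have "z = k * a + (z - k * a)" by simp
    ultimately show "z \<in> {k * a + p | k p. p \<in> R.span S}" by blast
  next
    fix z assume "z \<in> {k * a + p | k p. p \<in> R.span S}"
    then obtain k p where "z = k * a + p" "p \<in> R.span S" by blast
    then have "z - k * a \<in> R.span S" by simp
    then show "z \<in> {z. \<exists>k. z - k * a \<in> R.span S}" by blast
  qed
qed

lemma ideal_gen_triple:
  fixes a :: "'a::comm_ring_1"
  shows "ideal_gen {a, b, c} = {p * a + q * b + r * c | p q r. True}"
proof -
  interpret R: Modules.module "(*) :: 'a \<Rightarrow> 'a \<Rightarrow> 'a::comm_ring_1" by (rule module_times)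
  have "ideal_gen {} = {0 :: 'a}" by (simp add: ideal_gen_def)
  then show ?thesis
    unfolding ideal_gen_insert by (simp add: add.assoc) blast
qed

lemma ideal_gen_lin_span:
  fixes S :: "'k::field bipoly set"
  shows "ideal_gen (lin_span S) = ideal_gen S"
proof -
  interpret R: Modules.module "(*) :: 'k bipoly \<Rightarrow> 'k bipoly \<Rightarrow> 'k bipoly" by (rule module_times)
  interpret V: Vector_Spaces.vector_space "scale :: 'k \<Rightarrow> 'k bipoly \<Rightarrow> 'k bipoly"
    by (rule vector_space_scale)
  have "p \<in> R.span S" if "p \<in> V.span S" for p
    using that
  proof (induction rule: V.span_induct_alt)
    case (step c x y)
    then show ?case
      unfolding scale_def by (blast intro: R.span_add[OF R.span_scale] R.span_base)
  qed (rule R.span_zero)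
  moreover have "S \<subseteq> V.span S" by (rule V.span_superset)
  ultimately show ?thesis
    unfolding ideal_gen_def lin_span_def
    by (metis R.span_mono R.span_span subset_antisym subsetI)
qed

text \<open>
  Together with \<open>irrelevant_coef_0\<close>, this makes minimality a condition on degrees: an entry of a
  bigraded matrix is a non-unit as soon as its bidegree is not \<open>(0, 0)\<close>.
\<close>

lemma homog_in_irrelevant:
  fixes p :: "'k::field bipoly"
  assumes "p \<in> homog a" "a \<noteq> 0"
  shows "p \<in> ideal_gen {var VS, var VT, var VU, var VV}"
proof -
  obtain q1 r1 where 1: "p = var VS * q1 + r1" "free VS r1" "r1 \<in> homog a"
    using var_division[of p VS] assms(1) by metis
  obtain q2 r2 where 2: "r1 = var VT * q2 + r2" "free VT r2" "r2 \<in> homog a" "free VS r2"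
    using var_division[of r1 VT] 1 by metis
  obtain q3 r3 where 3: "r2 = var VU * q3 + r3" "free VU r3" "r3 \<in> homog a" "free VS r3" "free VT r3"
    using var_division[of r2 VU] 2 by metis
  obtain q4 r4 where 4: "r3 = var VV * q4 + r4" "free VV r4" "r4 \<in> homog a" "free VS r4" "free VT r4"
      "free VU r4"
    using var_division[of r3 VV] 3 by metis
  have "r4 = 0"
  proof (rule poly_mapping_eqI, rule ccontr)
    fix m assume "coef r4 m \<noteq> coef 0 m"
    then have "expo m VS = 0" "expo m VT = 0" "expo m VU = 0" "expo m VV = 0" "bideg m = a"
      using 4 by (auto simp: free_def dest: homogD)
    with assms(2) show False by (simp add: bideg_def zero_prod_def)
  qed
  then have "p = q1 * var VS + (q2 * var VT + (q3 * var VU + (q4 * var VV + 0)))"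
    by (simp only: 1(1) 2(1) 3(1) 4(1)) (simp add: algebra_simps)
  moreover have "0 \<in> ideal_gen ({} :: 'k bipoly set)"
    unfolding ideal_gen_def by (rule Modules.module.span_zero[OF module_times])
  ultimately show ?thesis
    by (simp only: ideal_gen_insert) blast
qed

lemma irrelevant_coef_0:
  fixes p :: "'k::field bipoly"
  assumes "p \<in> ideal_gen {var VS, var VT, var VU, var VV}"
  shows "coef p 0 = 0"
proof -
  interpret R: Modules.module "(*) :: 'k bipoly \<Rightarrow> 'k bipoly \<Rightarrow> 'k bipoly" by (rule module_times)
  show ?thesis
    using assms unfolding ideal_gen_def
  proof (induction rule: R.span_induct_alt)
    case (step c x y)
    then obtain z where "x = var z" by blast
    then have "coef (c * x) 0 = 0"
      using coef_var_mult_0[of 0 z c] by (simp add: mult.commute)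
    with step show ?case
      by (simp add: lookup_add)
  qed simp
qed

lemma graded_map_minimal:
  assumes "graded_map b a M" "set a \<inter> set b = {}"
  shows "elements_mat M \<subseteq> ideal_gen {var VS, var VT, var VU, var VV}"
proof
  fix p assume "p \<in> elements_mat M"
  then obtain j k where jk: "j < length a" "k < length b" "p = M $$ (j, k)"
    using assms(1) by (auto simp: graded_map_def dest!: elements_matD)
  then have "b ! k - a ! j \<noteq> 0"
    using assms(2) by (metis disjoint_iff eq_iff_diff_eq_0 nth_mem)
  with jk assms(1) show "p \<in> ideal_gen {var VS, var VT, var VU, var VV}"
    by (intro homog_in_irrelevant[of _ "b ! k - a ! j"]) (auto simp: graded_map_def)
qed

lemma mat_of_rows_list_mult_vec:
  assumes "i < length rs" "length (rs ! i) = n" "v \<in> carrier_vec n"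
  shows "(mat_of_rows_list n rs *\<^sub>v v) $ i = (\<Sum>j<n. rs ! i ! j * v $ j)"
  using assms by (simp add: mat_of_rows_list_def scalar_prod_def lessThan_atLeast0)

section \<open>The resolution\<close>

lemma mat_of_rows_list_carrier: "length rs = m \<Longrightarrow> mat_of_rows_list n rs \<in> carrier_mat m n"
  by (simp add: mat_of_rows_list_def)

lemma vec3_eqI: "dim_vec v = 3 \<Longrightarrow> dim_vec w = 3 \<Longrightarrow> v $ 0 = w $ 0 \<Longrightarrow> v $ 1 = w $ 1 \<Longrightarrow>
    v $ 2 = w $ 2 \<Longrightarrow> v = (w :: 'b vec)"
  by (rule eq_vecI) (auto simp: less_Suc_eq eval_nat_numeral)

lemma vec4_eqI: "dim_vec v = 4 \<Longrightarrow> dim_vec w = 4 \<Longrightarrow> v $ 0 = w $ 0 \<Longrightarrow> v $ 1 = w $ 1 \<Longrightarrow>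
    v $ 2 = w $ 2 \<Longrightarrow> v $ 3 = w $ 3 \<Longrightarrow> v = (w :: 'b vec)"
  by (rule eq_vecI) (auto simp: less_Suc_eq eval_nat_numeral)

lemma vec5_eqI: "dim_vec v = 5 \<Longrightarrow> dim_vec w = 5 \<Longrightarrow> v $ 0 = w $ 0 \<Longrightarrow> v $ 1 = w $ 1 \<Longrightarrow>
    v $ 2 = w $ 2 \<Longrightarrow> v $ 3 = w $ 3 \<Longrightarrow> v $ 4 = w $ 4 \<Longrightarrow> v = (w :: 'b vec)"
  by (rule eq_vecI) (auto simp: less_Suc_eq eval_nat_numeral)

lemma in_kernel_iff:
  assumes M: "M \<in> carrier_mat m k"
  shows "v \<in> mat_kernel M \<longleftrightarrow> v \<in> carrier_vec k \<and> (\<forall>i<m. (M *\<^sub>v v) $ i = 0)"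
proof -
  have "M *\<^sub>v v = 0\<^sub>v m \<longleftrightarrow> (\<forall>i<m. (M *\<^sub>v v) $ i = 0)"
  proof
    assume "M *\<^sub>v v = 0\<^sub>v m"
    then show "\<forall>i<m. (M *\<^sub>v v) $ i = 0" by simp
  next
    assume "\<forall>i<m. (M *\<^sub>v v) $ i = 0"
    with M show "M *\<^sub>v v = 0\<^sub>v m"
      by (intro eq_vecI) (simp_all del: index_mult_mat_vec)
  qed
  then show ?thesis
    using M by (simp add: mat_kernel_def del: index_mult_mat_vec)
qed

text \<open>
  The columns of \<open>D1\<close> are the syzygies \<open>(t\<^sup>2, - s t, s\<^sup>2)\<close> and \<open>(y\<^sup>2, - x y, x\<^sup>2)\<close>, which are interchanged
  by swapping the pairs \<open>(s, t)\<close> and \<open>(x, y)\<close>, and the three Koszul syzygies. The columns of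
  \<open>D2\<close> write \<open>x\<close> and \<open>y\<close> times the first column, and \<open>s\<close> and \<open>t\<close> times the second, in terms of the
  Koszul syzygies. \<open>D3\<close> is the remaining relation between these four.
\<close>

context bilinear_regular
begin

definition "D0 = mat_of_rows_list 3 [[s * x, t * x + s * y, t * y]]"

definition "D1 = mat_of_rows_list 5
  [[t\<^sup>2, y\<^sup>2, t * x + s * y, t * y, 0],
   [- s * t, - x * y, - s * x, 0, t * y],
   [s\<^sup>2, x\<^sup>2, 0, - s * x, - (t * x + s * y)]]"

definition "D2 = mat_of_rows_list 4
  [[x, y, 0, 0],
   [0, 0, s, t],
   [- t, 0, - y, 0],
   [s, - t, x, - y],
   [0, s, 0, x]]"

definition "D3 = mat_of_rows_list 1 [[y], [- x], [- t], [s]]"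

lemma D_carrier [simp]:
  "D0 \<in> carrier_mat 1 3" "D1 \<in> carrier_mat 3 5" "D2 \<in> carrier_mat 5 4" "D3 \<in> carrier_mat 4 1"
  unfolding D0_def D1_def D2_def D3_def by (rule mat_of_rows_list_carrier, simp)+

lemma D0_mult:
  "v \<in> carrier_vec 3 \<Longrightarrow> (D0 *\<^sub>v v) $ 0 = v $ 0 * (s * x) + v $ 1 * (t * x + s * y) + v $ 2 * (t * y)"
  unfolding D0_def by (subst mat_of_rows_list_mult_vec) (simp_all add: eval_nat_numeral mult.commute)

lemma D1_mult:
  assumes "v \<in> carrier_vec 5"
  shows "(D1 *\<^sub>v v) $ 0 =
      t\<^sup>2 * v $ 0 + y\<^sup>2 * v $ 1 + (t * x + s * y) * v $ 2 + t * y * v $ 3" (is ?A)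
    "(D1 *\<^sub>v v) $ 1 = - s * t * v $ 0 - x * y * v $ 1 - s * x * v $ 2 + t * y * v $ 4" (is ?B)
    "(D1 *\<^sub>v v) $ 2 =
      s\<^sup>2 * v $ 0 + x\<^sup>2 * v $ 1 - s * x * v $ 3 - (t * x + s * y) * v $ 4" (is ?C)
proof -
  note * = mat_of_rows_list_mult_vec[OF _ _ assms]
  show ?A unfolding D1_def by (subst *) (simp_all add: eval_nat_numeral)
  show ?B unfolding D1_def by (subst *) (simp_all add: eval_nat_numeral)
  show ?C unfolding D1_def by (subst *) (simp_all add: eval_nat_numeral algebra_simps)
qed

lemma D2_mult:
  assumes "v \<in> carrier_vec 4"
  shows "(D2 *\<^sub>v v) $ 0 = x * v $ 0 + y * v $ 1" (is ?A)
    "(D2 *\<^sub>v v) $ 1 = s * v $ 2 + t * v $ 3" (is ?B)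
    "(D2 *\<^sub>v v) $ 2 = - t * v $ 0 - y * v $ 2" (is ?C)
    "(D2 *\<^sub>v v) $ 3 = s * v $ 0 - t * v $ 1 + x * v $ 2 - y * v $ 3" (is ?D)
    "(D2 *\<^sub>v v) $ 4 = s * v $ 1 + x * v $ 3" (is ?E)
proof -
  note * = mat_of_rows_list_mult_vec[OF _ _ assms]
  show ?A unfolding D2_def by (subst *) (simp_all add: eval_nat_numeral)
  show ?B unfolding D2_def by (subst *) (simp_all add: eval_nat_numeral)
  show ?C unfolding D2_def by (subst *) (simp_all add: eval_nat_numeral)
  show ?D unfolding D2_def by (subst *) (simp_all add: eval_nat_numeral)
  show ?E unfolding D2_def by (subst *) (simp_all add: eval_nat_numeral)
qed

lemma D3_mult:
  assumes "v \<in> carrier_vec 1"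
  shows "(D3 *\<^sub>v v) $ 0 = y * v $ 0" (is ?A)
    "(D3 *\<^sub>v v) $ 1 = - x * v $ 0" (is ?B)
    "(D3 *\<^sub>v v) $ 2 = - t * v $ 0" (is ?C)
    "(D3 *\<^sub>v v) $ 3 = s * v $ 0" (is ?D)
proof -
  note * = mat_of_rows_list_mult_vec[OF _ _ assms]
  show ?A unfolding D3_def by (subst *) (simp_all add: eval_nat_numeral)
  show ?B unfolding D3_def by (subst *) (simp_all add: eval_nat_numeral)
  show ?C unfolding D3_def by (subst *) (simp_all add: eval_nat_numeral)
  show ?D unfolding D3_def by (subst *) (simp_all add: eval_nat_numeral)
qed

end

lemma all_less_numeral:
  "(\<forall>i<1. P (i::nat)) \<longleftrightarrow> P 0"
  "(\<forall>i<3. P (i::nat)) \<longleftrightarrow> P 0 \<and> P 1 \<and> P 2"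
  "(\<forall>i<4. P (i::nat)) \<longleftrightarrow> P 0 \<and> P 1 \<and> P 2 \<and> P 3"
  "(\<forall>i<5. P (i::nat)) \<longleftrightarrow> P 0 \<and> P 1 \<and> P 2 \<and> P 3 \<and> P 4"
  by (simp_all add: eval_nat_numeral All_less_Suc conj_ac)

context bilinear_regular
begin

lemma exact_0: "mat_kernel D0 = (\<lambda>v. D1 *\<^sub>v v) ` carrier_vec 5"
proof (intro equalityI subsetI)
  fix v assume "v \<in> mat_kernel D0"
  then have v: "v \<in> carrier_vec 3" and k: "(D0 *\<^sub>v v) $ 0 = 0"
    unfolding in_kernel_iff[OF D_carrier(1)] all_less_numeral by blast+
  from syzygies_0[OF k[unfolded D0_mult[OF v]]] obtain c1 c2 k01 k02 k12 where
    c: "v $ 0 = t\<^sup>2 * c1 + y\<^sup>2 * c2 + (t * x + s * y) * k01 + t * y * k02"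
      "v $ 1 = - s * t * c1 - x * y * c2 - s * x * k01 + t * y * k12"
      "v $ 2 = s\<^sup>2 * c1 + x\<^sup>2 * c2 - s * x * k02 - (t * x + s * y) * k12"
    by blast
  define w where "w = vec_of_list [c1, c2, k01, k02, k12]"
  have w: "w \<in> carrier_vec 5" by (simp add: w_def carrier_vecI)
  have wi: "w $ 0 = c1" "w $ 1 = c2" "w $ 2 = k01" "w $ 3 = k02" "w $ 4 = k12"
    by (simp_all add: w_def vec_of_list_index eval_nat_numeral)
  have "v = D1 *\<^sub>v w"
    using v by (intro vec3_eqI)
      (simp_all add: c D1_mult[OF w] wi carrier_matD[OF D_carrier(2)] del: index_mult_mat_vec One_nat_def)
  with w show "v \<in> (\<lambda>v. D1 *\<^sub>v v) ` carrier_vec 5" by blast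
next
  fix v assume "v \<in> (\<lambda>v. D1 *\<^sub>v v) ` carrier_vec 5"
  then obtain w where w: "v = D1 *\<^sub>v w" "w \<in> carrier_vec 5" by blast
  have v: "v \<in> carrier_vec 3"
    unfolding w(1) by (rule mult_mat_vec_carrier[OF D_carrier(2) w(2)])
  moreover have "(D0 *\<^sub>v v) $ 0 = 0"
    unfolding D0_mult[OF v] unfolding w(1) D1_mult[OF w(2)]
    by (simp add: algebra_simps power2_eq_square)
  ultimately show "v \<in> mat_kernel D0"
    unfolding in_kernel_iff[OF D_carrier(1)] all_less_numeral by blast
qed

lemma exact_1: "mat_kernel D1 = (\<lambda>v. D2 *\<^sub>v v) ` carrier_vec 4"
proof (intro equalityI subsetI)
  fix v assume "v \<in> mat_kernel D1"
  then have v: "v \<in> carrier_vec 5" and k: "\<forall>i<3. (D1 *\<^sub>v v) $ i = 0"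
    unfolding in_kernel_iff[OF D_carrier(2)] by blast+
  have "(D1 *\<^sub>v v) $ 0 = 0" "(D1 *\<^sub>v v) $ 1 = 0" "(D1 *\<^sub>v v) $ 2 = 0"
    using k unfolding all_less_numeral by blast+
  from syzygies_1[OF this[unfolded D1_mult[OF v]]] obtain p1 p2 p3 p4 where
    p: "v $ 0 = x * p1 + y * p2" "v $ 1 = s * p3 + t * p4" "v $ 2 = - t * p1 - y * p3"
      "v $ 3 = s * p1 - t * p2 + x * p3 - y * p4" "v $ 4 = s * p2 + x * p4"
    by blast
  define w where "w = vec_of_list [p1, p2, p3, p4]"
  have w: "w \<in> carrier_vec 4" by (simp add: w_def carrier_vecI)
  have wi: "w $ 0 = p1" "w $ 1 = p2" "w $ 2 = p3" "w $ 3 = p4"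
    by (simp_all add: w_def vec_of_list_index eval_nat_numeral)
  have "v = D2 *\<^sub>v w"
    using v by (intro vec5_eqI)
      (simp_all add: p D2_mult[OF w] wi carrier_matD[OF D_carrier(3)] del: index_mult_mat_vec One_nat_def)
  with w show "v \<in> (\<lambda>v. D2 *\<^sub>v v) ` carrier_vec 4" by blast
next
  fix v assume "v \<in> (\<lambda>v. D2 *\<^sub>v v) ` carrier_vec 4"
  then obtain w where w: "v = D2 *\<^sub>v w" "w \<in> carrier_vec 4" by blast
  have v: "v \<in> carrier_vec 5"
    unfolding w(1) by (rule mult_mat_vec_carrier[OF D_carrier(3) w(2)])
  have "(D1 *\<^sub>v v) $ 0 = 0" "(D1 *\<^sub>v v) $ 1 = 0" "(D1 *\<^sub>v v) $ 2 = 0"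
    unfolding D1_mult[OF v] unfolding w(1) D2_mult[OF w(2)]
    by (simp_all add: algebra_simps power2_eq_square)
  with v show "v \<in> mat_kernel D1"
    unfolding in_kernel_iff[OF D_carrier(2)] all_less_numeral by blast
qed

lemma exact_2: "mat_kernel D2 = (\<lambda>v. D3 *\<^sub>v v) ` carrier_vec 1"
proof (intro equalityI subsetI)
  fix v assume "v \<in> mat_kernel D2"
  then have v: "v \<in> carrier_vec 4" and k: "\<forall>i<5. (D2 *\<^sub>v v) $ i = 0"
    unfolding in_kernel_iff[OF D_carrier(3)] by blast+
  have "(D2 *\<^sub>v v) $ 0 = 0" "(D2 *\<^sub>v v) $ 1 = 0" "(D2 *\<^sub>v v) $ 2 = 0" "(D2 *\<^sub>v v) $ 4 = 0"
    using k unfolding all_less_numeral by blast+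
  from syzygies_2[OF this[unfolded D2_mult[OF v]]] obtain h where
    h: "v $ 0 = y * h" "v $ 1 = - x * h" "v $ 2 = - t * h" "v $ 3 = s * h"
    by blast
  define w where "w = vec_of_list [h]"
  have w: "w \<in> carrier_vec 1" by (simp add: w_def carrier_vecI)
  have wi: "w $ 0 = h"
    by (simp_all add: w_def vec_of_list_index eval_nat_numeral)
  have "v = D3 *\<^sub>v w"
    using v by (intro vec4_eqI)
      (simp_all add: h D3_mult[OF w] wi carrier_matD[OF D_carrier(4)] del: index_mult_mat_vec One_nat_def)
  with w show "v \<in> (\<lambda>v. D3 *\<^sub>v v) ` carrier_vec 1" by blast
next
  fix v assume "v \<in> (\<lambda>v. D3 *\<^sub>v v) ` carrier_vec 1"
  then obtain w where w: "v = D3 *\<^sub>v w" "w \<in> carrier_vec 1" by blast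
  have v: "v \<in> carrier_vec 4"
    unfolding w(1) by (rule mult_mat_vec_carrier[OF D_carrier(4) w(2)])
  have "(D2 *\<^sub>v v) $ 0 = 0" "(D2 *\<^sub>v v) $ 1 = 0" "(D2 *\<^sub>v v) $ 2 = 0" "(D2 *\<^sub>v v) $ 3 = 0"
      "(D2 *\<^sub>v v) $ 4 = 0"
    unfolding D2_mult[OF v] unfolding w(1) D3_mult[OF w(2)]
    by (simp_all add: algebra_simps power2_eq_square)
  with v show "v \<in> mat_kernel D2"
    unfolding in_kernel_iff[OF D_carrier(3)] all_less_numeral by blast
qed

lemma exact_3: "mat_kernel D3 = {0\<^sub>v 1}"
proof (intro equalityI subsetI)
  fix v assume "v \<in> mat_kernel D3"
  then have v: "v \<in> carrier_vec 1" and k: "\<forall>i<4. (D3 *\<^sub>v v) $ i = 0"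
    unfolding in_kernel_iff[OF D_carrier(4)] by blast+
  have "(D3 *\<^sub>v v) $ 3 = 0"
    using k unfolding all_less_numeral by blast
  with nonzero have "v $ 0 = 0"
    by (simp add: D3_mult[OF v] del: index_mult_mat_vec)
  with v show "v \<in> {0\<^sub>v 1}" by (auto intro!: eq_vecI[of _ "0\<^sub>v 1"])
next
  fix v :: "'a vec" assume "v \<in> {0\<^sub>v 1}"
  then have v: "v \<in> carrier_vec 1" "v $ 0 = 0" by auto
  have "(D3 *\<^sub>v v) $ 0 = 0" "(D3 *\<^sub>v v) $ 1 = 0" "(D3 *\<^sub>v v) $ 2 = 0" "(D3 *\<^sub>v v) $ 3 = 0"
    unfolding D3_mult[OF v(1)] by (simp_all add: v)
  with v(1) show "v \<in> mat_kernel D3"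
    unfolding in_kernel_iff[OF D_carrier(4)] all_less_numeral by blast
qed

lemma image_0: "(\<lambda>v. (D0 *\<^sub>v v) $ 0) ` carrier_vec 3 = ideal_gen {s * x, t * x + s * y, t * y}"
proof -
  have "p * (s * x) + q * (t * x + s * y) + r * (t * y) \<in> (\<lambda>v. (D0 *\<^sub>v v) $ 0) ` carrier_vec 3" for p q r
  proof -
    define w where "w = vec_of_list [p, q, r]"
    have w: "w \<in> carrier_vec 3" by (simp add: w_def carrier_vecI)
    have "(D0 *\<^sub>v w) $ 0 = p * (s * x) + q * (t * x + s * y) + r * (t * y)"
      unfolding D0_mult[OF w] by (simp add: w_def vec_of_list_index eval_nat_numeral)
    with w show ?thesis by (metis (no_types, lifting) image_eqI)
  qed
  moreover have "(D0 *\<^sub>v v) $ 0 \<in> ideal_gen {s * x, t * x + s * y, t * y}" if "v \<in> carrier_vec 3" for v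
    unfolding D0_mult[OF that] ideal_gen_triple by blast
  ultimately show ?thesis
    unfolding ideal_gen_triple by blast
qed

end

lemma carrier_vec_0: "carrier_vec 0 = {vNil}"
proof (intro equalityI subsetI)
  fix v :: "'a vec" assume "v \<in> carrier_vec 0"
  then have "v = vNil" by (intro eq_vecI) simp_all
  then show "v \<in> {vNil}" by simp
qed simp

lemma zero_mat_0_mult: "0\<^sub>m m 0 *\<^sub>v vNil = (0\<^sub>v m :: 'a::semiring_0 vec)"
  by (intro eq_vecI) (simp_all add: scalar_prod_def)

lemma mat_kernel_zero_0: "mat_kernel (0\<^sub>m m 0) = {vNil :: 'a::comm_ring_1 vec}"
  unfolding mat_kernel_def index_zero_mat carrier_vec_0 using zero_mat_0_mult by auto

lemma mat_of_rows_list_index: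
  "i < length rs \<Longrightarrow> j < k \<Longrightarrow> mat_of_rows_list k rs $$ (i, j) = rs ! i ! j"
  by (simp add: mat_of_rows_list_def)

lemma graded_map_rows:
  assumes "length rs = length a" "k = length b"
    and "list_all2 (\<lambda>r \<alpha>. list_all2 (\<lambda>p \<beta>. p \<in> homog (\<beta> - \<alpha>)) r b) rs a"
  shows "graded_map b a (mat_of_rows_list k rs)"
proof -
  have "rs ! i ! j \<in> homog (b ! j - a ! i)" if "i < length a" "j < length b" for i j
    using list_all2_nthD2[OF list_all2_nthD2[OF assms(3) that(1)] that(2)] .
  then show ?thesis
    unfolding graded_map_def using mat_of_rows_list_carrier[OF assms(1)] assms(1,2)
    by (simp add: mat_of_rows_list_index)
qed

text \<open>
  With \<open>x = g0\<close> and \<open>y = g1\<close> of bidegree \<open>(0, n)\<close>, the bidegrees of the four matrices are those of the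
  claim. No bidegree occurs in two consecutive modules, whence minimality.
\<close>

lemma betti_of_bilinear:
  fixes g0 g1 :: "'k::field bipoly"
  assumes n: "n > 0" and g: "g0 \<in> homog (0, int n)" "g1 \<in> homog (0, int n)"
    and "bilinear_regular (var VS) (var VT) g0 g1"
  shows "has_bigraded_betti (ideal_gen {var VS * g0, var VT * g0 + var VS * g1, var VT * g1})
      [replicate_mset 3 (1, int n),
       {#(1, 3 * int n)#} + replicate_mset 3 (2, 2 * int n) + {#(3, int n)#},
       replicate_mset 2 (2, 3 * int n) + replicate_mset 2 (3, 2 * int n),
       {#(3, 3 * int n)#}]"
proof -
  interpret B: bilinear_regular "var VS" "var VT" g0 g1 by fact
  define N where "N = int n"
  have N: "N > 0" using n by (simp add: N_def)
  define l0 :: "(int \<times> int) list" where "l0 = [(1, N), (1, N), (1, N)]"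
  define l1 :: "(int \<times> int) list" where "l1 = [(3, N), (1, 3 * N), (2, 2 * N), (2, 2 * N), (2, 2 * N)]"
  define l2 :: "(int \<times> int) list" where "l2 = [(3, 2 * N), (3, 2 * N), (2, 3 * N), (2, 3 * N)]"
  define l3 :: "(int \<times> int) list" where "l3 = [(3, 3 * N)]"
  note l_defs = l0_def l1_def l2_def l3_def
  have l: "length l0 = 3" "length l1 = 5" "length l2 = 4" "length l3 = 1"
    by (simp_all add: l_defs)
  define a where "a i = (if i = 0 then l0 else if i = 1 then l1 else if i = 2 then l2
     else if i = 3 then l3 else [])" for i :: nat
  define d where "d i = (if i = 0 then B.D0 else if i = 1 then B.D1 else if i = 2 then B.D2
     else if i = 3 then B.D3 else 0\<^sub>m (length (a (i - 1))) 0)" for i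
  have S: "var VS \<in> homog (1, 0)" and T: "var VT \<in> homog (1, 0)"
    using var_homog[of VS] var_homog[of VT] by simp_all
  note xy = g[folded N_def]
  note hom = S T xy homog_mult[OF S xy(1)] homog_mult[OF S xy(2)] homog_mult[OF T xy(1)]
    homog_mult[OF T xy(2)] homog_mult[OF S S] homog_mult[OF S T] homog_mult[OF T T]
    homog_mult[OF xy(1) xy(1)] homog_mult[OF xy(1) xy(2)] homog_mult[OF xy(2) xy(2)]
  have m0: "graded_map l0 [(0, 0)] B.D0"
    unfolding B.D0_def by (rule graded_map_rows) (auto simp: l_defs intro!: homog_add hom)
  have m1: "graded_map l1 l0 B.D1"
    unfolding B.D1_def
    by (rule graded_map_rows)
      (auto simp: l_defs power2_eq_square simp del: minus_add_distrib intro!: homog_add hom)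
  have m2: "graded_map l2 l1 B.D2"
    unfolding B.D2_def by (rule graded_map_rows) (auto simp: l_defs intro!: hom)
  have m3: "graded_map l3 l2 B.D3"
    unfolding B.D3_def by (rule graded_map_rows) (auto simp: l_defs intro!: hom)
  have maps: "graded_map (a (Suc i)) (a i) (d (Suc i)) \<and> set (a i) \<inter> set (a (Suc i)) = {}" for i
  proof -
    consider "i = 0" | "i = 1" | "i = 2" | "i \<ge> 3" by linarith
    then show ?thesis
    proof cases
      case 4
      then show ?thesis by (auto simp: a_def d_def graded_map_def)
    qed (use m1 m2 m3 N in \<open>auto simp: a_def d_def l_defs\<close>)
  qed
  have exact: "mat_kernel (d i) = (\<lambda>x. d (Suc i) *\<^sub>v x) ` carrier_vec (length (a (Suc i)))" for i
  proof -
    consider "i = 0" | "i = 1" | "i = 2" | "i = 3" | "i > 3" by linarith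
    then show ?thesis
    proof cases
      case 1
      then show ?thesis using B.exact_0 by (simp add: a_def d_def l)
    next
      case 2
      then show ?thesis using B.exact_1 by (simp add: a_def d_def l)
    next
      case 3
      then show ?thesis using B.exact_2 by (simp add: a_def d_def l)
    next
      case 4
      then show ?thesis
        using B.exact_3 by (simp add: a_def d_def l carrier_vec_0 zero_mat_0_mult)
    next
      case 5
      then show ?thesis
        by (simp add: a_def d_def carrier_vec_0 zero_mat_0_mult mat_kernel_zero_0)
    qed
  qed
  have minimal: "minimal_bigraded_free_resolution
      (ideal_gen {var VS * g0, var VT * g0 + var VS * g1, var VT * g1}) a d"
    unfolding minimal_bigraded_free_resolution_def bigraded_free_resolution_def
  proof (intro conjI allI)
    show "graded_map (a 0) [(0, 0)] (d 0)"
      using m0 by (simp add: a_def d_def)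
    show "(\<lambda>x. (d 0 *\<^sub>v x) $ 0) ` carrier_vec (length (a 0)) =
        ideal_gen {var VS * g0, var VT * g0 + var VS * g1, var VT * g1}"
      using B.image_0 by (simp add: a_def d_def l del: index_mult_mat_vec)
    fix i
    show "graded_map (a (Suc i)) (a i) (d (Suc i))"
      using maps[of i] by blast
    show "elements_mat (d (Suc i)) \<subseteq> ideal_gen {var VS, var VT, var VU, var VV}"
      using graded_map_minimal maps[of i] by blast
    show "mat_kernel (d i) = (\<lambda>x. d (Suc i) *\<^sub>v x) ` carrier_vec (length (a (Suc i)))"
      by (rule exact)
  qed
  define F :: "(int \<times> int) multiset list" where "F = [replicate_mset 3 (1, N),
       {#(1, 3 * N)#} + replicate_mset 3 (2, 2 * N) + {#(3, N)#},
       replicate_mset 2 (2, 3 * N) + replicate_mset 2 (3, 2 * N),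
       {#(3, 3 * N)#}]"
  have "mset (a i) = (if i < length F then F ! i else {#})" for i
  proof -
    consider "i = 0" | "i = 1" | "i = 2" | "i = 3" | "i > 3" by linarith
    then show ?thesis
      by cases (simp_all add: F_def a_def l_defs eval_nat_numeral)
  qed
  with minimal show ?thesis
    unfolding has_bigraded_betti_def N_def[symmetric] F_def[symmetric] by blast
qed

section \<open>Linear spans of few polynomials\<close>

lemma lin_span_insert:
  fixes a :: "'k::field bipoly"
  shows "lin_span (insert a S) = {scale k a + p | k p. p \<in> lin_span S}"
proof -
  interpret V: Vector_Spaces.vector_space "scale :: 'k \<Rightarrow> 'k bipoly \<Rightarrow> 'k bipoly"
    by (rule vector_space_scale)
  show ?thesis
    unfolding lin_span_def V.span_insert
  proof (intro equalityI subsetI)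
    fix z assume "z \<in> {z. \<exists>k. z - scale k a \<in> V.span S}"
    then obtain k where "z - scale k a \<in> V.span S" by blast
    moreover have "z = scale k a + (z - scale k a)" by simp
    ultimately show "z \<in> {scale k a + p | k p. p \<in> V.span S}" by blast
  next
    fix z assume "z \<in> {scale k a + p | k p. p \<in> V.span S}"
    then obtain k p where "z = scale k a + p" "p \<in> V.span S" by blast
    then have "z - scale k a \<in> V.span S" by simp
    then show "z \<in> {z. \<exists>k. z - scale k a \<in> V.span S}" by blast
  qed
qed

lemma lin_span_empty: "lin_span {} = {0 :: 'k::field bipoly}"
  unfolding lin_span_def by (rule Modules.module.span_empty) (use vector_space_scale in \<open>simp add: Vector_Spaces.vector_space_def Modules.module_def\<close>)

lemma lin_span_single: "lin_span {a} = {scale p a | p. True}"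
  for a :: "'k::field bipoly"
  unfolding lin_span_insert lin_span_empty by simp

lemma lin_span_pair: "lin_span {a, b} = {scale p a + scale q b | p q. True}"
  for a b :: "'k::field bipoly"
  unfolding lin_span_insert[of a] lin_span_single by blast

lemma lin_span_triple: "lin_span {a, b, c} = {scale p a + scale q b + scale r c | p q r. True}"
  for a b c :: "'k::field bipoly"
  unfolding lin_span_insert[of a] lin_span_pair by (simp add: add.assoc) blast

lemma lin_span_add: "p \<in> lin_span S \<Longrightarrow> q \<in> lin_span S \<Longrightarrow> p + q \<in> lin_span S"
  for p :: "'k::field bipoly"
proof -
  interpret V: Vector_Spaces.vector_space "scale :: 'k \<Rightarrow> 'k bipoly \<Rightarrow> 'k bipoly"
    by (rule vector_space_scale)
  show "p \<in> lin_span S \<Longrightarrow> q \<in> lin_span S \<Longrightarrow> p + q \<in> lin_span S"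
    unfolding lin_span_def by (rule V.span_add)
qed

lemma lin_span_scale: "p \<in> lin_span S \<Longrightarrow> scale c p \<in> lin_span S"
  for p :: "'k::field bipoly"
proof -
  interpret V: Vector_Spaces.vector_space "scale :: 'k \<Rightarrow> 'k bipoly \<Rightarrow> 'k bipoly"
    by (rule vector_space_scale)
  show "p \<in> lin_span S \<Longrightarrow> scale c p \<in> lin_span S"
    unfolding lin_span_def by (rule V.span_scale)
qed

lemma lin_span_base: "p \<in> S \<Longrightarrow> p \<in> lin_span S"
  for p :: "'k::field bipoly"
proof -
  interpret V: Vector_Spaces.vector_space "scale :: 'k \<Rightarrow> 'k bipoly \<Rightarrow> 'k bipoly"
    by (rule vector_space_scale)
  show "p \<in> S \<Longrightarrow> p \<in> lin_span S"
    unfolding lin_span_def by (rule V.span_base)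
qed

lemma lin_span_mono: "S \<subseteq> lin_span T \<Longrightarrow> lin_span S \<subseteq> lin_span T"
  for S :: "'k::field bipoly set"
proof -
  interpret V: Vector_Spaces.vector_space "scale :: 'k \<Rightarrow> 'k bipoly \<Rightarrow> 'k bipoly"
    by (rule vector_space_scale)
  show "S \<subseteq> lin_span T \<Longrightarrow> lin_span S \<subseteq> lin_span T"
    unfolding lin_span_def by (metis V.span_mono V.span_span)
qed

lemma scale_simps:
  "scale c 0 = 0" "scale 0 p = 0" "scale 1 p = p"
  "scale c (p + q) = scale c p + scale c q" "scale c (p - q) = scale c p - scale c q"
  "scale c (- p) = - scale c p" "scale (- c) p = - scale c p"
  "scale (c + d) p = scale c p + scale d p" "scale (c - d) p = scale c p - scale d p"
  "scale c (scale d p) = scale (c * d) p"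
  "q * scale c p = scale c (q * p)" "scale c p * q = scale c (p * q)"
proof -
  have c: "const 0 = 0" "const 1 = 1" "const (- c) = - const c" "const (c + d) = const c + const d"
    "const (c - d) = const c - const d" "const (c * d) = const c * const d" for c d :: 'a
    by (simp_all add: const_def single_add single_diff single_uminus mult_single)
  show "scale c 0 = 0" "scale 0 p = 0" "scale 1 p = p"
    "scale c (p + q) = scale c p + scale c q" "scale c (p - q) = scale c p - scale c q"
    "scale c (- p) = - scale c p" "scale (- c) p = - scale c p"
    "scale (c + d) p = scale c p + scale d p" "scale (c - d) p = scale c p - scale d p"
    "scale c (scale d p) = scale (c * d) p"
    "q * scale c p = scale c (q * p)" "scale c p * q = scale c (p * q)"
    by (simp_all add: scale_def c algebra_simps)
qed

lemma scale_cancel: "c \<noteq> 0 \<Longrightarrow> scale c p = q \<longleftrightarrow> p = scale (1 / c) q"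
  by (auto simp: scale_simps)

lemma scale_eq_0_iff: "scale c p = 0 \<longleftrightarrow> c = 0 \<or> p = 0"
  using scale_cancel[of c p 0] by (auto simp: scale_simps)

definition indep3 :: "'k::field bipoly \<Rightarrow> 'k bipoly \<Rightarrow> 'k bipoly \<Rightarrow> bool" where
  "indep3 f0 f1 f2 \<longleftrightarrow>
     (\<forall>a b c. scale a f0 + scale b f1 + scale c f2 = 0 \<longrightarrow> a = 0 \<and> b = 0 \<and> c = 0)"

definition indep2 :: "'k::field bipoly \<Rightarrow> 'k bipoly \<Rightarrow> bool" where
  "indep2 g0 g1 \<longleftrightarrow> (\<forall>a b. scale a g0 + scale b g1 = 0 \<longrightarrow> a = 0 \<and> b = 0)"

lemma indep3_if_dim_3:
  fixes f0 f1 f2 :: "'k::field bipoly"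
  assumes "lin_dim (lin_span {f0, f1, f2}) = 3"
  shows "indep3 f0 f1 f2"
proof -
  interpret V: Vector_Spaces.vector_space "scale :: 'k \<Rightarrow> 'k bipoly \<Rightarrow> 'k bipoly"
    by (rule vector_space_scale)
  have no2: "\<not> lin_span {f0, f1, f2} \<subseteq> lin_span {p, q}" for p q
  proof
    assume "lin_span {f0, f1, f2} \<subseteq> lin_span {p, q}"
    then have "lin_dim (lin_span {f0, f1, f2}) \<le> card {p, q}"
      unfolding lin_dim_def lin_span_def by (intro V.dim_le_card) auto
    also have "\<dots> \<le> 2" by (simp add: card_insert_if)
    finally show False using assms by simp
  qed
  have elim: "c = 0" if "scale c f = scale a p + scale b q" "{f, p, q} = {f0, f1, f2}" for a b c f p q
  proof (rule ccontr)
    assume "c \<noteq> 0"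
    then have "f = scale (a / c) p + scale (b / c) q"
      using that(1) by (simp add: scale_cancel scale_simps)
    then have "f \<in> lin_span {p, q}"
      unfolding lin_span_pair by blast
    then have "{f, p, q} \<subseteq> lin_span {p, q}"
      using lin_span_base[of _ "{p, q}"] by auto
    then show False
      using no2[of p q] lin_span_mono that(2) by metis
  qed
  show ?thesis
    unfolding indep3_def
  proof (intro allI impI conjI)
    fix a b c assume eq: "scale a f0 + scale b f1 + scale c f2 = 0"
    have "scale a f0 = scale (- b) f1 + scale (- c) f2"
      using eq by (simp add: scale_simps algebra_simps eq_neg_iff_add_eq_0)
    then show "a = 0" by (rule elim) auto
    have "scale b f1 = scale (- a) f0 + scale (- c) f2"
      using eq by (simp add: scale_simps algebra_simps eq_neg_iff_add_eq_0)
    then show "b = 0" by (rule elim) auto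
    have "scale c f2 = scale (- a) f0 + scale (- b) f1"
      using eq by (simp add: scale_simps algebra_simps eq_neg_iff_add_eq_0)
    then show "c = 0" by (rule elim) auto
  qed
qed

lemma indep3_spans:
  fixes f0 f1 f2 F0 F1 F2 :: "'k::field bipoly"
  assumes "indep3 F0 F1 F2" "{F0, F1, F2} \<subseteq> lin_span {f0, f1, f2}"
  shows "lin_span {F0, F1, F2} = lin_span {f0, f1, f2}"
proof
  interpret V: Vector_Spaces.vector_space "scale :: 'k \<Rightarrow> 'k bipoly \<Rightarrow> 'k bipoly"
    by (rule vector_space_scale)
  show "lin_span {F0, F1, F2} \<subseteq> lin_span {f0, f1, f2}"
    by (rule lin_span_mono) fact
  note ind = assms(1)[unfolded indep3_def, rule_format]
  have "F2 \<notin> lin_span {}"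
    using ind[of 0 0 1] by (auto simp: lin_span_empty scale_simps)
  moreover have n1: "F1 \<notin> lin_span {F2}"
  proof
    assume "F1 \<in> lin_span {F2}"
    then obtain c where "F1 = scale c F2" by (auto simp: lin_span_single)
    then show False using ind[of 0 1 "- c"] by (simp add: scale_simps)
  qed
  moreover have n0: "F0 \<notin> lin_span {F1, F2}"
  proof
    assume "F0 \<in> lin_span {F1, F2}"
    then obtain c d where "F0 = scale c F1 + scale d F2" by (auto simp: lin_span_pair)
    then show False using ind[of 1 "- c" "- d"] by (simp add: scale_simps)
  qed
  ultimately have indep: "V.independent {F0, F1, F2}"
    unfolding lin_span_def
    by (intro V.independent_insertI) (simp_all add: V.independent_empty)
  have "F1 \<noteq> F2" "F0 \<noteq> F1" "F0 \<noteq> F2"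
    using n0 n1 lin_span_base[of _ "{F1, F2}"] lin_span_base[of _ "{F2}"] by auto
  then have card: "card {F0, F1, F2} = 3"
    by simp
  show "lin_span {f0, f1, f2} \<subseteq> lin_span {F0, F1, F2}"
  proof (rule subsetI, rule ccontr)
    fix w assume w: "w \<in> lin_span {f0, f1, f2}" "w \<notin> lin_span {F0, F1, F2}"
    then have "V.independent (insert w {F0, F1, F2})"
      unfolding lin_span_def by (intro V.independent_insertI indep)
    moreover have "insert w {F0, F1, F2} \<subseteq> V.span {f0, f1, f2}"
      using w(1) assms(2) unfolding lin_span_def by simp
    ultimately have "card (insert w {F0, F1, F2}) \<le> card {f0, f1, f2}"
      using V.independent_span_bound[of "{f0, f1, f2}"] by blast
    moreover have "card {f0, f1, f2} \<le> 3"
      by (simp add: card_insert_if)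
    moreover have "w \<notin> {F0, F1, F2}"
      using w(2) lin_span_base[of w "{F0, F1, F2}"] by blast
    ultimately show False
      using card by (simp add: card_insert_if split: if_splits)
  qed
qed

section \<open>The bilinear normal form of \<open>W\<close>\<close>

lemma indep2I:
  assumes "\<And>c. g0 = scale c g1 \<Longrightarrow> False" "\<And>c. g1 = scale c g0 \<Longrightarrow> False"
  shows "indep2 g0 g1"
  unfolding indep2_def
proof (intro allI impI)
  fix a b assume eq: "scale a g0 + scale b g1 = 0"
  have "scale a g0 = scale (- b) g1" "scale b g1 = scale (- a) g0"
    using eq by (simp_all add: scale_simps eq_neg_iff_add_eq_0 add.commute)
  then have "a \<noteq> 0 \<Longrightarrow> g0 = scale (1 / a * - b) g1" "b \<noteq> 0 \<Longrightarrow> g1 = scale (1 / b * - a) g0"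
    using scale_cancel scale_simps(10) by metis+
  with assms show "a = 0 \<and> b = 0" by blast
qed

lemma st_eq_iff:
  assumes "a \<in> homog (0, j)" "b \<in> homog (0, j)" "c \<in> homog (0, j)" "d \<in> homog (0, j)"
  shows "var VS * a + var VT * b = var VS * c + var VT * d \<longleftrightarrow> a = c \<and> b = d"
proof
  assume "var VS * a + var VT * b = var VS * c + var VT * d"
  then have "var VS * (a - c) + var VT * (b - d) = 0"
    by (simp add: algebra_simps)
  then show "a = c \<and> b = d"
    using st_independent[OF _ homog_diff[OF assms(1,3)] homog_diff[OF assms(2,4)]] by simp
qed simp

text \<open>
  Writing \<open>F\<^sub>i = s a\<^sub>i + t b\<^sub>i\<close> with \<open>a\<^sub>i, b\<^sub>i\<close> in \<open>u, v\<close> and comparing the coefficients of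
  \<open>s\<^sup>3, s\<^sup>2 t, s t\<^sup>2, t\<^sup>3\<close> gives \<open>a\<^sub>0 = 0\<close>, \<open>a\<^sub>1 = - b\<^sub>0\<close>, \<open>a\<^sub>2 = - b\<^sub>1\<close> and \<open>b\<^sub>2 = 0\<close>.
\<close>

lemma form_of_quadratic_syzygy:
  fixes F0 F1 F2 :: "'k::field bipoly"
  assumes F: "F0 \<in> homog (1, j)" "F1 \<in> homog (1, j)" "F2 \<in> homog (1, j)"
    and syz: "var VS ^ 2 * F0 + var VS * var VT * F1 + var VT ^ 2 * F2 = 0"
  obtains g0 g1 where "g0 \<in> homog (0, j)" "g1 \<in> homog (0, j)"
    "F0 = var VT * g1" "F1 = - (var VT * g0 + var VS * g1)" "F2 = var VS * g0"
proof -
  obtain a0 b0 where 0: "F0 = var VS * a0 + var VT * b0" "a0 \<in> homog (0, j)" "b0 \<in> homog (0, j)"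
    using homog_st_split[OF F(1)] by auto
  obtain a1 b1 where 1: "F1 = var VS * a1 + var VT * b1" "a1 \<in> homog (0, j)" "b1 \<in> homog (0, j)"
    using homog_st_split[OF F(2)] by auto
  obtain a2 b2 where 2: "F2 = var VS * a2 + var VT * b2" "a2 \<in> homog (0, j)" "b2 \<in> homog (0, j)"
    using homog_st_split[OF F(3)] by auto
  note hf = 0(2,3) 1(2,3) 2(2,3)
  have fS: "free VS (p::'k bipoly)" if "p \<in> homog (0, j)" for p using that free_homog by blast
  have fT: "free VS (var VT * p :: 'k bipoly)" if "free VS p" for p
    using that by (intro free_mult free_var) simp_all
  have e0: "var VS * (var VS * (var VS * a0 + var VT * (b0 + a1)) + var VT * (var VT * (b1 + a2))) +
      var VT * (var VT * (var VT * b2)) = 0"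
    using syz unfolding 0 1 2 by (simp add: algebra_simps power2_eq_square)
  have "var VT * (var VT * (var VT * b2)) = 0" and
    e1: "var VS * (var VS * a0 + var VT * (b0 + a1)) + var VT * (var VT * (b1 + a2)) = 0"
    using free_unique[OF e0 fT[OF fT[OF fT[OF fS[OF hf(6)]]]]] by blast+
  have e2: "var VT * (var VT * (b1 + a2)) = 0" and
    e3: "var VS * a0 + var VT * (b0 + a1) = 0"
    using free_unique[OF e1 fT[OF fT[OF fS[OF homog_add[OF hf(4,5)]]]]] by blast+
  have "a0 = 0" "b0 + a1 = 0"
    using st_independent[OF e3 hf(1) homog_add[OF hf(2,3)]] by blast+
  moreover have "b2 = 0" "b1 + a2 = 0"
    using \<open>var VT * (var VT * (var VT * b2)) = 0\<close> e2 by auto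
  moreover have "a1 = - b0" "b1 = - a2"
    using calculation by (simp_all add: eq_neg_iff_add_eq_0 add.commute)
  ultimately have "F0 = var VT * b0" "F1 = - (var VT * a2 + var VS * b0)" "F2 = var VS * a2"
    unfolding 0 1 2 by simp_all
  with hf show thesis by (intro that)
qed

lemma indep3_bilinear:
  fixes g0 g1 :: "'k::field bipoly"
  assumes "indep2 g0 g1" "g0 \<in> homog (0, j)" "g1 \<in> homog (0, j)"
  shows "indep3 (var VS * g0) (var VT * g0 + var VS * g1) (var VT * g1)"
  unfolding indep3_def
proof (intro allI impI)
  fix a b c
  assume "scale a (var VS * g0) + scale b (var VT * g0 + var VS * g1) + scale c (var VT * g1) = 0"
  then have "var VS * (scale a g0 + scale b g1) + var VT * (scale b g0 + scale c g1) = 0"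
    by (simp add: scale_simps algebra_simps)
  then have "scale a g0 + scale b g1 = 0" "scale b g0 + scale c g1 = 0"
    using st_independent[OF _ homog_add[OF homog_scale[OF assms(2)] homog_scale[OF assms(3)]]
        homog_add[OF homog_scale[OF assms(2)] homog_scale[OF assms(3)]]] by simp_all
  with assms(1) show "a = 0 \<and> b = 0 \<and> c = 0"
    unfolding indep2_def by blast
qed

text \<open>
  The only point beyond \<open>form_of_quadratic_syzygy\<close> is the independence of \<open>g0\<close> and \<open>g1\<close>. If one is a
  multiple of the other, then \<open>F0, F1, F2\<close> span both \<open>s g\<close> and \<open>t g\<close>, and \<open>s (t g) - t (s g) = 0\<close>
  is a linear relation.
\<close>

lemma bilinear_form:
  fixes W :: "'k::field bipoly set"
  assumes W: "W = lin_span {f0, f1, f2}" "W \<subseteq> homog (1, j)"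
    and F: "F0 \<in> W" "F1 \<in> W" "F2 \<in> W" "\<not> (F0 = 0 \<and> F1 = 0 \<and> F2 = 0)"
    and syz: "var VS ^ 2 * F0 + var VS * var VT * F1 + var VT ^ 2 * F2 = 0"
    and lin: "\<And>G0 G1. G0 \<in> W \<Longrightarrow> G1 \<in> W \<Longrightarrow> var VS * G0 + var VT * G1 = 0 \<Longrightarrow> G0 = 0"
  obtains g0 g1 where "g0 \<in> homog (0, j)" "g1 \<in> homog (0, j)" "indep2 g0 g1"
    "W = lin_span {var VS * g0, var VT * g0 + var VS * g1, var VT * g1}"
proof -
  note W_add = lin_span_add[of _ "{f0, f1, f2}", folded W(1)]
  note W_scale = lin_span_scale[of _ "{f0, f1, f2}", folded W(1)]
  have W_uminus: "- p \<in> W" if "p \<in> W" for p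
    using W_scale[OF that, of "- 1"] by (simp add: scale_simps)
  obtain g0 g1 where g: "g0 \<in> homog (0, j)" "g1 \<in> homog (0, j)"
    and Fg: "F0 = var VT * g1" "F1 = - (var VT * g0 + var VS * g1)" "F2 = var VS * g0"
    by (rule form_of_quadratic_syzygy[OF subsetD[OF W(2) F(1)] subsetD[OF W(2) F(2)]
      subsetD[OF W(2) F(3)] syz])
  have no: "g = 0" if "var VS * g \<in> W" "var VT * g \<in> W" for g
  proof -
    have "var VS * (- (var VT * g)) + var VT * (var VS * g) = 0"
      by (simp add: algebra_simps)
    then have "- (var VT * g) = 0"
      by (rule lin[OF W_uminus[OF that(2)] that(1)])
    then show "g = 0" by simp
  qed
  have ind: "indep2 g0 g1"
  proof (rule indep2I)
    fix c assume c: "g0 = scale c g1"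
    have "var VS * g1 = - F1 + scale (- c) F0"
      unfolding Fg c by (simp add: scale_simps)
    then have "var VS * g1 \<in> W" using W_add[OF W_uminus[OF F(2)] W_scale[OF F(1)]] by simp
    moreover have "var VT * g1 \<in> W" using F Fg by simp
    ultimately have "g1 = 0" by (rule no)
    then show False using F(4) unfolding Fg c by (simp add: scale_simps)
  next
    fix c assume c: "g1 = scale c g0"
    have "var VT * g0 = - F1 + scale (- c) F2"
      unfolding Fg c by (simp add: scale_simps)
    then have "var VT * g0 \<in> W" using W_add[OF W_uminus[OF F(2)] W_scale[OF F(3)]] by simp
    moreover have "var VS * g0 \<in> W" using F Fg by simp
    ultimately have "g0 = 0" using no by blast
    then show False using F(4) unfolding Fg c by (simp add: scale_simps)
  qed
  have "var VT * g0 + var VS * g1 \<in> W"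
    using W_uminus[OF F(2)] unfolding Fg by (simp add: add.commute)
  moreover have "var VS * g0 \<in> W" "var VT * g1 \<in> W"
    using F(1,3) unfolding Fg by simp_all
  ultimately have "{var VS * g0, var VT * g0 + var VS * g1, var VT * g1} \<subseteq> W"
    by simp
  then have "W = lin_span {var VS * g0, var VT * g0 + var VS * g1, var VT * g1}"
    unfolding W(1) by (rule indep3_spans[OF indep3_bilinear[OF ind g], symmetric])
  with g ind show thesis by (rule that)
qed

lemma bilinear_collect:
  fixes s t x y :: "'a::comm_ring_1"
  shows "p * (s * x) + q * (t * x + s * y) + r * (t * y) = x * (p * s + q * t) + y * (q * s + r * t)"
  by (simp add: algebra_simps)

lemma ideal_gen_tripleE:
  fixes a :: "'a::comm_ring_1"
  assumes "d \<in> ideal_gen {a, b, c}"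
  obtains p q r where "d = p * a + q * b + r * c"
  using assms unfolding ideal_gen_triple by blast

text \<open>
  The radical of \<open>I\<^sub>W\<close> contains \<open>s u\<close> and \<open>s v\<close>, while \<open>I\<^sub>W \<subseteq> (g0, g1)\<close>. So \<open>s\<^sup>N u\<^sup>N\<close> lies in \<open>(g0, g1)\<close>, and
  \<open>s\<close> can be cancelled because it does not occur in \<open>g0, g1\<close>.
\<close>

lemma coprime_of_basepoint_free:
  fixes g0 g1 :: "'k::field bipoly"
  assumes g: "g0 \<in> homog (0, j)" "g1 \<in> homog (0, j)"
    and bpf: "basepoint_free (lin_span {var VS * g0, var VT * g0 + var VS * g1, var VT * g1})"
    and z: "z \<in> {VU, VV}"
  shows "\<exists>N p q. var z ^ N = g0 * p + g1 * q"
proof -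
  let ?I = "ideal_gen {var VS * g0, var VT * g0 + var VS * g1, var VT * g1}"
  interpret R: Modules.module "(*) :: 'k bipoly \<Rightarrow> 'k bipoly \<Rightarrow> 'k bipoly" by (rule module_times)
  have "var VS * var z \<in> ideal_gen {var VS, var VT :: 'k bipoly}"
    unfolding ideal_gen_def using R.span_scale[OF R.span_base[of "var VS"], of "{var VS, var VT}" "var z"]
    by (simp add: mult.commute)
  moreover have "var VS * var z \<in> ideal_gen {var VU, var VV :: 'k bipoly}"
    unfolding ideal_gen_def using z by (intro R.span_scale R.span_base) auto
  ultimately have "var VS * var z \<in> radical ?I"
    unfolding bpf[unfolded basepoint_free_def ideal_gen_lin_span] by (rule IntI)
  then obtain N where "(var VS * var z) ^ N \<in> ?I"
    unfolding radical_def by blast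
  then obtain p q r where pqr: "(var VS * var z) ^ N =
      p * (var VS * g0) + q * (var VT * g0 + var VS * g1) + r * (var VT * g1)"
    by (rule ideal_gen_tripleE)
  have "var VS ^ N * var z ^ N = (var VS * var z) ^ N"
    by (rule power_mult_distrib[symmetric])
  also have "\<dots> = g0 * (p * var VS + q * var VT) + g1 * (q * var VS + r * var VT)"
    unfolding pqr by (rule bilinear_collect)
  finally have eq: "var VS ^ N * var z ^ N =
      g0 * (p * var VS + q * var VT) + g1 * (q * var VS + r * var VT)" .
  have reduce: "\<exists>p q. var VS ^ k * (h :: 'k bipoly) = g0 * p + g1 * q \<Longrightarrow> \<exists>p q. h = g0 * p + g1 * q" for k h
  proof (induction k)
    case (Suc k)
    then obtain p q where "var VS ^ Suc k * h = g0 * p + g1 * q"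
      by blast
    then have "var VS * (var VS ^ k * h) = g0 * p + g1 * q"
      unfolding power_Suc mult.assoc .
    from var_mod_pair[OF free_homog(1)[OF g(1)] free_homog(1)[OF g(2)] this] obtain c d
      where "var VS ^ k * h = g0 * c + g1 * d"
      by blast
    then show ?case
      using Suc.IH by blast
  qed simp
  have "\<exists>p q. var z ^ N = g0 * p + g1 * q"
    by (rule reduce[of N], rule exI, rule exI, rule eq)
  then show ?thesis ..
qed

lemma betti_if_bilinear_form:
  fixes g0 g1 :: "'k::field bipoly"
  assumes "n > 0" and g: "g0 \<in> homog (0, int n)" "g1 \<in> homog (0, int n)" "indep2 g0 g1"
    and W: "W = lin_span {var VS * g0, var VT * g0 + var VS * g1, var VT * g1}"
    and bpf: "basepoint_free W"
  shows "has_bigraded_betti (ideal_gen W)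
      [replicate_mset 3 (1, int n),
       {#(1, 3 * int n)#} + replicate_mset 3 (2, 2 * int n) + {#(3, int n)#},
       replicate_mset 2 (2, 3 * int n) + replicate_mset 2 (3, 2 * int n),
       {#(3, 3 * int n)#}]"
proof -
  have "scale 1 g0 + scale 0 g1 \<noteq> 0" "scale 0 g0 + scale 1 g1 \<noteq> 0"
    using g(3) zero_neq_one unfolding indep2_def by metis+
  then have nz: "g0 \<noteq> 0" "g1 \<noteq> 0"
    by (simp_all add: scale_simps)
  have bpf': "basepoint_free (lin_span {var VS * g0, var VT * g0 + var VS * g1, var VT * g1})"
    using bpf unfolding W .
  obtain N p q where U: "var VU ^ N = g0 * p + g1 * q"
    using coprime_of_basepoint_free[OF g(1,2) bpf', of VU, OF insertI1] by (elim exE)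
  obtain M p' q' where V: "var VV ^ M = g0 * p' + g1 * q'"
    using coprime_of_basepoint_free[OF g(1,2) bpf', of VV, OF insertI2[OF insertI1]] by (elim exE)
  have ideal: "ideal_gen W = ideal_gen {var VS * g0, var VT * g0 + var VS * g1, var VT * g1}"
    unfolding W by (rule ideal_gen_lin_span)
  show ?thesis
    unfolding ideal
    by (rule betti_of_bilinear[OF assms(1) g(1,2) bilinear_regular_bipoly[OF g(1,2) nz U V]])
qed

section \<open>Smooth ternary quadratic forms\<close>

type_synonym 'a triple = "'a \<times> 'a \<times> 'a"

fun smul :: "'a::comm_ring_1 \<Rightarrow> 'a triple \<Rightarrow> 'a triple" where
  "smul c (x0, x1, x2) = (c * x0, c * x1, c * x2)"

fun dot :: "'a::comm_ring_1 triple \<Rightarrow> 'a triple \<Rightarrow> 'a" where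
  "dot (x0, x1, x2) (y0, y1, y2) = x0 * y0 + x1 * y1 + x2 * y2"

fun cross :: "'a::comm_ring_1 triple \<Rightarrow> 'a triple \<Rightarrow> 'a triple" where
  "cross (x0, x1, x2) (y0, y1, y2) = (x1 * y2 - x2 * y1, x2 * y0 - x0 * y2, x0 * y1 - x1 * y0)"

lemma dot_commute: "dot x y = dot y x"
  by (cases x; cases y) (simp add: mult.commute)

lemma dot_add: "dot x (y + z) = dot x y + dot x z"
  by (cases x; cases y; cases z) (simp add: algebra_simps)

lemma dot_smul: "dot x (smul c y) = c * dot x y"
  by (cases x; cases y) (simp add: algebra_simps)

lemma dot_cross_self: "dot x (cross x y) = 0" "dot y (cross x y) = 0"
  by (cases x; cases y; simp add: algebra_simps)+

lemma dot_cross_cross: "dot (cross x y) (cross z w) = dot x z * dot y w - dot x w * dot y z"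
  by (cases x; cases y; cases z; cases w) (simp add: algebra_simps)

lemma cross_cross: "cross x (cross y z) = smul (dot x z) y + smul (- dot x y) z"
  by (cases x; cases y; cases z) (simp add: algebra_simps)

lemma cramer:
  "smul (dot (cross p r) s) g = smul (dot g p) (cross r s) + smul (dot g r) (cross s p) + smul (dot g s) (cross p r)"
  by (cases p; cases r; cases s; cases g) (simp add: algebra_simps)

lemma smul_eq_0_iff: "smul c x = 0 \<longleftrightarrow> c = 0 \<or> x = (0 :: 'a::field triple)"
  by (cases x) (auto simp: zero_prod_def)

lemma smul_0 [simp]: "smul 0 x = 0" "smul c 0 = 0"
  by (cases x, simp_all add: zero_prod_def)

lemma smul_1 [simp]: "smul 1 x = x"
  by (cases x) simp

locale ternary_form =
  fixes A B C D E F :: "'a::field"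
begin

fun q :: "'a triple \<Rightarrow> 'a" where
  "q (x, y, z) = A * x * x + B * y * y + C * z * z + D * x * y + E * x * z + F * y * z"

fun grad :: "'a triple \<Rightarrow> 'a triple" where
  "grad (x, y, z) = (2 * A * x + D * y + E * z, D * x + 2 * B * y + F * z, E * x + F * y + 2 * C * z)"

lemma q_add: "q (x + y) = q x + q y + dot (grad x) y"
  by (cases x; cases y) (simp add: algebra_simps)

lemma q_smul: "q (smul c x) = c * c * q x"
  by (cases x) (simp add: algebra_simps)

lemma grad_lin: "grad (smul a x + smul b y) = smul a (grad x) + smul b (grad y)"
  by (cases x; cases y) (simp add: algebra_simps)

lemma grad_smul: "grad (smul a x) = smul a (grad x)"
  by (cases x) (simp add: algebra_simps)

lemma dot_grad_commute: "dot (grad x) y = dot (grad y) x"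
  by (cases x; cases y) (simp add: algebra_simps)

lemma dot_grad_self: "dot (grad x) x = 2 * q x"
  by (cases x) (simp add: algebra_simps)

end

text \<open>
  The Jacobian criterion over the given field. For a form over an algebraically closed field this is
  smoothness of the conic, also in characteristic 2, where \<open>grad x\<close> may vanish at points off the
  conic.
\<close>

locale smooth_ternary_form = ternary_form +
  assumes smooth: "q x = 0 \<Longrightarrow> grad x = 0 \<Longrightarrow> x = 0"
begin

text \<open>
  The tangent at \<open>p\<close> is a line, so some point lies off it, and moving this point along the
  line through \<open>p\<close> gives a second zero \<open>r\<close> of the form. The vector product of the two gradients is
  orthogonal to \<open>p\<close> and \<open>r\<close> and replaces an orthogonal complement, which would be delicate in
  characteristic 2. If the form vanished there, its gradient would be orthogonal to a basis.
\<close>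

lemma hyperbolic_basis:
  assumes p: "q p = 0" "p \<noteq> 0"
  shows "\<exists>r s \<kappa>. \<kappa> \<noteq> 0 \<and>
    (\<forall>a b c. q (smul a p + smul b r + smul c s) = a * b + \<kappa> * c * c)"
proof -
  define u where "u = grad p"
  have "u \<noteq> 0" unfolding u_def using smooth[OF p(1)] p(2) by blast
  obtain r' where r': "dot u r' = 1"
  proof (cases u)
    case (fields u0 u1 u2)
    then consider "u0 \<noteq> 0" | "u1 \<noteq> 0" | "u2 \<noteq> 0"
      using \<open>u \<noteq> 0\<close> by (auto simp: zero_prod_def)
    then show thesis
    proof cases
      case 1 then show thesis using that[of "(1 / u0, 0, 0)"] fields by simp
    next
      case 2 then show thesis using that[of "(0, 1 / u1, 0)"] fields by simp
    next
      case 3 then show thesis using that[of "(0, 0, 1 / u2)"] fields by simp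
    qed
  qed
  define r where "r = r' + smul (- q r') p"
  define w where "w = grad r"
  define s where "s = cross u w"
  have up: "dot u p = 0"
    unfolding u_def dot_grad_self p by simp
  have ur: "dot u r = 1"
    unfolding r_def dot_add dot_smul up r' by simp
  have wp: "dot w p = 1"
    unfolding w_def dot_grad_commute[of r] using ur u_def by simp
  have "dot (grad r') p = 1"
    unfolding dot_grad_commute[of r'] using r' u_def by simp
  then have qr: "q r = 0"
    unfolding r_def q_add q_smul dot_smul p by simp
  have wr: "dot w r = 0"
    unfolding w_def dot_grad_self qr by simp
  have us: "dot u s = 0" and ws: "dot w s = 0"
    unfolding s_def by (rule dot_cross_self)+
  have det: "dot (cross p r) s = - 1"
    unfolding s_def dot_cross_cross dot_commute[of p] dot_commute[of r] up wp ur by simp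
  have expand: "q (smul a p + smul b r + smul c s) = a * b + q s * c * c" for a b c
  proof -
    have "dot (grad (smul a p + smul b r)) (smul c s) = 0"
      unfolding grad_lin dot_smul dot_commute[of _ s] dot_add
      unfolding u_def[symmetric] w_def[symmetric]
      using us ws by (simp add: dot_commute[of s])
    moreover have "dot (grad (smul a p)) (smul b r) = a * b"
      unfolding grad_smul u_def[symmetric] dot_smul dot_commute[of _ r] using ur
      by (simp add: dot_commute[of r])
    ultimately show ?thesis
      by (simp only: q_add q_smul p qr) (simp add: algebra_simps)
  qed
  have "q s \<noteq> 0"
  proof
    assume qs: "q s = 0"
    have "dot (grad s) p = 0" "dot (grad s) r = 0" "dot (grad s) s = 0"
      unfolding dot_grad_commute[of s p] dot_grad_commute[of s r] dot_grad_self
      using us ws qs by (simp_all add: u_def w_def)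
    then have "smul (- 1) (grad s) = 0"
      using cramer[of p r s "grad s"] unfolding det by simp
    then have "grad s = 0"
      unfolding smul_eq_0_iff by simp
    with qs have "s = 0" by (rule smooth)
    then show False using det by (cases "cross p r") (simp add: zero_prod_def)
  qed
  with expand show ?thesis by blast
qed

text \<open>
  The gradients at two points of a line on the conic are both orthogonal to the line, so they are
  proportional. The gradient is linear, so it vanishes at some point of the line.
\<close>

lemma no_isotropic_plane:
  assumes indep: "\<And>a b. smul a x + smul b y = 0 \<Longrightarrow> a = 0 \<and> b = 0"
    and iso: "\<And>a b. q (smul a x + smul b y) = 0"
  shows False
proof -
  define N where "N = cross x y"
  have qx: "q x = 0" and qy: "q y = 0"
    using iso[of 1 0] iso[of 0 1] by simp_all
  have xy: "dot (grad x) y = 0"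
    using iso[of 1 1] qx qy by (simp add: q_add)
  define p r where "p = grad x" and "r = grad y"
  have "cross p N = 0" "cross r N = 0"
    unfolding N_def cross_cross p_def r_def using xy dot_grad_commute[of x y]
    by (simp_all add: dot_grad_self qx qy)
  obtain x0 x1 x2 y0 y1 y2 where X: "x = (x0, x1, x2)" and Y: "y = (y0, y1, y2)"
    by (cases x; cases y) auto
  obtain p0 p1 p2 r0 r1 r2 where P: "p = (p0, p1, p2)" and R: "r = (r0, r1, r2)"
    by (cases p; cases r) auto
  have "x \<noteq> 0"
    using indep[of 1 0] by auto
  have "N \<noteq> 0"
  proof
    assume "N = 0"
    then have c: "x1 * y2 = x2 * y1" "x2 * y0 = x0 * y2" "x0 * y1 = x1 * y0"
      by (simp_all add: N_def X Y zero_prod_def)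
    have "smul y0 x + smul (- x0) y = 0" "smul y1 x + smul (- x1) y = 0" "smul y2 x + smul (- x2) y = 0"
      using c by (simp_all add: X Y zero_prod_def algebra_simps)
    with indep have "x0 = 0" "x1 = 0" "x2 = 0"
      by fastforce+
    with \<open>x \<noteq> 0\<close> show False by (simp add: X zero_prod_def)
  qed
  have key: "\<exists>a b. \<not> (a = 0 \<and> b = 0) \<and> smul a p + smul b r = 0"
  proof -
    obtain n0 n1 n2 where N: "N = (n0, n1, n2)" by (cases N)
    have pn: "p1 * n2 = p2 * n1" "p2 * n0 = p0 * n2" "p0 * n1 = p1 * n0"
      and rn: "r1 * n2 = r2 * n1" "r2 * n0 = r0 * n2" "r0 * n1 = r1 * n0"
      using \<open>cross p N = 0\<close> \<open>cross r N = 0\<close> by (simp_all add: P R N zero_prod_def)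
    have "\<exists>\<pi> \<rho>. p = smul \<pi> N \<and> r = smul \<rho> N"
    proof -
      consider "n0 \<noteq> 0" | "n1 \<noteq> 0" | "n2 \<noteq> 0"
        using \<open>N \<noteq> 0\<close> by (auto simp: N zero_prod_def)
      then show ?thesis
      proof cases
        case 1
        then show ?thesis
          using pn rn by (intro exI[of _ "p0 / n0"] exI[of _ "r0 / n0"]) (simp add: P R N field_simps)
      next
        case 2
        then show ?thesis
          using pn rn by (intro exI[of _ "p1 / n1"] exI[of _ "r1 / n1"]) (simp add: P R N field_simps)
      next
        case 3
        then show ?thesis
          using pn rn by (intro exI[of _ "p2 / n2"] exI[of _ "r2 / n2"]) (simp add: P R N field_simps)
      qed
    qed
    then obtain \<pi> \<rho> where pr: "p = smul \<pi> N" "r = smul \<rho> N" by blast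
    show ?thesis
    proof (cases "\<pi> = 0")
      case True
      then show ?thesis
        by (intro exI[of _ 1] exI[of _ 0]) (simp add: pr)
    next
      case False
      then show ?thesis
        by (intro exI[of _ \<rho>] exI[of _ "- \<pi>"]) (simp add: pr N zero_prod_def)
    qed
  qed
  then obtain a b where ab: "\<not> (a = 0 \<and> b = 0)" "smul a p + smul b r = 0" by blast
  have "grad (smul a x + smul b y) = 0"
    unfolding grad_lin using ab(2) by (simp add: p_def r_def)
  with iso have "smul a x + smul b y = 0" by (rule smooth)
  with indep ab(1) show False by blast
qed

end

text \<open>
  On the line \<open>z = 0\<close> a zero of the form is a root of a quadratic polynomial, or the point \<open>(1, 0, 0)\<close>.
\<close>

lemma (in ternary_form) isotropic_vector:
  assumes "\<And>b c. \<exists>x. x * x + b * x + c = (0 :: 'a)"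
  shows "\<exists>p. p \<noteq> 0 \<and> q p = 0"
proof (cases "A = 0")
  case True
  have "q (1, 0, 0) = A" by simp
  with True show ?thesis by (metis Pair_inject one_neq_zero zero_prod_def)
next
  case False
  obtain x where "x * x + D / A * x + B / A = 0"
    using assms by blast
  moreover have "A * x * x + B + D * x = A * (x * x + D / A * x + B / A)"
    using False by (simp add: field_simps)
  ultimately have "A * x * x + B + D * x = 0" by simp
  then show ?thesis by (intro exI[of _ "(x, 1, 0)"]) (simp add: zero_prod_def)
qed

lemma quadratic_root:
  fixes b c :: "'a::alg_closed_field"
  shows "\<exists>x. x * x + b * x + c = 0"
proof -
  have "\<exists>x. poly [:c, b, 1:] x = 0"
    by (rule alg_closed_imp_poly_has_root) simp
  then show ?thesis by (simp add: algebra_simps)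
qed

text \<open>
  Otherwise the polynomial \<open>1 + X (c + b X + a X\<^sup>2)\<close> is not constant, so it has a root. The root is not
  \<open>0\<close>, so the bracket vanishes there, which is absurd.
\<close>

lemma quadratic_zero_imp_coeffs_zero:
  fixes a b c :: "'a::alg_closed_field"
  assumes "\<And>x. x \<noteq> 0 \<Longrightarrow> a * x * x + b * x + c = 0"
  shows "a = 0 \<and> b = 0 \<and> c = 0"
proof (rule ccontr)
  assume nz: "\<not> ?thesis"
  have "\<exists>x. poly [:1, c, b, a:] x = 0"
    by (rule alg_closed_imp_poly_has_root) (use nz in auto)
  then obtain x where x: "1 + x * (a * x * x + b * x + c) = 0"
    by (auto simp: algebra_simps)
  then have "x \<noteq> 0" by auto
  with assms x show False by simp
qed

section \<open>Base change to the algebraic closure, and descent\<close>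

lemma coef_map: "h 0 = 0 \<Longrightarrow> coef (Poly_Mapping.map h p) m = h (coef p m)"
  by (simp add: Poly_Mapping.map.rep_eq when_def)

lemma map_add:
  fixes p q :: "'k::field bipoly" and h :: "'k \<Rightarrow> 'l::field"
  assumes "h 0 = 0" "\<And>x y. h (x + y) = h x + h y"
  shows "Poly_Mapping.map h (p + q) = Poly_Mapping.map h p + Poly_Mapping.map h q"
  by (rule poly_mapping_eqI) (simp add: coef_map assms lookup_add)

lemma map_zero: "Poly_Mapping.map h 0 = 0"
  by (rule poly_mapping_eqI) (simp add: Poly_Mapping.map.rep_eq)

lemma map_var_mult:
  fixes p :: "'k::field bipoly" and h :: "'k \<Rightarrow> 'l::field"
  assumes "h 0 = 0"
  shows "Poly_Mapping.map h (var x * p) = var x * Poly_Mapping.map h p"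
proof (rule poly_mapping_eqI)
  fix m
  show "coef (Poly_Mapping.map h (var x * p)) m = coef (var x * Poly_Mapping.map h p) m"
  proof (cases "expo m x = 0")
    case True
    then show ?thesis by (simp add: coef_map assms coef_var_mult_0)
  next
    case False
    then obtain m' where "m = mvar x + m'" by (rule mon_split)
    then show ?thesis
      by (simp add: coef_map[of h, OF assms] coef_var_mult del: One_nat_def)
  qed
qed

lemma coef_base_change [simp]: "coef (base_change p) m = to_ac (coef p m)"
  by (simp add: base_change_def coef_map)

lemma base_change_0 [simp]: "base_change 0 = 0"
  by (rule poly_mapping_eqI) simp

lemma base_change_add: "base_change (p + q) = base_change p + base_change q"
  by (rule poly_mapping_eqI) (simp add: lookup_add)

lemma base_change_scale: "base_change (scale c p) = scale (to_ac c) (base_change p)"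
  by (rule poly_mapping_eqI) simp

lemma base_change_var_mult: "base_change (var x * p) = var x * base_change p"
  unfolding base_change_def by (rule map_var_mult) simp

lemma base_change_eq_0_iff: "base_change p = 0 \<longleftrightarrow> p = 0"
proof
  assume "base_change p = 0"
  then have "coef (base_change p) m = 0" for m by simp
  then show "p = 0" by (intro poly_mapping_eqI) simp
qed simp

lemma base_change_homog: "p \<in> homog a \<Longrightarrow> base_change p \<in> homog a"
  by (rule homogI) (auto dest: homogD)

text \<open>
  A relation between polynomials over \<open>K\<close> with coefficients \<open>x\<^sub>i\<close> in the closure becomes a relation over
  \<open>K\<close> with coefficients \<open>\<phi> x\<^sub>i\<close>. The condition \<open>\<phi> c = 1\<close>, for a nonzero \<open>c\<close> of our choice, keeps the
  new relation nontrivial.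
\<close>

lemma linear_functional:
  fixes c :: "'k::field alg_closure"
  assumes "c \<noteq> 0"
  obtains \<phi> :: "'k alg_closure \<Rightarrow> 'k"
  where "\<And>x y. \<phi> (x + y) = \<phi> x + \<phi> y" "\<And>a x. \<phi> (x * to_ac a) = \<phi> x * a" "\<phi> c = 1"
proof -
  interpret V: vector_space_pair "\<lambda>(a :: 'k) x. to_ac a * x" "(*) :: 'k \<Rightarrow> 'k \<Rightarrow> 'k"
    by unfold_locales (simp_all add: algebra_simps)
  have "V.vs1.independent {c}"
    using assms V.vs1.independent_insertI[of c "{}"] V.vs1.independent_empty by simp
  then obtain \<phi> where \<phi>: "Vector_Spaces.linear (\<lambda>(a :: 'k) x. to_ac a * x) (*) \<phi>" "\<forall>x\<in>{c}. \<phi> x = 1"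
    using V.linear_independent_extend[of "{c}" "\<lambda>_. 1"] by blast
  interpret \<phi>: Vector_Spaces.linear "\<lambda>(a :: 'k) x. to_ac a * x" "(*)" \<phi> by fact
  show thesis
  proof
    show "\<phi> (x + y) = \<phi> x + \<phi> y" for x y by (rule \<phi>.add)
    show "\<phi> (x * to_ac a) = \<phi> x * a" for a x
      using \<phi>.scale[of a x] by (simp add: mult.commute)
    show "\<phi> c = 1" using \<phi>(2) by simp
  qed
qed

lemma map_functional_combination:
  fixes \<phi> :: "'k::field alg_closure \<Rightarrow> 'k"
  assumes \<phi>: "\<And>x y. \<phi> (x + y) = \<phi> x + \<phi> y" "\<And>a x. \<phi> (x * to_ac a) = \<phi> x * a"
  shows "Poly_Mapping.map \<phi> (scale x (base_change f) + scale y (base_change g) + scale z (base_change h)) =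
    scale (\<phi> x) f + scale (\<phi> y) g + scale (\<phi> z) h"
proof -
  have "\<phi> 0 = 0" using \<phi>(1)[of 0 0] by (metis add_0 add_cancel_left_left)
  then show ?thesis
    by (intro poly_mapping_eqI) (simp add: coef_map \<phi> lookup_add)
qed

lemma indep3_base_change:
  fixes f0 f1 f2 :: "'k::field bipoly"
  assumes "indep3 f0 f1 f2"
  shows "indep3 (base_change f0) (base_change f1) (base_change f2)"
  unfolding indep3_def
proof (intro allI impI)
  fix x y z
  assume eq: "scale x (base_change f0) + scale y (base_change f1) + scale z (base_change f2) = 0"
  have zero: "\<phi> x = 0 \<and> \<phi> y = 0 \<and> \<phi> z = 0"
    if "\<And>x y. \<phi> (x + y) = \<phi> x + \<phi> y" "\<And>a x. \<phi> (x * to_ac a) = \<phi> x * a" for \<phi>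
    using map_functional_combination[of \<phi> x f0 y f1 z f2, OF that] assms
    unfolding eq map_zero indep3_def by simp
  have "c = 0" if "c \<in> {x, y, z}" for c
  proof (rule ccontr)
    assume "c \<noteq> 0"
    then obtain \<phi> :: "'k alg_closure \<Rightarrow> 'k" where \<phi>: "\<And>x y. \<phi> (x + y) = \<phi> x + \<phi> y"
      "\<And>a x. \<phi> (x * to_ac a) = \<phi> x * a" "\<phi> c = 1"
      by (rule linear_functional) blast
    with zero[of \<phi>] that show False by auto
  qed
  then show "x = 0 \<and> y = 0 \<and> z = 0" by simp
qed

lemma indep2_base_change:
  assumes "indep2 g0 g1"
  shows "indep2 (base_change g0) (base_change g1)"
  unfolding indep2_def
proof (intro allI impI)
  fix x y
  assume eq: "scale x (base_change g0) + scale y (base_change g1) = 0"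
  have zero: "\<phi> x = 0 \<and> \<phi> y = 0"
    if "\<And>x y. \<phi> (x + y) = \<phi> x + \<phi> y" "\<And>a x. \<phi> (x * to_ac a) = \<phi> x * a" for \<phi>
    using map_functional_combination[of \<phi> x g0 y g1 0 0, OF that] assms
    unfolding indep2_def by (simp add: eq map_zero scale_simps)
  have "c = 0" if "c \<in> {x, y}" for c
  proof (rule ccontr)
    assume "c \<noteq> 0"
    then obtain \<phi> :: "'a alg_closure \<Rightarrow> 'a" where \<phi>: "\<And>x y. \<phi> (x + y) = \<phi> x + \<phi> y"
      "\<And>a x. \<phi> (x * to_ac a) = \<phi> x * a" "\<phi> c = 1"
      by (rule linear_functional) blast
    with zero[of \<phi>] that show False by auto
  qed
  then show "x = 0 \<and> y = 0" by simp
qed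

text \<open>
  Applying a \<open>K\<close>-linear functional to all coefficients commutes with multiplication by \<open>s\<close> and \<open>t\<close>, and it
  maps combinations of \<open>f0, f1, f2\<close> over the closure to combinations over \<open>K\<close>. The functional is chosen not to
  vanish on some coefficient of some \<open>F\<^sub>i\<close>.
\<close>

lemma descend_quadratic_syzygy:
  fixes f0 f1 f2 :: "'k::field bipoly"
  assumes F: "{F0, F1, F2} \<subseteq> lin_span {base_change f0, base_change f1, base_change f2}"
    and nz: "\<not> (F0 = 0 \<and> F1 = 0 \<and> F2 = 0)"
    and syz: "var VS ^ 2 * F0 + var VS * var VT * F1 + var VT ^ 2 * F2 = 0"
  obtains G0 G1 G2 where "{G0, G1, G2} \<subseteq> lin_span {f0, f1, f2}"
    "\<not> (G0 = 0 \<and> G1 = 0 \<and> G2 = 0)"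
    "var VS ^ 2 * G0 + var VS * var VT * G1 + var VT ^ 2 * G2 = 0"
proof -
  obtain G m where G: "G \<in> {F0, F1, F2}" "coef G m \<noteq> 0"
  proof -
    obtain G where "G \<in> {F0, F1, F2}" "G \<noteq> 0" using nz by blast
    then show thesis using that poly_mapping_eqI[of G 0] by auto
  qed
  obtain \<phi> :: "'k alg_closure \<Rightarrow> 'k" where \<phi>: "\<And>x y. \<phi> (x + y) = \<phi> x + \<phi> y"
      "\<And>a x. \<phi> (x * to_ac a) = \<phi> x * a" "\<phi> (coef G m) = 1"
    using G(2) by (rule linear_functional) blast
  have \<phi>0: "\<phi> 0 = 0" using \<phi>(1)[of 0 0] by (metis add_0 add_cancel_left_left)
  let ?M = "Poly_Mapping.map \<phi>"
  have span: "?M p \<in> lin_span {f0, f1, f2}"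
    if p: "p \<in> lin_span {base_change f0, base_change f1, base_change f2}" for p
  proof -
    obtain x y z where "p = scale x (base_change f0) + scale y (base_change f1) + scale z (base_change f2)"
      using p unfolding lin_span_triple by blast
    then have "?M p = scale (\<phi> x) f0 + scale (\<phi> y) f1 + scale (\<phi> z) f2"
      using map_functional_combination[of \<phi>, OF \<phi>(1,2)] by simp
    then show ?thesis
      unfolding lin_span_triple by blast
  qed
  have "coef (?M G) m = 1"
    using \<phi>(3) by (simp add: coef_map[of \<phi>, OF \<phi>0])
  then have "?M G \<noteq> 0" by auto
  have "var VS * (var VS * ?M F0) + var VS * (var VT * ?M F1) + var VT * (var VT * ?M F2) =
      ?M (var VS * (var VS * F0) + var VS * (var VT * F1) + var VT * (var VT * F2))"
    by (simp only: map_add[of \<phi>, OF \<phi>0 \<phi>(1)] map_var_mult[of \<phi>, OF \<phi>0])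
  also have "\<dots> = ?M 0"
    using syz by (simp only: power2_eq_square mult.assoc)
  finally have syz': "var VS ^ 2 * ?M F0 + var VS * var VT * ?M F1 + var VT ^ 2 * ?M F2 = 0"
    by (simp only: power2_eq_square mult.assoc map_zero)
  show thesis
  proof (rule that[OF _ _ syz'])
    show "{?M F0, ?M F1, ?M F2} \<subseteq> lin_span {f0, f1, f2}"
      using F span by simp
    show "\<not> (?M F0 = 0 \<and> ?M F1 = 0 \<and> ?M F2 = 0)"
      using G(1) \<open>?M G \<noteq> 0\<close> by auto
  qed
qed

section \<open>The Segre variety in coordinates\<close>

lemma proportional_if_wedge_zero:
  fixes g h :: "'k::field bipoly"
  assumes "g \<noteq> 0" "\<And>m m'. coef g m * coef h m' = coef g m' * coef h m"
  obtains c where "h = scale c g"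
proof -
  obtain m where m: "coef g m \<noteq> 0"
    using assms(1) poly_mapping_eqI[of g 0] by auto
  have "h = scale (coef h m / coef g m) g"
  proof (rule poly_mapping_eqI)
    fix m'
    show "coef h m' = coef (scale (coef h m / coef g m) g) m'"
      using assms(2)[of m m'] m by (simp add: field_simps)
  qed
  then show thesis by (rule that)
qed

lemma const_times: "const c * p = scale c p"
  by (simp add: scale_def)

lemma segreE:
  fixes a b :: "'k::field bipoly"
  assumes "var VS * a + var VT * b \<in> segre n" "a \<in> homog (0, int n)" "b \<in> homog (0, int n)"
  obtains p q g where "a = scale p g" "b = scale q g" "g \<in> homog (0, int n)"
proof -
  obtain l g where lg: "var VS * a + var VT * b = l * g" "l \<in> homog (1, 0)" "g \<in> homog (0, int n)"
    using assms(1) unfolding segre_def by blast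
  obtain lp lq where l: "l = var VS * lp + var VT * lq" "lp \<in> homog (0, 0)" "lq \<in> homog (0, 0)"
    using homog_st_split[OF lg(2)] by auto
  obtain p q where pq: "lp = const p" "lq = const q"
    using homog_00_const[OF l(2)] homog_00_const[OF l(3)] by metis
  have "l * g = var VS * (lp * g) + var VT * (lq * g)"
    unfolding l(1) by (simp only: distrib_right mult.assoc)
  then have "var VS * a + var VT * b = var VS * scale p g + var VT * scale q g"
    unfolding lg(1) pq const_times .
  then have "a = scale p g" "b = scale q g"
    using st_eq_iff[OF assms(2,3) homog_scale[OF lg(3)] homog_scale[OF lg(3)]] by blast+
  then show thesis using lg(3) by (rule that)
qed

text \<open>
  A product \<open>(p s + q t) g\<close> is \<open>s (p g) + t (q g)\<close>, so the elements of the Segre variety are those with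
  proportional components. The condition on the coefficients is the vanishing of the
  \<open>2 \<times> 2\<close> minors.
\<close>

lemma segre_iff_wedge_zero:
  fixes a b :: "'k::field bipoly"
  assumes hom: "a \<in> homog (0, int n)" "b \<in> homog (0, int n)"
  shows "var VS * a + var VT * b \<in> segre n \<longleftrightarrow>
    var VS * a + var VT * b \<noteq> 0 \<and> (\<forall>m m'. coef a m * coef b m' = coef a m' * coef b m)"
proof
  assume *: "var VS * a + var VT * b \<in> segre n"
  obtain p q g where "a = scale p g" "b = scale q g" "g \<in> homog (0, int n)"
    by (rule segreE[OF * hom])
  moreover have "var VS * a + var VT * b \<noteq> 0"
    using * unfolding segre_def by blast
  ultimately show "var VS * a + var VT * b \<noteq> 0 \<and>
      (\<forall>m m'. coef a m * coef b m' = coef a m' * coef b m)"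
    by (simp only: coef_scale) (simp add: mult_ac)
next
  assume *: "var VS * a + var VT * b \<noteq> 0 \<and> (\<forall>m m'. coef a m * coef b m' = coef a m' * coef b m)"
  have S: "var VS \<in> homog (1, 0)" and T: "var VT \<in> homog (1, 0)"
    using var_homog[of VS] var_homog[of VT] by simp_all
  have "\<exists>l g. var VS * a + var VT * b = l * g \<and> l \<in> homog (1, 0) \<and> g \<in> homog (0, int n)"
  proof (cases "a = 0")
    case True
    then show ?thesis using T hom(2) by (intro exI[of _ "var VT"] exI[of _ b]) simp
  next
    case False
    then obtain c where c: "b = scale c a"
      using * by (rule_tac proportional_if_wedge_zero[of a b]) auto
    have "var VS * a + var VT * b = (var VS + scale c (var VT)) * a"
      unfolding c by (simp only: scale_simps distrib_right)
    then show ?thesis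
      using homog_add[OF S homog_scale[OF T]] hom(1) by blast
  qed
  with * show "var VS * a + var VT * b \<in> segre n"
    unfolding segre_def by blast
qed

text \<open>
  The element of the span with coordinates \<open>x\<close>; triples are used for points of \<open>P(W)\<close>.
\<close>

definition comb3 :: "'k::field bipoly \<Rightarrow> 'k bipoly \<Rightarrow> 'k bipoly \<Rightarrow> 'k triple \<Rightarrow> 'k bipoly" where
  "comb3 f0 f1 f2 x = (case x of (x0, x1, x2) \<Rightarrow> scale x0 f0 + scale x1 f1 + scale x2 f2)"

lemma comb3_add: "comb3 f0 f1 f2 (x + y) = comb3 f0 f1 f2 x + comb3 f0 f1 f2 y"
  by (cases x; cases y) (simp add: comb3_def scale_simps)

lemma comb3_smul: "comb3 f0 f1 f2 (smul c x) = scale c (comb3 f0 f1 f2 x)"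
  by (cases x) (simp add: comb3_def scale_simps)

lemma comb3_eq_0_iff: "indep3 f0 f1 f2 \<Longrightarrow> comb3 f0 f1 f2 x = 0 \<longleftrightarrow> x = 0"
  by (cases x) (auto simp: comb3_def indep3_def zero_prod_def scale_simps)

lemma comb3_in_span: "comb3 f0 f1 f2 x \<in> lin_span {f0, f1, f2}"
  by (cases x) (auto simp: comb3_def lin_span_triple)

lemma in_span_comb3: "p \<in> lin_span {f0, f1, f2} \<Longrightarrow> \<exists>x. p = comb3 f0 f1 f2 x"
  unfolding lin_span_triple comb3_def by auto

definition vec3 :: "'a triple \<Rightarrow> 'a vec" where
  "vec3 x = (case x of (x0, x1, x2) \<Rightarrow> vec_of_list [x0, x1, x2])"

lemma vec3_simps [simp]:
  "dim_vec (vec3 x) = 3" "vec3 x \<in> carrier_vec 3"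
  "vec3 (x0, x1, x2) $ 0 = x0" "vec3 (x0, x1, x2) $ Suc 0 = x1" "vec3 (x0, x1, x2) $ 2 = x2"
  by (cases x; simp add: vec3_def vec_of_list_index carrier_vecI numeral_2_eq_2)+

lemma vec3_cases:
  assumes "v \<in> carrier_vec 3"
  obtains x where "v = vec3 x"
proof
  show "v = vec3 (v $ 0, v $ 1, v $ 2)"
  proof (rule eq_vecI)
    fix i assume "i < dim_vec (vec3 (v $ 0, v $ 1, v $ 2))"
    then consider "i = 0" | "i = Suc 0" | "i = 2" by fastforce
    then show "v $ i = vec3 (v $ 0, v $ 1, v $ 2) $ i"
      by cases simp_all
  qed (use assms in simp)
qed

lemma vec3_eq_0_iff: "vec3 x = 0\<^sub>v 3 \<longleftrightarrow> x = 0"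
proof (cases x)
  case (fields x0 x1 x2)
  show ?thesis
  proof
    assume *: "vec3 x = 0\<^sub>v 3"
    have "vec3 x $ 0 = 0" "vec3 x $ 1 = 0" "vec3 x $ 2 = 0"
      unfolding * by simp_all
    then show "x = 0" by (simp add: fields zero_prod_def)
  next
    assume "x = 0"
    then show "vec3 x = 0\<^sub>v 3"
    proof (intro eq_vecI)
      fix i assume "x = 0" "i < dim_vec (0\<^sub>v 3)"
      then consider "i = 0" | "i = Suc 0" | "i = 2" by fastforce
      then show "vec3 x $ i = 0\<^sub>v 3 $ i"
        by cases (simp_all add: \<open>x = 0\<close> zero_prod_def)
    qed simp
  qed
qed

lemma vec3_in_segre_section:
  "vec3 x \<in> segre_section n [f0, f1, f2] \<longleftrightarrow>
     comb3 (base_change f0) (base_change f1) (base_change f2) x \<in> segre n"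
proof -
  have *: "(\<Sum>i<3. h i) = h 0 + h 1 + h (2 :: nat)" for h :: "nat \<Rightarrow> 'a alg_closure bipoly"
    by (simp add: numeral_3_eq_3 numeral_2_eq_2)
  show ?thesis
    by (cases x) (simp add: segre_section_def comb3_def * numeral_3_eq_3[symmetric])
qed

lemma quadratic_form_vec3:
  assumes "B \<in> carrier_mat 3 3"
  shows "vec3 x \<bullet> (B *\<^sub>v vec3 x) =
    ternary_form.q (B $$ (0,0)) (B $$ (1,1)) (B $$ (2,2)) (B $$ (0,1) + B $$ (1,0))
      (B $$ (0,2) + B $$ (2,0)) (B $$ (1,2) + B $$ (2,1)) x"
proof -
  have *: "(\<Sum>i = 0..<3. h i) = h 0 + h 1 + h (2 :: nat)" for h :: "nat \<Rightarrow> 'a"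
    by (simp add: numeral_3_eq_3 numeral_2_eq_2)
  show ?thesis
    using assms by (cases x) (simp add: ternary_form.q.simps scalar_prod_def * algebra_simps)
qed

lemma gradient_vec3:
  assumes "B \<in> carrier_mat 3 3"
  shows "(B + transpose_mat B) *\<^sub>v vec3 x =
    vec3 (ternary_form.grad (B $$ (0,0)) (B $$ (1,1)) (B $$ (2,2)) (B $$ (0,1) + B $$ (1,0))
      (B $$ (0,2) + B $$ (2,0)) (B $$ (1,2) + B $$ (2,1)) x)"
proof -
  have *: "(\<Sum>i = 0..<3. h i) = h 0 + h 1 + h (2 :: nat)" for h :: "nat \<Rightarrow> 'a"
    by (simp add: numeral_3_eq_3 numeral_2_eq_2)
  show ?thesis
  proof (rule eq_vecI)
    fix i assume "i < dim_vec (vec3 (ternary_form.grad (B $$ (0,0)) (B $$ (1,1)) (B $$ (2,2))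
      (B $$ (0,1) + B $$ (1,0)) (B $$ (0,2) + B $$ (2,0)) (B $$ (1,2) + B $$ (2,1)) x))"
    then consider "i = 0" | "i = Suc 0" | "i = 2" by fastforce
    then show "((B + transpose_mat B) *\<^sub>v vec3 x) $ i =
        vec3 (ternary_form.grad (B $$ (0,0)) (B $$ (1,1)) (B $$ (2,2)) (B $$ (0,1) + B $$ (1,0))
          (B $$ (0,2) + B $$ (2,0)) (B $$ (1,2) + B $$ (2,1)) x) $ i"
      using assms by cases (cases x; simp add: ternary_form.grad.simps scalar_prod_def * algebra_simps)+
  qed (use assms in simp)
qed

lemma smooth_conicE:
  fixes f0 f1 f2 :: "'k::field bipoly"
  assumes "smooth_conic (segre_section n [f0, f1, f2])"
  obtains A B C D E F where "smooth_ternary_form A B C D E F"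
    "\<And>x. x \<noteq> 0 \<Longrightarrow> comb3 (base_change f0) (base_change f1) (base_change f2) x \<in> segre n \<longleftrightarrow>
       ternary_form.q A B C D E F x = 0"
proof -
  obtain A :: "'k mat" where "A \<in> carrier_mat 3 3"
    and A: "segre_section n [f0, f1, f2] =
        {x \<in> carrier_vec 3. x \<noteq> 0\<^sub>v 3 \<and> x \<bullet> (map_mat to_ac A *\<^sub>v x) = 0}"
      "\<forall>x\<in>segre_section n [f0, f1, f2].
         (map_mat to_ac A + transpose_mat (map_mat to_ac A)) *\<^sub>v x \<noteq> 0\<^sub>v 3"
    using assms unfolding smooth_conic_def Let_def by blast
  define B :: "'k alg_closure mat" where "B = map_mat to_ac A"
  have B: "B \<in> carrier_mat 3 3" using \<open>A \<in> carrier_mat 3 3\<close> by (simp add: B_def)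
  note quad = quadratic_form_vec3[OF B] and gr = gradient_vec3[OF B]
  let ?q = "ternary_form.q (B $$ (0,0)) (B $$ (1,1)) (B $$ (2,2)) (B $$ (0,1) + B $$ (1,0))
      (B $$ (0,2) + B $$ (2,0)) (B $$ (1,2) + B $$ (2,1))"
  let ?g = "ternary_form.grad (B $$ (0,0)) (B $$ (1,1)) (B $$ (2,2)) (B $$ (0,1) + B $$ (1,0))
      (B $$ (0,2) + B $$ (2,0)) (B $$ (1,2) + B $$ (2,1))"
  have mem: "vec3 x \<in> segre_section n [f0, f1, f2] \<longleftrightarrow> x \<noteq> 0 \<and> ?q x = 0" for x
    unfolding A(1) B_def[symmetric] quad[symmetric] using vec3_eq_0_iff[of x] by simp
  show thesis
  proof
    show "comb3 (base_change f0) (base_change f1) (base_change f2) x \<in> segre n \<longleftrightarrow> ?q x = 0"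
      if "x \<noteq> 0" for x
      using mem[of x] that unfolding vec3_in_segre_section by blast
    show "smooth_ternary_form (B $$ (0,0)) (B $$ (1,1)) (B $$ (2,2)) (B $$ (0,1) + B $$ (1,0))
      (B $$ (0,2) + B $$ (2,0)) (B $$ (1,2) + B $$ (2,1))"
    proof (unfold_locales, rule ccontr)
      fix x assume "?q x = 0" "?g x = 0" "x \<noteq> 0"
      then have "vec3 x \<in> segre_section n [f0, f1, f2]" using mem by blast
      then have "(B + transpose_mat B) *\<^sub>v vec3 x \<noteq> 0\<^sub>v 3"
        using A(2) unfolding B_def by blast
      then show False
        unfolding gr vec3_eq_0_iff using \<open>?g x = 0\<close> by blast
    qed
  qed
qed

section \<open>From a smooth conic to the resolution\<close>

lemma const_add: "const (x + y) = const x + const y"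
  and const_mult: "const (x * y) = const x * const y"
  by (simp_all add: const_def single_add mult_single)

text \<open>
  The \<open>2 \<times> 2\<close> minors of the coefficient matrix of \<open>a\<close> and \<open>b\<close>, that is, the coordinates of the exterior
  product.
\<close>

definition wedge :: "'k::field bipoly \<Rightarrow> 'k bipoly \<Rightarrow> (bivar \<Rightarrow>\<^sub>0 nat) \<Rightarrow> (bivar \<Rightarrow>\<^sub>0 nat) \<Rightarrow> 'k" where
  "wedge a b m m' = coef a m * coef b m' - coef a m' * coef b m"

lemma wedge_simps:
  "wedge (a + b) c m m' = wedge a c m m' + wedge b c m m'"
  "wedge a (b + c) m m' = wedge a b m m' + wedge a c m m'"
  "wedge (scale x a) b m m' = x * wedge a b m m'"
  "wedge a (scale x b) m m' = x * wedge a b m m'"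
  by (simp_all add: wedge_def lookup_add algebra_simps)

lemma wedge_self [simp]: "wedge a a m m' = 0"
  by (simp add: wedge_def mult.commute)

lemma wedge_commute: "wedge b a m m' = - wedge a b m m'"
  by (simp add: wedge_def mult.commute)

lemma segre_iff_wedge:
  fixes a b :: "'k::field bipoly"
  assumes hom: "a \<in> homog (0, int n)" "b \<in> homog (0, int n)"
  shows "var VS * a + var VT * b \<in> segre n \<longleftrightarrow>
    var VS * a + var VT * b \<noteq> 0 \<and> (\<forall>m m'. wedge a b m m' = 0)"
  unfolding segre_iff_wedge_zero[OF hom] wedge_def by simp

text \<open>
  \<open>P\<close> and \<open>R\<close> lie on the conic and \<open>S\<close> is the pole of the line through them, so each minor is a multiple
  of \<open>a b + \<kappa> c\<^sup>2\<close>. Hence \<open>P = l g\<close> and \<open>R = k h\<close> factor, where \<open>l, k\<close> and \<open>g, h\<close> are independent because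
  \<open>P + R\<close> does not factor. The vanishing of the mixed minors with \<open>S\<close> determines
  \<open>\<Delta> S = \<beta> k g - \<alpha> l h\<close>, where \<open>\<Delta>\<close> is the determinant of \<open>l, k\<close>. Multiplication by \<open>l k\<close> gives the
  syzygy \<open>\<Delta> l k S - \<beta> k\<^sup>2 P + \<alpha> l\<^sup>2 R = 0\<close>.
\<close>

lemma quadratic_syzygy_of_conic_frame:
  fixes p0 p1 r0 r1 s0 s1 :: "'k::alg_closed_field bipoly"
  assumes hom: "p0 \<in> homog (0, int n)" "p1 \<in> homog (0, int n)" "r0 \<in> homog (0, int n)"
      "r1 \<in> homog (0, int n)" "s0 \<in> homog (0, int n)" "s1 \<in> homog (0, int n)"
    and P: "P = var VS * p0 + var VT * p1" and R: "R = var VS * r0 + var VT * r1"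
    and S: "S = var VS * s0 + var VT * s1"
    and indep: "indep3 P R S" and "\<kappa> \<noteq> 0"
    and conic: "\<And>a b c. \<not> (a = 0 \<and> b = 0 \<and> c = 0) \<Longrightarrow>
      scale a P + scale b R + scale c S \<in> segre n \<longleftrightarrow> a * b + \<kappa> * c * c = 0"
  obtains F0 F1 F2 where "{F0, F1, F2} \<subseteq> lin_span {P, R, S}" "\<not> (F0 = 0 \<and> F1 = 0 \<and> F2 = 0)"
    "var VS ^ 2 * F0 + var VS * var VT * F1 + var VT ^ 2 * F2 = 0"
proof -
  note hs = homog_add[OF homog_add] homog_scale
  have conic': "a * b + \<kappa> * c * c = 0 \<longleftrightarrow>
      (\<forall>m m'. wedge (scale a p0 + scale b r0 + scale c s0) (scale a p1 + scale b r1 + scale c s1) m m' = 0)"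
    if nz: "\<not> (a = 0 \<and> b = 0 \<and> c = 0)" for a b c
  proof -
    have "scale a P + scale b R + scale c S =
        var VS * (scale a p0 + scale b r0 + scale c s0) + var VT * (scale a p1 + scale b r1 + scale c s1)"
      unfolding P R S by (simp add: scale_simps distrib_left)
    moreover have "scale a P + scale b R + scale c S \<noteq> 0"
      using indep nz unfolding indep3_def by blast
    moreover have "scale a p0 + scale b r0 + scale c s0 \<in> homog (0, int n)"
      "scale a p1 + scale b r1 + scale c s1 \<in> homog (0, int n)"
      by (intro homog_add homog_scale hom)+
    ultimately show ?thesis
      using conic[OF nz] segre_iff_wedge by metis
  qed
  have wP: "wedge p0 p1 m m' = 0" and wR: "wedge r0 r1 m m' = 0" for m m'
    using conic'[of 1 0 0] conic'[of 0 1 0] by (simp_all add: scale_simps)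
  have "\<not> (\<forall>m m'. wedge (p0 + r0) (p1 + r1) m m' = 0)"
    using conic'[of 1 1 0] by (simp add: scale_simps)
  then obtain m m' where wPR: "wedge p0 r1 m m' + wedge r0 p1 m m' \<noteq> 0"
    by (auto simp: wedge_simps wP wR add.commute)
  have pencil: "wedge p0 s1 m m' + wedge s0 p1 m m' = 0 \<and> wedge r0 s1 m m' + wedge s0 r1 m m' = 0" for m m'
  proof -
    define cPS where "cPS = wedge p0 s1 m m' + wedge s0 p1 m m'"
    define cRS where "cRS = wedge r0 s1 m m' + wedge s0 r1 m m'"
    define cSS where "cSS = wedge s0 s1 m m' - \<kappa> * (wedge p0 r1 m m' + wedge r0 p1 m m')"
    \<comment> \<open>The points \<open>t P - (\<kappa> / t) R + S\<close> lie on the conic; a minor at such a point, times \<open>t\<close>, is a quadratic polynomial in \<open>t\<close>.\<close>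
    have "cPS * t * t + cSS * t + (- \<kappa> * cRS) = 0" if t: "t \<noteq> 0" for t
    proof -
      have "wedge (scale t p0 + scale (- \<kappa> / t) r0 + scale 1 s0)
          (scale t p1 + scale (- \<kappa> / t) r1 + scale 1 s1) m m' = 0"
        using conic'[of t "- \<kappa> / t" 1] t by simp
      then have "t * cPS + cSS + (- \<kappa> / t) * cRS = 0"
        unfolding wedge_simps wP wR cPS_def cRS_def cSS_def using t by (simp add: algebra_simps)
      moreover have "cPS * t * t + cSS * t + (- \<kappa> * cRS) = t * (t * cPS + cSS + (- \<kappa> / t) * cRS)"
        using t by (simp add: field_simps)
      ultimately show ?thesis by simp
    qed
    from quadratic_zero_imp_coeffs_zero[OF this] show ?thesis
      using \<open>\<kappa> \<noteq> 0\<close> by (simp add: cPS_def cRS_def)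
  qed
  have "P \<in> segre n" "R \<in> segre n"
    using conic[of 1 0 0] conic[of 0 1 0] by (simp_all add: scale_simps)
  obtain \<pi>0 \<pi>1 g where g: "p0 = scale \<pi>0 g" "p1 = scale \<pi>1 g" "g \<in> homog (0, int n)"
    by (rule segreE[OF \<open>P \<in> segre n\<close>[unfolded P] hom(1,2)])
  obtain \<rho>0 \<rho>1 h where h: "r0 = scale \<rho>0 h" "r1 = scale \<rho>1 h" "h \<in> homog (0, int n)"
    by (rule segreE[OF \<open>R \<in> segre n\<close>[unfolded R] hom(3,4)])
  define \<Delta> where "\<Delta> = \<pi>0 * \<rho>1 - \<pi>1 * \<rho>0"
  have "wedge p0 r1 m m' + wedge r0 p1 m m' = \<Delta> * wedge g h m m'"
    unfolding g h wedge_simps wedge_commute[of h g] \<Delta>_def by (simp add: algebra_simps)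
  with wPR have "\<Delta> \<noteq> 0" "g \<noteq> 0" "h \<noteq> 0"
    by (auto simp: wedge_def)
  have "wedge g (scale \<pi>0 s1 + scale (- \<pi>1) s0) m m' = 0" for m m'
    using pencil[of m m'] unfolding g wedge_simps wedge_commute[of g s0] by simp
  then obtain \<beta> where \<beta>: "scale \<pi>0 s1 + scale (- \<pi>1) s0 = scale \<beta> g"
    using proportional_if_wedge_zero[OF \<open>g \<noteq> 0\<close>] unfolding wedge_def by (metis eq_iff_diff_eq_0)
  have "wedge h (scale \<rho>0 s1 + scale (- \<rho>1) s0) m m' = 0" for m m'
    using pencil[of m m'] unfolding h wedge_simps wedge_commute[of h s0] by simp
  then obtain \<alpha> where \<alpha>: "scale \<rho>0 s1 + scale (- \<rho>1) s0 = scale \<alpha> h"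
    using proportional_if_wedge_zero[OF \<open>h \<noteq> 0\<close>] unfolding wedge_def by (metis eq_iff_diff_eq_0)
  \<comment> \<open>The coefficients of \<open>s\<^sup>2\<close>, \<open>s t\<close> and \<open>t\<^sup>2\<close> in \<open>\<Delta> l k S - \<beta> k\<^sup>2 P + \<alpha> l\<^sup>2 R\<close>.\<close>
  define F0 where "F0 = scale (- \<beta> * \<rho>0 * \<rho>0) P + scale (\<alpha> * \<pi>0 * \<pi>0) R + scale (\<Delta> * (\<pi>0 * \<rho>0)) S"
  define F1 where "F1 = scale (- (\<beta> * \<rho>0 * \<rho>1 + \<beta> * \<rho>0 * \<rho>1)) P + scale (\<alpha> * \<pi>0 * \<pi>1 + \<alpha> * \<pi>0 * \<pi>1) R +
    scale (\<Delta> * (\<pi>0 * \<rho>1 + \<pi>1 * \<rho>0)) S"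
  define F2 where "F2 = scale (- \<beta> * \<rho>1 * \<rho>1) P + scale (\<alpha> * \<pi>1 * \<pi>1) R + scale (\<Delta> * (\<pi>1 * \<rho>1)) S"
  show thesis
  proof
    show "{F0, F1, F2} \<subseteq> lin_span {P, R, S}"
      unfolding F0_def F1_def F2_def lin_span_triple by blast
    show "\<not> (F0 = 0 \<and> F1 = 0 \<and> F2 = 0)"
    proof
      assume *: "F0 = 0 \<and> F1 = 0 \<and> F2 = 0"
      have "\<Delta> * (\<pi>0 * \<rho>0) = 0" "\<Delta> * (\<pi>0 * \<rho>1 + \<pi>1 * \<rho>0) = 0" "\<Delta> * (\<pi>1 * \<rho>1) = 0"
        using * indep unfolding indep3_def F0_def F1_def F2_def by blast+
      with \<open>\<Delta> \<noteq> 0\<close> have "\<pi>0 * \<rho>0 = 0" "\<pi>0 * \<rho>1 + \<pi>1 * \<rho>0 = 0" "\<pi>1 * \<rho>1 = 0"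
        by simp_all
      then show False using \<open>\<Delta> \<noteq> 0\<close> by (auto simp: \<Delta>_def)
    qed
    define s t :: "'k bipoly" where "s = var VS" and "t = var VT"
    define l k where "l = scale \<pi>0 s + scale \<pi>1 t" and "k = scale \<rho>0 s + scale \<rho>1 t"
    have Pl: "P = l * g" and Rk: "R = k * h"
      unfolding P R g h l_def k_def s_def t_def by (simp_all add: scale_simps distrib_right)
    have S1: "scale \<Delta> S = k * scale \<beta> g - l * scale \<alpha> h"
      unfolding \<alpha>[symmetric] \<beta>[symmetric] l_def k_def S \<Delta>_def s_def[symmetric] t_def[symmetric]
      by (simp add: scale_simps algebra_simps)
    have F0': "F0 = scale (\<pi>0 * \<rho>0) (scale \<Delta> S) - scale (\<beta> * \<rho>0 * \<rho>0) P + scale (\<alpha> * \<pi>0 * \<pi>0) R"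
      and F1': "F1 = scale (\<pi>0 * \<rho>1 + \<pi>1 * \<rho>0) (scale \<Delta> S) - scale (\<beta> * \<rho>0 * \<rho>1 + \<beta> * \<rho>0 * \<rho>1) P +
        scale (\<alpha> * \<pi>0 * \<pi>1 + \<alpha> * \<pi>0 * \<pi>1) R"
      and F2': "F2 = scale (\<pi>1 * \<rho>1) (scale \<Delta> S) - scale (\<beta> * \<rho>1 * \<rho>1) P + scale (\<alpha> * \<pi>1 * \<pi>1) R"
      unfolding F0_def F1_def F2_def by (simp_all add: scale_simps mult.commute)
    have "s ^ 2 * F0 + s * t * F1 + t ^ 2 * F2 =
        l * k * scale \<Delta> S - scale \<beta> (k * k * P) + scale \<alpha> (l * l * R)"
      unfolding F0' F1' F2' l_def k_def scale_def const_add const_mult power2_eq_square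
      by (simp add: algebra_simps)
    also have "\<dots> = 0"
      unfolding S1 Pl Rk by (simp add: scale_simps algebra_simps)
    finally show "var VS ^ 2 * F0 + var VS * var VT * F1 + var VT ^ 2 * F2 = 0"
      unfolding s_def t_def .
  qed
qed

lemma (in ternary_form) q_zero: "q 0 = 0"
  by (simp add: zero_prod_def)

lemma smul_combination_add:
  "smul (a + a') p + smul (b + b') r + smul (c + c') s =
    (smul a p + smul b r + smul c s) + (smul a' p + smul b' r + smul c' s)"
  by (cases p; cases r; cases s) (simp add: algebra_simps)

text \<open>
  Adding a relation \<open>(a, b, c)\<close> to any coordinate vector leaves the value of \<open>a b + \<kappa> c\<^sup>2\<close> unchanged.
  Comparing the values at \<open>(0, 0, 0)\<close>, \<open>(1, 0, 0)\<close> and \<open>(0, 1, 0)\<close> gives the claim.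
\<close>

lemma (in ternary_form) hyperbolic_frame_independent:
  assumes "\<kappa> \<noteq> 0"
    and form: "\<And>a b c. q (smul a p + smul b r + smul c s) = a * b + \<kappa> * c * c"
    and zero: "smul a p + smul b r + smul c s = 0"
  shows "a = 0 \<and> b = 0 \<and> c = 0"
proof -
  have inv: "(a + a') * (b + b') + \<kappa> * (c + c') * (c + c') = a' * b' + \<kappa> * c' * c'" for a' b' c'
    unfolding form[symmetric] smul_combination_add zero by simp
  have "a * b + \<kappa> * c * c = 0" using inv[of 0 0 0] by simp
  moreover have "(a * b + \<kappa> * c * c) + b = 0" using inv[of 1 0 0] by (simp add: algebra_simps)
  moreover have "(a * b + \<kappa> * c * c) + a = 0" using inv[of 0 1 0] by (simp add: algebra_simps)
  ultimately have "b = 0" "a = 0" by (metis add_0)+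
  with \<open>a * b + \<kappa> * c * c = 0\<close> \<open>\<kappa> \<noteq> 0\<close> show ?thesis by simp
qed

lemma comb3_homog:
  "f0 \<in> homog a \<Longrightarrow> f1 \<in> homog a \<Longrightarrow> f2 \<in> homog a \<Longrightarrow> comb3 f0 f1 f2 x \<in> homog a"
  by (cases x) (auto simp: comb3_def intro!: homog_add homog_scale)

text \<open>
  Such a syzygy makes the two elements \<open>t g\<close> and \<open>- s g\<close>. All their combinations factor, so they span
  a line on the conic.
\<close>

lemma no_linear_syzygy:
  fixes c0 c1 c2 :: "'k::field bipoly"
  assumes "smooth_ternary_form A B C D E F" and indep: "indep3 c0 c1 c2"
    and hom: "c0 \<in> homog (1, int n)" "c1 \<in> homog (1, int n)" "c2 \<in> homog (1, int n)"
    and conic: "\<And>x. x \<noteq> 0 \<Longrightarrow> comb3 c0 c1 c2 x \<in> segre n \<longleftrightarrow> ternary_form.q A B C D E F x = 0"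
    and lin: "var VS * comb3 c0 c1 c2 x + var VT * comb3 c0 c1 c2 y = 0"
  shows "comb3 c0 c1 c2 x = 0"
proof (rule ccontr)
  assume nz: "comb3 c0 c1 c2 x \<noteq> 0"
  interpret Q: smooth_ternary_form A B C D E F by fact
  have "var VS ^ 2 * comb3 c0 c1 c2 x + var VS * var VT * comb3 c0 c1 c2 y + var VT ^ 2 * 0 =
      var VS * (var VS * comb3 c0 c1 c2 x + var VT * comb3 c0 c1 c2 y)"
    by (simp add: algebra_simps power2_eq_square)
  then have syz: "var VS ^ 2 * comb3 c0 c1 c2 x + var VS * var VT * comb3 c0 c1 c2 y + var VT ^ 2 * 0 = 0"
    unfolding lin by simp
  obtain g0 g where g: "g \<in> homog (0, int n)" "comb3 c0 c1 c2 x = var VT * g"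
    "comb3 c0 c1 c2 y = - (var VT * g0 + var VS * g)" "0 = var VS * g0"
    using form_of_quadratic_syzygy[OF comb3_homog[OF hom] comb3_homog[OF hom] homog_0 syz] by metis
  then have "g0 = 0" by simp
  with g nz have g': "comb3 c0 c1 c2 y = - (var VS * g)" "g \<noteq> 0" by simp_all
  have comb: "comb3 c0 c1 c2 (smul a x + smul b y) = var VS * scale (- b) g + var VT * scale a g" for a b
    unfolding comb3_add comb3_smul g(2) g'(1) by (simp add: scale_simps)
  show False
  proof (rule Q.no_isotropic_plane[of x y])
    fix a b assume "smul a x + smul b y = 0"
    then have "var VS * scale (- b) g + var VT * scale a g = 0"
      unfolding comb[symmetric] comb3_eq_0_iff[OF indep] .
    from st_independent[OF this homog_scale[OF g(1)] homog_scale[OF g(1)]]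
    show "a = 0 \<and> b = 0"
      using g'(2) by (simp add: scale_eq_0_iff)
  next
    fix a b
    show "Q.q (smul a x + smul b y) = 0"
    proof (cases "smul a x + smul b y = 0")
      case True
      then show ?thesis by (simp only: Q.q_zero)
    next
      case False
      then have "comb3 c0 c1 c2 (smul a x + smul b y) \<noteq> 0"
        unfolding comb3_eq_0_iff[OF indep] .
      then have "comb3 c0 c1 c2 (smul a x + smul b y) \<in> segre n"
        unfolding comb segre_iff_wedge[OF homog_scale[OF g(1)] homog_scale[OF g(1)]]
        by (simp add: wedge_simps)
      with conic[OF False] show ?thesis by blast
    qed
  qed
qed

lemma quadratic_syzygy_of_smooth_conic:
  fixes c0 c1 c2 :: "'k::alg_closed_field bipoly"
  assumes "smooth_ternary_form A B C D E F" and indep: "indep3 c0 c1 c2"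
    and hom: "c0 \<in> homog (1, int n)" "c1 \<in> homog (1, int n)" "c2 \<in> homog (1, int n)"
    and conic: "\<And>x. x \<noteq> 0 \<Longrightarrow> comb3 c0 c1 c2 x \<in> segre n \<longleftrightarrow> ternary_form.q A B C D E F x = 0"
  obtains F0 F1 F2 where "{F0, F1, F2} \<subseteq> lin_span {c0, c1, c2}" "\<not> (F0 = 0 \<and> F1 = 0 \<and> F2 = 0)"
    "var VS ^ 2 * F0 + var VS * var VT * F1 + var VT ^ 2 * F2 = 0"
proof -
  interpret Q: smooth_ternary_form A B C D E F by fact
  obtain p where p: "p \<noteq> 0" "Q.q p = 0"
    using Q.isotropic_vector[OF quadratic_root] by blast
  obtain r s \<kappa> where \<kappa>: "\<kappa> \<noteq> 0"
    and form: "\<And>a b c. Q.q (smul a p + smul b r + smul c s) = a * b + \<kappa> * c * c"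
    using Q.hyperbolic_basis[OF p(2,1)] by blast
  let ?c = "comb3 c0 c1 c2"
  have comb: "scale a (?c p) + scale b (?c r) + scale c (?c s) = ?c (smul a p + smul b r + smul c s)" for a b c
    unfolding comb3_add comb3_smul ..
  have ind: "indep3 (?c p) (?c r) (?c s)"
    unfolding indep3_def comb comb3_eq_0_iff[OF indep]
    using Q.hyperbolic_frame_independent[OF \<kappa> form] by blast
  have conic': "scale a (?c p) + scale b (?c r) + scale c (?c s) \<in> segre n \<longleftrightarrow> a * b + \<kappa> * c * c = 0"
    if "\<not> (a = 0 \<and> b = 0 \<and> c = 0)" for a b c
  proof -
    have "smul a p + smul b r + smul c s \<noteq> 0"
      using Q.hyperbolic_frame_independent[OF \<kappa> form] that by blast
    from conic[OF this] show ?thesis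
      unfolding comb form .
  qed
  have h: "?c x \<in> homog (1, int n)" for x
    by (rule comb3_homog[OF hom])
  obtain p0 p1 where P: "?c p = var VS * p0 + var VT * p1" "p0 \<in> homog (0, int n)" "p1 \<in> homog (0, int n)"
    using homog_st_split[OF h[of p]] by auto
  obtain r0 r1 where R: "?c r = var VS * r0 + var VT * r1" "r0 \<in> homog (0, int n)" "r1 \<in> homog (0, int n)"
    using homog_st_split[OF h[of r]] by auto
  obtain s0 s1 where S: "?c s = var VS * s0 + var VT * s1" "s0 \<in> homog (0, int n)" "s1 \<in> homog (0, int n)"
    using homog_st_split[OF h[of s]] by auto
  obtain F0 F1 F2 where F: "{F0, F1, F2} \<subseteq> lin_span {?c p, ?c r, ?c s}" "\<not> (F0 = 0 \<and> F1 = 0 \<and> F2 = 0)"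
    "var VS ^ 2 * F0 + var VS * var VT * F1 + var VT ^ 2 * F2 = 0"
    by (rule quadratic_syzygy_of_conic_frame[OF P(2,3) R(2,3) S(2,3) P(1) R(1) S(1) ind \<kappa> conic'])
  have "{?c p, ?c r, ?c s} \<subseteq> lin_span {c0, c1, c2}"
    using comb3_in_span by blast
  then have "{F0, F1, F2} \<subseteq> lin_span {c0, c1, c2}"
    using F(1) lin_span_mono by blast
  then show thesis using F(2,3) by (rule that)
qed

lemma betti_if_smooth_conic:
  fixes n :: nat and W :: "'k::field bipoly set" and f0 f1 f2 :: "'k bipoly"
  assumes "n > 0" and W: "W = lin_span {f0, f1, f2}" and dim: "lin_dim W = 3"
    and hom: "W \<subseteq> homog (1, int n)" and bpf: "basepoint_free W"
    and smooth: "smooth_conic (segre_section n [f0, f1, f2])"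
  shows "has_bigraded_betti (ideal_gen W)
      [replicate_mset 3 (1, int n),
       {#(1, 3 * int n)#} + replicate_mset 3 (2, 2 * int n) + {#(3, int n)#},
       replicate_mset 2 (2, 3 * int n) + replicate_mset 2 (3, 2 * int n),
       {#(3, 3 * int n)#}]"
proof -
  have indep: "indep3 f0 f1 f2"
    using indep3_if_dim_3 dim unfolding W .
  define c0 c1 c2 where "c0 = base_change f0" and "c1 = base_change f1" and "c2 = base_change f2"
  note c_defs = c0_def c1_def c2_def
  have indep_c: "indep3 c0 c1 c2"
    unfolding c_defs by (rule indep3_base_change[OF indep])
  have "f0 \<in> W" "f1 \<in> W" "f2 \<in> W"
    unfolding W by (rule lin_span_base, simp)+
  then have hom_c: "c0 \<in> homog (1, int n)" "c1 \<in> homog (1, int n)" "c2 \<in> homog (1, int n)"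
    unfolding c_defs using hom base_change_homog by blast+
  obtain A B C D E F where Q: "smooth_ternary_form A B C D E F"
    and conic: "\<And>x. x \<noteq> 0 \<Longrightarrow> comb3 c0 c1 c2 x \<in> segre n \<longleftrightarrow> ternary_form.q A B C D E F x = 0"
    using smooth_conicE[OF smooth] unfolding c_defs by blast
  obtain F0 F1 F2 where F: "{F0, F1, F2} \<subseteq> lin_span {c0, c1, c2}" "\<not> (F0 = 0 \<and> F1 = 0 \<and> F2 = 0)"
    "var VS ^ 2 * F0 + var VS * var VT * F1 + var VT ^ 2 * F2 = 0"
    by (rule quadratic_syzygy_of_smooth_conic[OF Q indep_c hom_c conic])
  obtain G0 G1 G2 where G: "{G0, G1, G2} \<subseteq> W" "\<not> (G0 = 0 \<and> G1 = 0 \<and> G2 = 0)"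
    "var VS ^ 2 * G0 + var VS * var VT * G1 + var VT ^ 2 * G2 = 0"
    using descend_quadratic_syzygy[OF F[unfolded c_defs]] unfolding W by blast
  have bc: "\<exists>x. base_change H = comb3 c0 c1 c2 x" if "H \<in> W" for H
  proof -
    obtain x y z where "H = scale x f0 + scale y f1 + scale z f2"
      using \<open>H \<in> W\<close> unfolding W lin_span_triple by blast
    then have "base_change H = comb3 c0 c1 c2 (to_ac x, to_ac y, to_ac z)"
      by (simp add: comb3_def c_defs base_change_add base_change_scale)
    then show ?thesis ..
  qed
  have lin: "H0 = 0" if H: "H0 \<in> W" "H1 \<in> W" "var VS * H0 + var VT * H1 = 0" for H0 H1
  proof -
    obtain x y where xy: "base_change H0 = comb3 c0 c1 c2 x" "base_change H1 = comb3 c0 c1 c2 y"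
      using bc H(1,2) by blast
    have syz: "var VS * comb3 c0 c1 c2 x + var VT * comb3 c0 c1 c2 y = 0"
      unfolding xy[symmetric] base_change_var_mult[symmetric] base_change_add[symmetric] H(3) by simp
    have "comb3 c0 c1 c2 x = 0"
      by (rule no_linear_syzygy[OF Q indep_c hom_c _ syz]) (rule conic)
    then show "H0 = 0"
      unfolding xy(1)[symmetric] base_change_eq_0_iff .
  qed
  have Gm: "G0 \<in> W" "G1 \<in> W" "G2 \<in> W" using G(1) by simp_all
  obtain g0 g1 where g: "g0 \<in> homog (0, int n)" "g1 \<in> homog (0, int n)" "indep2 g0 g1"
    "W = lin_span {var VS * g0, var VT * g0 + var VS * g1, var VT * g1}"
    by (rule bilinear_form[OF W hom Gm G(2,3) lin])
  show ?thesis
    by (rule betti_if_bilinear_form[OF assms(1) g bpf])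
qed

section \<open>From the resolution to a smooth conic\<close>

lemma comb3_inject:
  assumes "indep3 f0 f1 f2" "comb3 f0 f1 f2 x = comb3 f0 f1 f2 y"
  shows "x = y"
proof -
  have "comb3 f0 f1 f2 (x + smul (- 1) y) = 0"
    unfolding comb3_add comb3_smul assms(2) by (simp add: scale_simps)
  then have "x + smul (- 1) y = 0"
    using comb3_eq_0_iff[OF assms(1)] by blast
  then show ?thesis
    by (cases x; cases y) (simp add: zero_prod_def)
qed

lemma wedge_nonzero:
  assumes "indep2 g0 g1"
  obtains m m' where "wedge g0 g1 m m' \<noteq> 0"
proof (rule ccontr)
  assume "\<not> thesis"
  then have z: "coef g0 m * coef g1 m' = coef g0 m' * coef g1 m" for m m'
    using that unfolding wedge_def by (metis eq_iff_diff_eq_0)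
  have "g0 \<noteq> 0"
  proof
    assume "g0 = 0"
    then have "scale 1 g0 + scale 0 g1 = 0" by (simp add: scale_simps)
    then show False using assms zero_neq_one unfolding indep2_def by metis
  qed
  then obtain c where "g1 = scale c g0"
    using proportional_if_wedge_zero z by blast
  then have "scale (- c) g0 + scale 1 g1 = 0" by (simp add: scale_simps)
  then show False using assms zero_neq_one unfolding indep2_def by metis
qed

text \<open>
  The minors of \<open>y\<^sub>0 g\<^sub>0 + y\<^sub>1 g\<^sub>1\<close> and \<open>y\<^sub>1 g\<^sub>0 + y\<^sub>2 g\<^sub>1\<close> are \<open>y\<^sub>0 y\<^sub>2 - y\<^sub>1\<^sup>2\<close> times those of \<open>g\<^sub>0\<close> and \<open>g\<^sub>1\<close>.
\<close>

lemma bilinear_in_segre_iff: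
  fixes g0 g1 :: "'k::field bipoly"
  assumes hom: "g0 \<in> homog (0, int n)" "g1 \<in> homog (0, int n)" and "indep2 g0 g1"
  shows "comb3 (var VS * g0) (var VT * g0 + var VS * g1) (var VT * g1) (y0, y1, y2) \<in> segre n \<longleftrightarrow>
    (y0, y1, y2) \<noteq> 0 \<and> y0 * y2 - y1 * y1 = 0"
proof -
  let ?f = "comb3 (var VS * g0) (var VT * g0 + var VS * g1) (var VT * g1) (y0, y1, y2)"
  have f: "?f = var VS * (scale y0 g0 + scale y1 g1) + var VT * (scale y1 g0 + scale y2 g1)"
    by (simp add: comb3_def scale_simps algebra_simps)
  obtain m m' where mm: "wedge g0 g1 m m' \<noteq> 0"
    using assms(3) by (rule wedge_nonzero)
  have w: "wedge (scale y0 g0 + scale y1 g1) (scale y1 g0 + scale y2 g1) m m' =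
      (y0 * y2 - y1 * y1) * wedge g0 g1 m m'" for m m'
    unfolding wedge_simps wedge_commute[of g1 g0] by (simp add: algebra_simps)
  have "(\<forall>m m'. (y0 * y2 - y1 * y1) * wedge g0 g1 m m' = 0) \<longleftrightarrow> y0 * y2 - y1 * y1 = 0"
    using mm by auto
  moreover have "?f \<noteq> 0 \<longleftrightarrow> (y0, y1, y2) \<noteq> 0"
    using comb3_eq_0_iff[OF indep3_bilinear[OF assms(3) hom]] by blast
  moreover have "scale y0 g0 + scale y1 g1 \<in> homog (0, int n)" "scale y1 g0 + scale y2 g1 \<in> homog (0, int n)"
    by (intro homog_add homog_scale hom)+
  from segre_iff_wedge[OF this]
  have "?f \<in> segre n \<longleftrightarrow> ?f \<noteq> 0 \<and> (\<forall>m m'. (y0 * y2 - y1 * y1) * wedge g0 g1 m m' = 0)"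
    unfolding f w .
  ultimately show ?thesis by blast
qed

definition to_ac3 :: "'k::field triple \<Rightarrow> 'k alg_closure triple" where
  "to_ac3 x = (case x of (x0, x1, x2) \<Rightarrow> (to_ac x0, to_ac x1, to_ac x2))"

lemma to_ac3_add: "to_ac3 (x + y) = to_ac3 x + to_ac3 y"
  by (cases x; cases y) (simp add: to_ac3_def)

lemma to_ac3_smul: "to_ac3 (smul c x) = smul (to_ac c) (to_ac3 x)"
  by (cases x) (simp add: to_ac3_def)

lemma base_change_comb3:
  "base_change (comb3 f0 f1 f2 x) = comb3 (base_change f0) (base_change f1) (base_change f2) (to_ac3 x)"
  by (cases x) (simp add: comb3_def to_ac3_def base_change_add base_change_scale)

text \<open>
  The conic is \<open>y\<^sub>0 y\<^sub>2 = y\<^sub>1\<^sup>2\<close> in the coordinates of the bilinear basis, and the change to the coordinates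
  of \<open>f0, f1, f2\<close> is defined over \<open>K\<close>. At a singular point \<open>y\<^sub>0\<close> and \<open>y\<^sub>2\<close> would vanish, and then \<open>y\<^sub>1\<close> by
  the equation, in every characteristic.
\<close>

lemma smooth_conic_if_bilinear_form:
  fixes f0 f1 f2 g0 g1 :: "'k::field bipoly"
  assumes g: "g0 \<in> homog (0, int n)" "g1 \<in> homog (0, int n)" "indep2 g0 g1"
    and indep: "indep3 f0 f1 f2"
    and W: "lin_span {f0, f1, f2} = lin_span {var VS * g0, var VT * g0 + var VS * g1, var VT * g1}"
  shows "smooth_conic (segre_section n [f0, f1, f2])"
proof -
  let ?F = "comb3 (var VS * g0) (var VT * g0 + var VS * g1) (var VT * g1)"
  note indep_F = indep3_bilinear[OF g(3,1,2)]
  have span: "\<exists>x. f = ?F x" if "f \<in> {f0, f1, f2}" for f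
    using lin_span_base[OF that] unfolding W by (rule in_span_comb3)
  obtain N0 where N0: "f0 = ?F N0" using span[of f0] by blast
  obtain N1 where N1: "f1 = ?F N1" using span[of f1] by blast
  obtain N2 where N2: "f2 = ?F N2" using span[of f2] by blast
  note N = N0 N1 N2
  obtain a0 b0 d0 a1 b1 d1 a2 b2 d2
    where N_abc: "N0 = (a0, b0, d0)" "N1 = (a1, b1, d1)" "N2 = (a2, b2, d2)"
    by (cases N0; cases N1; cases N2) blast
  have M: "\<exists>x0 x1 x2. e = smul x0 N0 + smul x1 N1 + smul x2 N2" for e
  proof -
    have "?F e \<in> lin_span {f0, f1, f2}"
      unfolding W by (rule comb3_in_span)
    then obtain x where "?F e = comb3 f0 f1 f2 x"
      using in_span_comb3 by blast
    moreover obtain x0 x1 x2 where "x = (x0, x1, x2)" by (cases x)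
    ultimately have "?F e = ?F (smul x0 N0 + smul x1 N1 + smul x2 N2)"
      unfolding comb3_add comb3_smul N[symmetric] by (simp add: comb3_def)
    then show ?thesis
      using comb3_inject[OF indep_F] by blast
  qed
  let ?c = "comb3 (base_change f0) (base_change f1) (base_change f2)"
  let ?G = "comb3 (var VS * base_change g0) (var VT * base_change g0 + var VS * base_change g1)
    (var VT * base_change g1)"
  let ?n0 = "to_ac3 N0" and ?n1 = "to_ac3 N1" and ?n2 = "to_ac3 N2"
  have bcF: "base_change (?F x) = ?G (to_ac3 x)" for x
    unfolding base_change_comb3 by (simp add: base_change_add base_change_var_mult)
  have c: "?c (x0, x1, x2) = ?G (smul x0 ?n0 + smul x1 ?n1 + smul x2 ?n2)" for x0 x1 x2
    unfolding comb3_add comb3_smul bcF[symmetric] N[symmetric] by (simp add: comb3_def)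
  have indep_c: "indep3 (base_change f0) (base_change f1) (base_change f2)"
    by (rule indep3_base_change[OF indep])
  have segre: "?c (x0, x1, x2) \<in> segre n \<longleftrightarrow> (x0, x1, x2) \<noteq> 0 \<and> y0 * y2 - y1 * y1 = 0"
    if y: "smul x0 ?n0 + smul x1 ?n1 + smul x2 ?n2 = (y0, y1, y2)" for x0 x1 x2 y0 y1 y2
  proof -
    have "?G (y0, y1, y2) = 0 \<longleftrightarrow> (x0, x1, x2) = 0"
      unfolding y[symmetric] c[symmetric] by (rule comb3_eq_0_iff[OF indep_c])
    then have "(y0, y1, y2) = 0 \<longleftrightarrow> (x0, x1, x2) = 0"
      using comb3_eq_0_iff[OF indep3_bilinear[OF indep2_base_change[OF g(3)]
        base_change_homog[OF g(1)] base_change_homog[OF g(2)]]] by blast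
    then show ?thesis
      unfolding c y bilinear_in_segre_iff[OF base_change_homog[OF g(1)] base_change_homog[OF g(2)]
        indep2_base_change[OF g(3)]] by blast
  qed
  \<comment> \<open>The matrix of \<open>y\<^sub>0 y\<^sub>2 - y\<^sub>1 y\<^sub>1\<close>, where row \<open>j\<close> uses the coordinates \<open>N\<^sub>j = (a\<^sub>j, b\<^sub>j, d\<^sub>j)\<close> of \<open>f\<^sub>j\<close> in the bilinear basis.\<close>
  define A where "A = mat_of_rows_list 3
    [[a0 * d0 - b0 * b0, a0 * d1 - b0 * b1, a0 * d2 - b0 * b2],
     [a1 * d0 - b1 * b0, a1 * d1 - b1 * b1, a1 * d2 - b1 * b2],
     [a2 * d0 - b2 * b0, a2 * d1 - b2 * b1, a2 * d2 - b2 * b2]]"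
  have A: "A \<in> carrier_mat 3 3"
    unfolding A_def by (rule mat_of_rows_list_carrier) simp
  define B where "B = map_mat (to_ac :: 'k \<Rightarrow> 'k alg_closure) A"
  have B: "B \<in> carrier_mat 3 3" using A by (simp add: B_def)
  have entries: "B $$ (0,0) = to_ac (a0 * d0 - b0 * b0)" "B $$ (0,1) = to_ac (a0 * d1 - b0 * b1)"
    "B $$ (0,2) = to_ac (a0 * d2 - b0 * b2)" "B $$ (1,0) = to_ac (a1 * d0 - b1 * b0)"
    "B $$ (1,1) = to_ac (a1 * d1 - b1 * b1)" "B $$ (1,2) = to_ac (a1 * d2 - b1 * b2)"
    "B $$ (2,0) = to_ac (a2 * d0 - b2 * b0)" "B $$ (2,1) = to_ac (a2 * d1 - b2 * b1)"
    "B $$ (2,2) = to_ac (a2 * d2 - b2 * b2)"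
    using A by (simp_all add: B_def) (simp_all add: A_def mat_of_rows_list_index)
  have quad: "vec3 (x0, x1, x2) \<bullet> (B *\<^sub>v vec3 (x0, x1, x2)) = y0 * y2 - y1 * y1"
    if y: "smul x0 ?n0 + smul x1 ?n1 + smul x2 ?n2 = (y0, y1, y2)" for x0 x1 x2 y0 y1 y2
  proof -
    have yy: "y0 = x0 * to_ac a0 + x1 * to_ac a1 + x2 * to_ac a2"
      "y1 = x0 * to_ac b0 + x1 * to_ac b1 + x2 * to_ac b2"
      "y2 = x0 * to_ac d0 + x1 * to_ac d1 + x2 * to_ac d2"
      using y by (simp_all add: N_abc to_ac3_def)
    show ?thesis
      unfolding quadratic_form_vec3[OF B] ternary_form.q.simps entries yy
      by (simp add: algebra_simps)
  qed
  have grad: "(B + transpose_mat B) *\<^sub>v vec3 (x0, x1, x2) =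
      vec3 (dot ?n0 (y2, - 2 * y1, y0), dot ?n1 (y2, - 2 * y1, y0), dot ?n2 (y2, - 2 * y1, y0))"
    if y: "smul x0 ?n0 + smul x1 ?n1 + smul x2 ?n2 = (y0, y1, y2)" for x0 x1 x2 y0 y1 y2
  proof -
    have yy: "y0 = x0 * to_ac a0 + x1 * to_ac a1 + x2 * to_ac a2"
      "y1 = x0 * to_ac b0 + x1 * to_ac b1 + x2 * to_ac b2"
      "y2 = x0 * to_ac d0 + x1 * to_ac d1 + x2 * to_ac d2"
      using y by (simp_all add: N_abc to_ac3_def)
    show ?thesis
      unfolding gradient_vec3[OF B] ternary_form.grad.simps entries yy
      by (simp add: N_abc to_ac3_def algebra_simps)
  qed
  have mem: "vec3 (x0, x1, x2) \<in> segre_section n [f0, f1, f2] \<longleftrightarrow>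
      (x0, x1, x2) \<noteq> 0 \<and> vec3 (x0, x1, x2) \<bullet> (B *\<^sub>v vec3 (x0, x1, x2)) = 0" for x0 x1 x2
  proof -
    obtain y0 y1 y2 where y: "smul x0 ?n0 + smul x1 ?n1 + smul x2 ?n2 = (y0, y1, y2)"
      by (cases "smul x0 ?n0 + smul x1 ?n1 + smul x2 ?n2")
    show ?thesis
      unfolding vec3_in_segre_section segre[OF y] quad[OF y] ..
  qed
  have conic: "segre_section n [f0, f1, f2] =
      {x \<in> carrier_vec 3. x \<noteq> 0\<^sub>v 3 \<and> x \<bullet> (B *\<^sub>v x) = 0}" (is "?L = ?R")
  proof (intro equalityI subsetI)
    fix v assume v: "v \<in> ?L"
    then have "v \<in> carrier_vec 3" by (simp add: segre_section_def numeral_3_eq_3)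
    then obtain x where "v = vec3 x" by (rule vec3_cases)
    moreover obtain x0 x1 x2 where "x = (x0, x1, x2)" by (cases x)
    ultimately show "v \<in> ?R"
      using v mem[of x0 x1 x2] vec3_eq_0_iff[of x] by simp
  next
    fix v assume v: "v \<in> ?R"
    then obtain x where "v = vec3 x" using vec3_cases by blast
    moreover obtain x0 x1 x2 where "x = (x0, x1, x2)" by (cases x)
    ultimately show "v \<in> ?L"
      using v mem[of x0 x1 x2] vec3_eq_0_iff[of x] by simp
  qed
  have smooth: "(B + transpose_mat B) *\<^sub>v v \<noteq> 0\<^sub>v 3" if v: "v \<in> ?L" for v
  proof
    assume zero: "(B + transpose_mat B) *\<^sub>v v = 0\<^sub>v 3"
    have "v \<in> carrier_vec 3" using v by (simp add: segre_section_def numeral_3_eq_3)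
    then obtain x where vx: "v = vec3 x" by (rule vec3_cases)
    obtain x0 x1 x2 where x: "x = (x0, x1, x2)" by (cases x)
    obtain y0 y1 y2 where y: "smul x0 ?n0 + smul x1 ?n1 + smul x2 ?n2 = (y0, y1, y2)"
      by (cases "smul x0 ?n0 + smul x1 ?n1 + smul x2 ?n2")
    let ?z = "(y2, - 2 * y1, y0)"
    have "dot ?n0 ?z = 0" "dot ?n1 ?z = 0" "dot ?n2 ?z = 0"
      using zero unfolding vx x grad[OF y] vec3_eq_0_iff by (simp_all add: zero_prod_def)
    then have "dot ?z (to_ac3 (smul u0 N0 + smul u1 N1 + smul u2 N2)) = 0" for u0 u1 u2
      unfolding to_ac3_add to_ac3_smul dot_add dot_smul dot_commute[of ?z] by simp
    then have z: "dot ?z (to_ac3 e) = 0" for e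
      using M[of e] by metis
    have "y2 = 0" "y0 = 0"
      using z[of "(1, 0, 0)"] z[of "(0, 0, 1)"] by (simp_all add: to_ac3_def)
    moreover have "vec3 (x0, x1, x2) \<in> ?L"
      using v unfolding vx x .
    then have "(x0, x1, x2) \<noteq> 0" "y0 * y2 - y1 * y1 = 0"
      unfolding vec3_in_segre_section segre[OF y] by blast+
    ultimately have "(y0, y1, y2) = 0"
      by (simp add: zero_prod_def)
    then have "?c (x0, x1, x2) = 0"
      unfolding c y by (simp add: comb3_def zero_prod_def scale_simps)
    then show False
      using comb3_eq_0_iff[OF indep_c] \<open>(x0, x1, x2) \<noteq> 0\<close> by blast
  qed
  show ?thesis
    unfolding smooth_conic_def Let_def
    by (rule bexI[OF conjI A]) (use conic smooth in \<open>simp_all only: B_def, blast\<close>)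
qed

lemma coef_mult_homog:
  fixes r h :: "'k::field bipoly"
  assumes "h \<in> homog a" "bideg m = a"
  shows "coef (r * h) m = coef r 0 * coef h m"
proof -
  define r' where "r' = r - const (coef r 0)"
  have "coef r' 0 = 0"
    by (simp add: r'_def lookup_minus const_def)
  have "coef (r' * h) m = 0"
  proof (rule ccontr)
    assume "coef (r' * h) m \<noteq> 0"
    then obtain m1 m2 where m: "m = m1 + m2" "coef r' m1 \<noteq> 0" "coef h m2 \<noteq> 0"
      by (rule coef_mult_nonzero)
    have "bideg m2 = a" using assms(1) m(3) by (rule homogD)
    then have "bideg m1 = (0, 0)"
      using assms(2) unfolding m(1) bideg_add by (simp add: zero_prod_def)
    then have "m1 = 0" by (rule bideg_eq_0)
    with m(2) \<open>coef r' 0 = 0\<close> show False by simp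
  qed
  moreover have "r * h = r' * h + scale (coef r 0) h"
    by (simp add: r'_def scale_def algebra_simps)
  ultimately show ?thesis by (simp add: lookup_add)
qed

text \<open>
  Only the constant terms of the coefficients contribute to the bidegree \<open>a\<close>.
\<close>

lemma combination_of_homog:
  fixes p :: "'k::field bipoly"
  assumes "p \<in> homog a" "h0 \<in> homog a" "h1 \<in> homog a" "h2 \<in> homog a"
    and p: "p = r0 * h0 + r1 * h1 + r2 * h2"
  shows "p = scale (coef r0 0) h0 + scale (coef r1 0) h1 + scale (coef r2 0) h2"
proof (rule poly_mapping_eqI)
  fix m
  show "coef p m = coef (scale (coef r0 0) h0 + scale (coef r1 0) h1 + scale (coef r2 0) h2) m"
  proof (cases "bideg m = a")
    case True
    show ?thesis
      unfolding p lookup_add coef_scale coef_mult_homog[OF assms(2) True]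
        coef_mult_homog[OF assms(3) True] coef_mult_homog[OF assms(4) True] by (rule refl)
  next
    case False
    then have "coef p m = 0" "coef h0 m = 0" "coef h1 m = 0" "coef h2 m = 0"
      using assms(1-4) homogD by blast+
    then show ?thesis by (simp add: lookup_add)
  qed
qed

lemma coef_mult_homog_0:
  fixes p x :: "'k::field bipoly"
  assumes "p \<in> homog \<alpha>" "\<not> (fst \<alpha> \<le> fst (bideg m) \<and> snd \<alpha> \<le> snd (bideg m))"
  shows "coef (p * x) m = 0"
proof (rule ccontr)
  assume "coef (p * x) m \<noteq> 0"
  then obtain m1 m2 where m: "m = m1 + m2" "coef p m1 \<noteq> 0" "coef x m2 \<noteq> 0"
    by (rule coef_mult_nonzero)
  have "bideg m1 = \<alpha>" using assms(1) m(2) by (rule homogD)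
  then show False
    using assms(2) bideg_nonneg[of m2] unfolding m(1) bideg_add by simp
qed

lemma index_mult_mat_vec_sum:
  assumes "M \<in> carrier_mat m k" "v \<in> carrier_vec k" "i < m"
  shows "(M *\<^sub>v v) $ i = (\<Sum>l<k. M $$ (i, l) * v $ l)"
  using assms by (simp add: scalar_prod_def lessThan_atLeast0)

lemma coef_sum: "coef (\<Sum>l\<in>A. h l) m = (\<Sum>l\<in>A. coef (h l) m)"
  by (induction A rule: infinite_finite_induct) (simp_all add: lookup_add)

lemma coef_irrelevant_mult:
  fixes M :: "'k::field bipoly mat"
  assumes M: "M \<in> carrier_mat m k" "elements_mat M \<subseteq> ideal_gen {var VS, var VT, var VU, var VV}"
    and v: "v \<in> carrier_vec k" and i: "i < m"
  shows "coef ((M *\<^sub>v v) $ i) 0 = 0"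
proof -
  have "coef (M $$ (i, l) * v $ l) 0 = 0" if "l < k" for l
  proof (rule ccontr)
    assume "coef (M $$ (i, l) * v $ l) 0 \<noteq> 0"
    then obtain m1 m2 where m: "0 = m1 + m2" "coef (M $$ (i, l)) m1 \<noteq> 0"
      by (rule coef_mult_nonzero)
    have "bideg m1 + bideg m2 = (0, 0)"
      unfolding bideg_add[symmetric] m(1)[symmetric] by (simp add: bideg_def)
    then have "bideg m1 = (0, 0)"
      using bideg_nonneg[of m1] bideg_nonneg[of m2] by (cases "bideg m1"; cases "bideg m2") auto
    then have "m1 = 0" by (rule bideg_eq_0)
    moreover have "M $$ (i, l) \<in> elements_mat M"
      using M(1) i that by (intro elements_matI) auto
    then have "coef (M $$ (i, l)) 0 = 0"
      using M(2) irrelevant_coef_0 by blast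
    ultimately show False using m(2) by simp
  qed
  then show ?thesis
    unfolding index_mult_mat_vec_sum[OF M(1) v i] coef_sum by simp
qed

lemma homog_20E:
  fixes q :: "'k::field bipoly"
  assumes "q \<in> homog (2, 0)"
  obtains \<alpha> \<beta> \<gamma> where "q = scale \<alpha> (var VS ^ 2) + scale \<beta> (var VS * var VT) + scale \<gamma> (var VT ^ 2)"
proof -
  obtain a b where ab: "q = var VS * a + var VT * b" "a \<in> homog (1, 0)" "b \<in> homog (1, 0)"
    using homog_st_split[OF assms] by auto
  obtain a0 a1 where a: "a = var VS * a0 + var VT * a1" "a0 \<in> homog (0, 0)" "a1 \<in> homog (0, 0)"
    using homog_st_split[OF ab(2)] by auto
  obtain b0 b1 where b: "b = var VS * b0 + var VT * b1" "b0 \<in> homog (0, 0)" "b1 \<in> homog (0, 0)"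
    using homog_st_split[OF ab(3)] by auto
  obtain c0 where c0: "a0 = const c0" using homog_00_const[OF a(2)] .
  obtain c1 where c1: "a1 = const c1" using homog_00_const[OF a(3)] .
  obtain d0 where d0: "b0 = const d0" using homog_00_const[OF b(2)] .
  obtain d1 where d1: "b1 = const d1" using homog_00_const[OF b(3)] .
  have "q = scale c0 (var VS ^ 2) + scale (c1 + d0) (var VS * var VT) + scale d1 (var VT ^ 2)"
    unfolding ab a b c0 c1 d0 d1 scale_def const_add by (simp add: algebra_simps power2_eq_square)
  then show thesis by (rule that)
qed

text \<open>
  Let \<open>h\<close> be the row \<open>d 0\<close> of generators. They lie in \<open>W\<close>, and by minimality they are linearly
  independent and each summand of the next module gives a nonzero column of \<open>d 1\<close>. The
  column of degree \<open>(3, n)\<close> is a syzygy of bidegree \<open>(2, 0)\<close>. A syzygy of bidegree \<open>(1, 0)\<close> would lie in the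
  image of \<open>d 1\<close>, whose columns have bidegrees \<open>(0, 2 n)\<close>, \<open>(1, n)\<close> and \<open>(2, 0)\<close>, so it is zero.
\<close>

lemma smooth_conic_if_betti:
  fixes n :: nat and W :: "'k::field bipoly set" and f0 f1 f2 :: "'k bipoly"
  assumes n: "n > 0" and W: "W = lin_span {f0, f1, f2}" and dim: "lin_dim W = 3"
    and hom: "W \<subseteq> homog (1, int n)"
    and betti: "has_bigraded_betti (ideal_gen W)
      [replicate_mset 3 (1, int n),
       {#(1, 3 * int n)#} + replicate_mset 3 (2, 2 * int n) + {#(3, int n)#},
       replicate_mset 2 (2, 3 * int n) + replicate_mset 2 (3, 2 * int n),
       {#(3, 3 * int n)#}]"
  shows "smooth_conic (segre_section n [f0, f1, f2])"
proof -
  define N where "N = int n"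
  have N: "N > 0" using n by (simp add: N_def)
  have indep: "indep3 f0 f1 f2"
    using indep3_if_dim_3 dim unfolding W .
  have "f0 \<in> W" "f1 \<in> W" "f2 \<in> W"
    unfolding W by (rule lin_span_base, simp)+
  then have hom_f: "f0 \<in> homog (1, N)" "f1 \<in> homog (1, N)" "f2 \<in> homog (1, N)"
    using hom unfolding N_def by blast+
  define F :: "(int \<times> int) multiset list" where "F = [replicate_mset 3 (1, N),
       {#(1, 3 * N)#} + replicate_mset 3 (2, 2 * N) + {#(3, N)#},
       replicate_mset 2 (2, 3 * N) + replicate_mset 2 (3, 2 * N),
       {#(3, 3 * N)#}]"
  have "has_bigraded_betti (ideal_gen W) F"
    using betti unfolding F_def N_def .
  then obtain a d where res: "minimal_bigraded_free_resolution (ideal_gen W) a d"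
    and ms: "\<And>i. mset (a i) = (if i < length F then F ! i else {#})"
    unfolding has_bigraded_betti_def by blast
  have ms0: "mset (a 0) = replicate_mset 3 (1, N)"
    using ms[of 0] by (simp add: F_def)
  have ms1: "mset (a 1) = {#(1, 3 * N)#} + replicate_mset 3 (2, 2 * N) + {#(3, N)#}"
    using ms[of 1] by (simp add: F_def)
  have len0: "length (a 0) = 3"
    using arg_cong[OF ms0, of size] by simp
  have a0: "a 0 ! j = (1, N)" if "j < 3" for j
  proof -
    have "a 0 ! j \<in># mset (a 0)" using that len0 by simp
    then show ?thesis unfolding ms0 by (simp split: if_splits)
  qed
  define K where "K = length (a 1)"
  have a1: "a 1 ! l \<in> {(1, 3 * N), (2, 2 * N), (3, N)}" if "l < K" for l
  proof -
    have "a 1 ! l \<in># mset (a 1)" using that unfolding K_def by simp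
    then show ?thesis unfolding ms1 by (auto split: if_splits)
  qed
  have "(3, N) \<in># mset (a 1)"
    unfolding ms1 by simp
  then obtain k where k: "k < K" "a 1 ! k = (3, N)"
    unfolding K_def set_mset_mset in_set_conv_nth by blast
  have g0: "graded_map (a 0) [(0, 0)] (d 0)" and g1: "graded_map (a 1) (a 0) (d 1)"
    and g2: "graded_map (a 2) (a 1) (d 2)"
    and im: "(\<lambda>x. (d 0 *\<^sub>v x) $ 0) ` carrier_vec (length (a 0)) = ideal_gen W"
    and ex0: "mat_kernel (d 0) = (\<lambda>x. d 1 *\<^sub>v x) ` carrier_vec (length (a 1))"
    and ex1: "mat_kernel (d 1) = (\<lambda>x. d 2 *\<^sub>v x) ` carrier_vec (length (a 2))"
    and min1: "elements_mat (d 1) \<subseteq> ideal_gen {var VS, var VT, var VU, var VV}"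
    and min2: "elements_mat (d 2) \<subseteq> ideal_gen {var VS, var VT, var VU, var VV}"
    using res unfolding minimal_bigraded_free_resolution_def bigraded_free_resolution_def
    by (simp_all add: numeral_2_eq_2)
  define L where "L = length (a 2)"
  have i0: "(0 :: nat) < 1" by simp
  have d0: "d 0 \<in> carrier_mat 1 3"
    using g0 unfolding graded_map_def len0 by simp
  have d1: "d 1 \<in> carrier_mat 3 K"
    using g1 unfolding graded_map_def len0 K_def by blast
  have d2: "d 2 \<in> carrier_mat K L"
    using g2 unfolding graded_map_def K_def L_def by blast
  define h where "h j = d 0 $$ (0, j)" for j
  have h_hom: "h j \<in> homog (1, N)" if "j < 3" for j
    using g0 that a0[OF that] unfolding graded_map_def h_def len0 by fastforce
  have sum3: "(\<Sum>l<3. x l) = x 0 + x 1 + x 2" for x :: "nat \<Rightarrow> 'k bipoly"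
    by (simp add: numeral_3_eq_3 numeral_2_eq_2)
  have d0_mult: "(d 0 *\<^sub>v v) $ 0 = h 0 * v $ 0 + h 1 * v $ 1 + h 2 * v $ 2"
    if "v \<in> carrier_vec 3" for v :: "'k bipoly vec"
    unfolding index_mult_mat_vec_sum[OF d0 that i0] sum3 h_def ..
  have ideal_mem: "\<exists>r0 r1 r2. p = r0 * h 0 + r1 * h 1 + r2 * h 2" if p: "p \<in> ideal_gen W" for p
  proof -
    obtain v where v: "v \<in> carrier_vec 3" "p = (d 0 *\<^sub>v v) $ 0"
      using p unfolding im[symmetric] len0 by blast
    show ?thesis
      unfolding v(2) d0_mult[OF v(1)] by (metis mult.commute)
  qed
  have kernel0: "\<exists>x \<in> carrier_vec K. v = d 1 *\<^sub>v x"
    if v: "v \<in> carrier_vec 3" "h 0 * v $ 0 + h 1 * v $ 1 + h 2 * v $ 2 = 0" for v :: "'k bipoly vec"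
  proof -
    have "(d 0 *\<^sub>v v) $ 0 = 0"
      unfolding d0_mult[OF v(1)] by (rule v(2))
    then have "v \<in> mat_kernel (d 0)"
      unfolding in_kernel_iff[OF d0] using v(1) by simp
    then show ?thesis unfolding ex0 K_def by blast
  qed
  have vec3_index: "vec3 (x0, x1, x2) $ 1 = x1" for x0 x1 x2 :: "'k bipoly"
    by simp
  have h_W: "h j \<in> W" if j: "j < 3" for j
  proof -
    have "(d 0 *\<^sub>v unit_vec 3 j) $ 0 = h j"
      unfolding index_mult_mat_vec_sum[OF d0 unit_vec_carrier i0] h_def
      using j by (simp add: if_distrib[of "\<lambda>x. _ * x"] cong: if_cong)
    then have "h j \<in> ideal_gen W"
      unfolding im[symmetric] len0 using unit_vec_carrier[of 3 j] by (metis (no_types, lifting) image_eqI)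
    then have "h j \<in> ideal_gen {f0, f1, f2}"
      unfolding W ideal_gen_lin_span .
    then obtain r0 r1 r2 where "h j = r0 * f0 + r1 * f1 + r2 * f2"
      by (rule ideal_gen_tripleE)
    from combination_of_homog[OF h_hom[OF j] hom_f this] show ?thesis
      unfolding W lin_span_triple by blast
  qed
  note h_W3 = h_W[of 0, simplified] h_W[of 1, simplified] h_W[of 2, simplified]
  note h_hom3 = h_hom[of 0, simplified] h_hom[of 1, simplified] h_hom[of 2, simplified]
  have h_comb: "scale x0 (h 0) + scale x1 (h 1) + scale x2 (h 2) \<in> W" for x0 x1 x2
    using lin_span_add lin_span_scale h_W3 unfolding W by (metis One_nat_def)
  have h_indep: "\<alpha>0 = 0 \<and> \<alpha>1 = 0 \<and> \<alpha>2 = 0"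
    if \<alpha>: "scale \<alpha>0 (h 0) + scale \<alpha>1 (h 1) + scale \<alpha>2 (h 2) = 0" for \<alpha>0 \<alpha>1 \<alpha>2
  proof -
    let ?v = "vec3 (const \<alpha>0, const \<alpha>1, const \<alpha>2)"
    have "h 0 * ?v $ 0 + h 1 * ?v $ 1 + h 2 * ?v $ 2 = 0"
      using \<alpha> by (simp add: scale_def mult.commute)
    then obtain x where x: "x \<in> carrier_vec K" "?v = d 1 *\<^sub>v x"
      using kernel0 by (metis vec3_simps(2))
    have "coef (?v $ j) 0 = 0" if "j < 3" for j
      unfolding x(2) by (rule coef_irrelevant_mult[OF d1 min1 x(1) that])
    from this[of 0] this[of 1] this[of 2] show ?thesis
      by (simp add: const_def)
  qed
  define q where "q j = d 1 $$ (j, k)" for j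
  have q_hom: "q j \<in> homog (2, 0)" if "j < 3" for j
    using g1 that a0[OF that] k unfolding graded_map_def q_def len0 K_def by fastforce
  have col: "(d 1 *\<^sub>v unit_vec K k) $ j = q j" if "j < 3" for j
    unfolding index_mult_mat_vec_sum[OF d1 unit_vec_carrier that] q_def
    using k(1) by (simp add: if_distrib[of "\<lambda>x. _ * x"] cong: if_cong)
  have q_syz: "h 0 * q 0 + h 1 * q 1 + h 2 * q 2 = 0"
  proof -
    have v: "d 1 *\<^sub>v unit_vec K k \<in> carrier_vec 3"
      using d1 by (rule mult_mat_vec_carrier) (rule unit_vec_carrier)
    have "d 1 *\<^sub>v unit_vec K k \<in> mat_kernel (d 0)"
      unfolding ex0 K_def by (rule imageI) (rule unit_vec_carrier)
    then have "(d 0 *\<^sub>v (d 1 *\<^sub>v unit_vec K k)) $ 0 = 0"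
      unfolding in_kernel_iff[OF d0] by simp
    then show ?thesis
      unfolding d0_mult[OF v] using col[of 0] col[of 1] col[of 2] by simp
  qed
  \<comment> \<open>Were the column zero, a basis vector would lie in the image of d 2, against minimality.\<close>
  have q_nz: "\<not> (q 0 = 0 \<and> q 1 = 0 \<and> q 2 = 0)"
  proof
    assume "q 0 = 0 \<and> q 1 = 0 \<and> q 2 = 0"
    then have "(d 1 *\<^sub>v unit_vec K k) $ j = 0" if "j < 3" for j
      using col[OF that] that by (auto simp: less_Suc_eq numeral_3_eq_3 numeral_2_eq_2)
    then have "unit_vec K k \<in> mat_kernel (d 1)"
      unfolding in_kernel_iff[OF d1] by (simp del: index_mult_mat_vec)
    then obtain x where x: "x \<in> carrier_vec L" "unit_vec K k = d 2 *\<^sub>v x"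
      unfolding ex1 L_def by blast
    have "coef ((unit_vec K k :: 'k bipoly vec) $ k) 0 = 0"
      unfolding x(2) by (rule coef_irrelevant_mult[OF d2 min2 x(1) k(1)])
    then show False using k(1) by simp
  qed
  obtain \<alpha>0 \<beta>0 \<gamma>0 where q0: "q 0 = scale \<alpha>0 (var VS ^ 2) + scale \<beta>0 (var VS * var VT) + scale \<gamma>0 (var VT ^ 2)"
    using homog_20E[OF q_hom[of 0]] by auto
  obtain \<alpha>1 \<beta>1 \<gamma>1 where q1: "q 1 = scale \<alpha>1 (var VS ^ 2) + scale \<beta>1 (var VS * var VT) + scale \<gamma>1 (var VT ^ 2)"
    using homog_20E[OF q_hom[of 1]] by auto
  obtain \<alpha>2 \<beta>2 \<gamma>2 where q2: "q 2 = scale \<alpha>2 (var VS ^ 2) + scale \<beta>2 (var VS * var VT) + scale \<gamma>2 (var VT ^ 2)"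
    using homog_20E[OF q_hom[of 2]] by auto
  define F0 where "F0 = scale \<alpha>0 (h 0) + scale \<alpha>1 (h 1) + scale \<alpha>2 (h 2)"
  define F1 where "F1 = scale \<beta>0 (h 0) + scale \<beta>1 (h 1) + scale \<beta>2 (h 2)"
  define F2 where "F2 = scale \<gamma>0 (h 0) + scale \<gamma>1 (h 1) + scale \<gamma>2 (h 2)"
  have F_W: "F0 \<in> W" "F1 \<in> W" "F2 \<in> W"
    unfolding F0_def F1_def F2_def by (rule h_comb)+
  have "var VS ^ 2 * F0 + var VS * var VT * F1 + var VT ^ 2 * F2 = h 0 * q 0 + h 1 * q 1 + h 2 * q 2"
    unfolding q0 q1 q2 F0_def F1_def F2_def scale_def by (simp add: algebra_simps)
  with q_syz have syz: "var VS ^ 2 * F0 + var VS * var VT * F1 + var VT ^ 2 * F2 = 0"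
    by simp
  have F_nz: "\<not> (F0 = 0 \<and> F1 = 0 \<and> F2 = 0)"
  proof
    assume "F0 = 0 \<and> F1 = 0 \<and> F2 = 0"
    then have "\<alpha>0 = 0 \<and> \<alpha>1 = 0 \<and> \<alpha>2 = 0" "\<beta>0 = 0 \<and> \<beta>1 = 0 \<and> \<beta>2 = 0"
      "\<gamma>0 = 0 \<and> \<gamma>1 = 0 \<and> \<gamma>2 = 0"
      unfolding F0_def F1_def F2_def using h_indep by blast+
    then show False using q_nz unfolding q0 q1 q2 by (simp add: scale_simps)
  qed
  have lin: "G0 = 0" if G: "G0 \<in> W" "G1 \<in> W" "var VS * G0 + var VT * G1 = 0" for G0 G1
  proof -
    have comb: "\<exists>x0 x1 x2. G = scale x0 (h 0) + scale x1 (h 1) + scale x2 (h 2)" if "G \<in> W" for G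
    proof -
      have "G \<in> ideal_gen W"
        unfolding ideal_gen_def by (rule Modules.module.span_base[OF module_times that])
      then obtain r0 r1 r2 where r: "G = r0 * h 0 + r1 * h 1 + r2 * h 2"
        using ideal_mem by blast
      have "G \<in> homog (1, N)" using hom that unfolding N_def by blast
      from combination_of_homog[OF this h_hom[of 0] h_hom[of 1] h_hom[of 2] r] show ?thesis by auto
    qed
    obtain x0 x1 x2 where x: "G0 = scale x0 (h 0) + scale x1 (h 1) + scale x2 (h 2)"
      using comb[OF G(1)] by blast
    obtain y0 y1 y2 where y: "G1 = scale y0 (h 0) + scale y1 (h 1) + scale y2 (h 2)"
      using comb[OF G(2)] by blast
    \<comment> \<open>The syzygy between G0 and G1, written as a vector in the kernel of \<open>d 0\<close>; at \<open>s\<close> it has the coefficients of G0.\<close>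
    define z where "z x y = var VS * const x + var VT * const y" for x y :: 'k
    let ?v = "vec3 (z x0 y0, z x1 y1, z x2 y2)"
    have "h 0 * ?v $ 0 + h 1 * ?v $ 1 + h 2 * ?v $ 2 = var VS * G0 + var VT * G1"
      unfolding x y vec3_index vec3_simps z_def scale_def by (simp add: algebra_simps)
    then obtain w where w: "w \<in> carrier_vec K" "?v = d 1 *\<^sub>v w"
      using kernel0[of ?v] G(3) by auto
    have "coef (?v $ j) (mvar VS) = 0" if j: "j < 3" for j
    proof -
      have "coef (d 1 $$ (j, l) * w $ l) (mvar VS) = 0" if l: "l < K" for l
      proof (rule coef_mult_homog_0)
        show "d 1 $$ (j, l) \<in> homog (a 1 ! l - a 0 ! j)"
          using g1 j l unfolding graded_map_def len0 K_def by blast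
        show "\<not> (fst (a 1 ! l - a 0 ! j) \<le> fst (bideg (mvar VS)) \<and>
            snd (a 1 ! l - a 0 ! j) \<le> snd (bideg (mvar VS)))"
          using a1[OF l] a0[OF j] N unfolding bideg_mvar by auto
      qed
      then show ?thesis
        unfolding w(2) index_mult_mat_vec_sum[OF d1 w(1) j] coef_sum by simp
    qed
    moreover have "coef (z x y) (mvar VS) = x" for x y
    proof -
      have "coef (var VS * const x) (mvar VS + 0) = x"
        unfolding coef_var_mult by (simp add: const_def)
      moreover have "coef (var VT * const y) (mvar VS) = 0"
        by (rule coef_var_mult_0) (simp add: lookup_single)
      ultimately show ?thesis by (simp add: z_def lookup_add)
    qed
    ultimately have "x0 = 0" "x1 = 0" "x2 = 0"
      using vec3_simps(3-5) by (metis less_numeral_extra(1) numeral_3_eq_3 zero_less_Suc lessI One_nat_def Suc_less_eq numeral_2_eq_2)+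
    then show "G0 = 0" unfolding x by (simp add: scale_simps)
  qed
  obtain g0 g1 where g: "g0 \<in> homog (0, int n)" "g1 \<in> homog (0, int n)" "indep2 g0 g1"
    "W = lin_span {var VS * g0, var VT * g0 + var VS * g1, var VT * g1}"
    by (rule bilinear_form[OF W hom F_W F_nz syz lin])
  show ?thesis
    by (rule smooth_conic_if_bilinear_form[OF g(1-3) indep]) (use W g(4) in simp)
qed

theorem theorem4p7:
  fixes n :: nat and W :: "'k::field bipoly set" and f0 f1 f2 :: "'k bipoly"
  assumes "n > 0"
    and "W = lin_span {f0, f1, f2}" and "lin_dim W = 3"
    and "W \<subseteq> homog (1, int n)"
    and "basepoint_free W"
  shows "smooth_conic (segre_section n [f0, f1, f2]) \<longleftrightarrow>
    has_bigraded_betti (ideal_gen W)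
      [replicate_mset 3 (1, int n),
       {#(1, 3 * int n)#} + replicate_mset 3 (2, 2 * int n) + {#(3, int n)#},
       replicate_mset 2 (2, 3 * int n) + replicate_mset 2 (3, 2 * int n),
       {#(3, 3 * int n)#}]"
  using assms betti_if_smooth_conic[of n W f0 f1 f2] smooth_conic_if_betti[of n W f0 f1 f2]
  by blast

end
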